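(* Let $E=(\mathbb{R}^2,\|\cdot\|)$ be a two-dimensional real normed space such that the standard basis $\{e_1,e_2\}$ is a sign-symmetric normalized basis of $E$ (so $\|e_1\|=\|e_2\|=1$), and such that the norm is smooth at $e_2$. Put $\varphi(t)=\|e_1+te_2\|$ for $t\in\mathbb{R}$, and assume that $\varphi$ is of class $C^2(\mathbb{R})$. Let $\mathrm{H}(E)$ be the vector space $\mathbb{R}\oplus\ell_2$ equipped with the norm $$\|(t,(a_i)_{i\ge 1})\|_{\mathrm{H}(E)}=\Big\|\Big(\sum_{i=1}^\infty a_i^2\Big)^{1/2}e_1+te_2\Big\|.$$ Then $\mathrm{H}(E)$ is an $L_1$-subspace if and only if the function $t\mapsto\varphi''(\sqrt{t})$ is completely monotone in $[0,\infty)$.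
   Context: All vector spaces are over $\mathbb{R}$. A normed space is called an $L_1$-subspace if it is linearly isometric to a subspace of $L_1(0,1)$. A basis $\{f_1,f_2\}$ of a two-dimensional normed space is sign-symmetric if for all scalars $a_1,a_2$ the vectors $-a_1f_1+a_2f_2$ and $a_1f_1+a_2f_2$ have the same norm. The norm is smooth at $e_2$ if it is differentiable at $e_2$ (equivalently, $t\mapsto\|e_2-te_1\|$ is differentiable at $t=0$). A real-valued function $f$ is completely monotone in $(0,\infty)$ if it is infinitely differentiable there and $(-1)^kf^{(k)}(t)\ge 0$ for all $t>0$ and $k=0,1,2,\dots$; if in addition $f$ is defined and right-continuous at zero, it is completely monotone in $[0,\infty)$. *)

theory Defs
  imports "HOL-Analysis.Analysis"
begin

text \<open>A norm as a function, because the norms on \<open>\<real>\<^sup>2\<close> and on \<open>\<real> \<oplus> \<ell>\<^sub>2\<close> considered here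
  differ from the type class norms.\<close>

definition is_norm :: "('a::real_vector \<Rightarrow> real) \<Rightarrow> bool" where
  "is_norm N \<longleftrightarrow>
     (\<forall>x. N x = 0 \<longleftrightarrow> x = 0) \<and>
     (\<forall>c x. N (c *\<^sub>R x) = \<bar>c\<bar> * N x) \<and>
     (\<forall>x y. N (x + y) \<le> N x + N y)"

definition sign_symmetric :: "('a::real_vector \<Rightarrow> real) \<Rightarrow> 'a \<Rightarrow> 'a \<Rightarrow> bool" where
  "sign_symmetric N f\<^sub>1 f\<^sub>2 \<longleftrightarrow>
     (\<forall>a\<^sub>1 a\<^sub>2. N (- a\<^sub>1 *\<^sub>R f\<^sub>1 + a\<^sub>2 *\<^sub>R f\<^sub>2) = N (a\<^sub>1 *\<^sub>R f\<^sub>1 + a\<^sub>2 *\<^sub>R f\<^sub>2))"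

definition L1_eq :: "(real \<Rightarrow> real) \<Rightarrow> (real \<Rightarrow> real) \<Rightarrow> bool" where
  "L1_eq f g \<longleftrightarrow>
     integrable (lebesgue_on {0<..<1}) f \<and> integrable (lebesgue_on {0<..<1}) g \<and>
     (AE x in lebesgue_on {0<..<1}. f x = g x)"

quotient_type L1_01 = "real \<Rightarrow> real" / partial: L1_eq
proof (rule part_equivpI)
  show "\<exists>f. L1_eq f f"
    by (rule exI[of _ "\<lambda>_. 0"]) (simp add: L1_eq_def)
  show "symp L1_eq"
    by (rule sympI) (auto simp: L1_eq_def)
  show "transp L1_eq"
    by (rule transpI) (auto simp: L1_eq_def)
qed

instantiation L1_01 :: real_normed_vector
begin

lift_definition zero_L1_01 :: L1_01 is "\<lambda>_. 0"
  by (simp add: L1_eq_def)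

lift_definition plus_L1_01 :: "L1_01 \<Rightarrow> L1_01 \<Rightarrow> L1_01" is "\<lambda>f g x. f x + g x"
  by (auto simp: L1_eq_def)

lift_definition minus_L1_01 :: "L1_01 \<Rightarrow> L1_01 \<Rightarrow> L1_01" is "\<lambda>f g x. f x - g x"
  by (auto simp: L1_eq_def)

lift_definition uminus_L1_01 :: "L1_01 \<Rightarrow> L1_01" is "\<lambda>f x. - f x"
  by (auto simp: L1_eq_def)

lift_definition scaleR_L1_01 :: "real \<Rightarrow> L1_01 \<Rightarrow> L1_01" is "\<lambda>c f x. c * f x"
  by (auto simp: L1_eq_def)

lift_definition norm_L1_01 :: "L1_01 \<Rightarrow> real"
  is "\<lambda>f. integral\<^sup>L (lebesgue_on {0<..<1}) (\<lambda>x. \<bar>f x\<bar>)"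
  by (rule integral_cong_AE) (auto simp: L1_eq_def)

definition dist_L1_01 :: "L1_01 \<Rightarrow> L1_01 \<Rightarrow> real"
  where "dist_L1_01 x y = norm (x - y)"

definition sgn_L1_01 :: "L1_01 \<Rightarrow> L1_01"
  where "sgn_L1_01 x = inverse (norm x) *\<^sub>R x"

definition uniformity_L1_01 :: "(L1_01 \<times> L1_01) filter"
  where "uniformity_L1_01 = (INF e\<in>{0<..}. principal {(x, y). dist x y < e})"

definition open_L1_01 :: "L1_01 set \<Rightarrow> bool"
  where "open_L1_01 U \<longleftrightarrow> (\<forall>x\<in>U. eventually (\<lambda>(x', y). x' = x \<longrightarrow> y \<in> U) uniformity)"

instance
proof
  fix x y z :: L1_01 and a b :: real
  show "x + y + z = x + (y + z)"
    by transfer (auto simp: L1_eq_def add.assoc)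
  show "x + y = y + x"
    by transfer (auto simp: L1_eq_def add.commute)
  show "0 + x = x"
    by transfer (auto simp: L1_eq_def)
  show "- x + x = 0"
    by transfer (auto simp: L1_eq_def)
  show "x - y = x + - y"
    by transfer (auto simp: L1_eq_def)
  show "a *\<^sub>R (x + y) = a *\<^sub>R x + a *\<^sub>R y"
    by transfer (auto simp: L1_eq_def algebra_simps)
  show "(a + b) *\<^sub>R x = a *\<^sub>R x + b *\<^sub>R x"
    by transfer (auto simp: L1_eq_def algebra_simps)
  show "a *\<^sub>R b *\<^sub>R x = (a * b) *\<^sub>R x"
    by transfer (auto simp: L1_eq_def algebra_simps)
  show "1 *\<^sub>R x = x"
    by transfer (auto simp: L1_eq_def)
  show "dist x y = norm (x - y)"
    by (rule dist_L1_01_def)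
  show "sgn x = inverse (norm x) *\<^sub>R x"
    by (rule sgn_L1_01_def)
  show "uniformity = (INF e\<in>{0<..}. principal {(x, y :: L1_01). dist x y < e})"
    by (rule uniformity_L1_01_def)
  show "open U \<longleftrightarrow> (\<forall>x\<in>U. eventually (\<lambda>(x', y). x' = x \<longrightarrow> y \<in> U) uniformity)"
    for U :: "L1_01 set"
    by (rule open_L1_01_def)
  show "norm x = 0 \<longleftrightarrow> x = 0"
    by transfer (auto simp: L1_eq_def integral_nonneg_eq_0_iff_AE)
  show "norm (x + y) \<le> norm x + norm y"
  proof transfer
    fix f g assume "L1_eq f f" "L1_eq g g"
    then have f: "integrable (lebesgue_on {0<..<1}) f"
      and g: "integrable (lebesgue_on {0<..<1}) g"
      by (auto simp: L1_eq_def)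
    have "integral\<^sup>L (lebesgue_on {0<..<1}) (\<lambda>x. \<bar>f x + g x\<bar>)
        \<le> integral\<^sup>L (lebesgue_on {0<..<1}) (\<lambda>x. \<bar>f x\<bar> + \<bar>g x\<bar>)"
      using f g by (intro integral_mono) auto
    also have "\<dots> = integral\<^sup>L (lebesgue_on {0<..<1}) (\<lambda>x. \<bar>f x\<bar>)
        + integral\<^sup>L (lebesgue_on {0<..<1}) (\<lambda>x. \<bar>g x\<bar>)"
      using f g by (intro Bochner_Integration.integral_add) auto
    finally show "integral\<^sup>L (lebesgue_on {0<..<1}) (\<lambda>x. \<bar>f x + g x\<bar>)
        \<le> integral\<^sup>L (lebesgue_on {0<..<1}) (\<lambda>x. \<bar>f x\<bar>)
        + integral\<^sup>L (lebesgue_on {0<..<1}) (\<lambda>x. \<bar>g x\<bar>)" .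
  qed
  show "norm (a *\<^sub>R x) = \<bar>a\<bar> * norm x"
    by transfer (simp add: abs_mult)
qed

end

text \<open>The normed space is the whole type \<open>'a\<close> with the norm \<open>N\<close>.\<close>

definition L1_subspace :: "('a::real_vector \<Rightarrow> real) \<Rightarrow> bool" where
  "L1_subspace N \<longleftrightarrow>
     (\<exists>(V :: L1_01 set) T. subspace V \<and> linear T \<and> bij_betw T UNIV V \<and> (\<forall>x. norm (T x) = N x))"

lemma ell2_add_aux:
  fixes a b :: "nat \<Rightarrow> real"
  assumes a: "summable (\<lambda>i. (a i)\<^sup>2)" and b: "summable (\<lambda>i. (b i)\<^sup>2)"
  shows "summable (\<lambda>i. (a i + b i)\<^sup>2)"
    and "sqrt (\<Sum>i. (a i + b i)\<^sup>2) \<le> sqrt (\<Sum>i. (a i)\<^sup>2) + sqrt (\<Sum>i. (b i)\<^sup>2)"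
proof -
  let ?C = "sqrt (\<Sum>i. (a i)\<^sup>2) + sqrt (\<Sum>i. (b i)\<^sup>2)"
  have le: "(\<Sum>i<n. (a i + b i)\<^sup>2) \<le> ?C\<^sup>2" for n
  proof -
    have "L2_set (\<lambda>i. a i + b i) {..<n} \<le> L2_set a {..<n} + L2_set b {..<n}"
      by (rule L2_set_triangle_ineq)
    also have "\<dots> \<le> ?C"
      unfolding L2_set_def
      by (intro add_mono real_sqrt_le_mono sum_le_suminf a b) auto
    finally have "(L2_set (\<lambda>i. a i + b i) {..<n})\<^sup>2 \<le> ?C\<^sup>2"
      by (intro power_mono) auto
    then show ?thesis
      by (simp add: L2_set_def sum_nonneg)
  qed
  show s: "summable (\<lambda>i. (a i + b i)\<^sup>2)"
    by (rule summableI_nonneg_bounded[OF _ le]) auto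
  have "(\<Sum>i. (a i + b i)\<^sup>2) \<le> ?C\<^sup>2"
    by (rule suminf_le_const[OF s le])
  then have "sqrt (\<Sum>i. (a i + b i)\<^sup>2) \<le> sqrt (?C\<^sup>2)"
    by (rule real_sqrt_le_mono)
  also have "\<dots> = ?C"
    by (simp add: suminf_nonneg a b)
  finally show "sqrt (\<Sum>i. (a i + b i)\<^sup>2) \<le> ?C" .
qed

typedef ell2 = "{a :: nat \<Rightarrow> real. summable (\<lambda>i. (a i)\<^sup>2)}"
  morphisms ell2_nth Abs_ell2
  by (rule exI[of _ "\<lambda>_. 0"]) simp

setup_lifting type_definition_ell2

instantiation ell2 :: real_normed_vector
begin

lift_definition zero_ell2 :: ell2 is "\<lambda>_. 0"
  by simp

lift_definition plus_ell2 :: "ell2 \<Rightarrow> ell2 \<Rightarrow> ell2" is "\<lambda>a b i. a i + b i"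
  by (rule ell2_add_aux)

lift_definition uminus_ell2 :: "ell2 \<Rightarrow> ell2" is "\<lambda>a i. - a i"
  by simp

lift_definition minus_ell2 :: "ell2 \<Rightarrow> ell2 \<Rightarrow> ell2" is "\<lambda>a b i. a i - b i"
  using ell2_add_aux(1)[of _ "\<lambda>i. - b i" for b] by simp

lift_definition scaleR_ell2 :: "real \<Rightarrow> ell2 \<Rightarrow> ell2" is "\<lambda>c a i. c * a i"
  by (simp add: power_mult_distrib)

lift_definition norm_ell2 :: "ell2 \<Rightarrow> real" is "\<lambda>a. sqrt (\<Sum>i. (a i)\<^sup>2)" .

definition dist_ell2 :: "ell2 \<Rightarrow> ell2 \<Rightarrow> real"
  where "dist_ell2 x y = norm (x - y)"

definition sgn_ell2 :: "ell2 \<Rightarrow> ell2"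
  where "sgn_ell2 x = inverse (norm x) *\<^sub>R x"

definition uniformity_ell2 :: "(ell2 \<times> ell2) filter"
  where "uniformity_ell2 = (INF e\<in>{0<..}. principal {(x, y). dist x y < e})"

definition open_ell2 :: "ell2 set \<Rightarrow> bool"
  where "open_ell2 U \<longleftrightarrow> (\<forall>x\<in>U. eventually (\<lambda>(x', y). x' = x \<longrightarrow> y \<in> U) uniformity)"

instance
proof
  fix x y z :: ell2 and a b :: real
  show "x + y + z = x + (y + z)"
    by transfer (simp add: add.assoc)
  show "x + y = y + x"
    by transfer (simp add: add.commute)
  show "0 + x = x"
    by transfer simp
  show "- x + x = 0"
    by transfer simp
  show "x - y = x + - y"
    by transfer simp
  show "a *\<^sub>R (x + y) = a *\<^sub>R x + a *\<^sub>R y"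
    by transfer (simp add: algebra_simps)
  show "(a + b) *\<^sub>R x = a *\<^sub>R x + b *\<^sub>R x"
    by transfer (simp add: algebra_simps)
  show "a *\<^sub>R b *\<^sub>R x = (a * b) *\<^sub>R x"
    by transfer (simp add: algebra_simps)
  show "1 *\<^sub>R x = x"
    by transfer simp
  show "dist x y = norm (x - y)"
    by (rule dist_ell2_def)
  show "sgn x = inverse (norm x) *\<^sub>R x"
    by (rule sgn_ell2_def)
  show "uniformity = (INF e\<in>{0<..}. principal {(x, y :: ell2). dist x y < e})"
    by (rule uniformity_ell2_def)
  show "open U \<longleftrightarrow> (\<forall>x\<in>U. eventually (\<lambda>(x', y). x' = x \<longrightarrow> y \<in> U) uniformity)"
    for U :: "ell2 set"
    by (rule open_ell2_def)
  show "norm x = 0 \<longleftrightarrow> x = 0"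
    by transfer (auto simp: suminf_eq_zero_iff)
  show "norm (x + y) \<le> norm x + norm y"
    by transfer (rule ell2_add_aux)
  show "norm (a *\<^sub>R x) = \<bar>a\<bar> * norm x"
    by transfer (simp add: power_mult_distrib suminf_mult real_sqrt_mult)
qed

end

text \<open>Here \<open>E\<close> is \<open>\<real>\<^sup>2\<close> with the norm \<open>N\<close> and \<open>axis i 1\<close> is the standard unit vector \<open>e\<^sub>i\<close>.
  The norm of \<open>a\<close> is the \<open>\<ell>\<^sub>2\<close> norm.\<close>

definition H_norm :: "(real^2 \<Rightarrow> real) \<Rightarrow> real \<times> ell2 \<Rightarrow> real" where
  "H_norm N = (\<lambda>(t, a). N (norm a *\<^sub>R axis 1 1 + t *\<^sub>R axis 2 1))"

definition C2_real :: "(real \<Rightarrow> real) \<Rightarrow> bool" where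
  "C2_real f \<longleftrightarrow>
     f differentiable_on UNIV \<and> deriv f differentiable_on UNIV \<and>
     continuous_on UNIV (deriv (deriv f))"

text \<open>Since \<open>{0<..}\<close> is open, the iterated derivatives at positive points do not depend on the values
  of \<open>f\<close> outside \<open>{0<..}\<close>.\<close>

definition completely_monotone_open :: "(real \<Rightarrow> real) \<Rightarrow> bool" where
  "completely_monotone_open f \<longleftrightarrow>
     (\<forall>k. (deriv ^^ k) f differentiable_on {0<..}) \<and>
     (\<forall>k. \<forall>t>0. (-1) ^ k * (deriv ^^ k) f t \<ge> 0)"

definition completely_monotone_closed :: "(real \<Rightarrow> real) \<Rightarrow> bool" where
  "completely_monotone_closed f \<longleftrightarrow>
     completely_monotone_open f \<and> continuous (at_right 0) f"

end

theory Submission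
  imports Defs "HOL-Probability.Probability"
begin

text \<open>
  Write \<open>N(r, t)\<close> for the norm of \<open>r e\<^sub>1 + t e\<^sub>2\<close> and \<open>g\<close> for a standard Gaussian variable.

  If \<open>H(E)\<close> embeds into \<open>L\<^sub>1\<close>, let \<open>F\<^sub>0, F\<^sub>1, F\<^sub>2, \<dots>\<close> be the images of the unit vectors. Averaging the
  identity \<open>\<integral>\<bar>t F\<^sub>0 + \<Sum>\<^sub>i a\<^sub>i F\<^sub>i\<bar> = N(\<parallel>a\<parallel>, t)\<close> over \<open>a = (g\<^sub>1, \<dots>, g\<^sub>n) / \<surd>n\<close> with independent standard
  Gaussian \<open>g\<^sub>i\<close> turns the left-hand side into a mixture of functions \<open>t \<mapsto> \<bbbE>\<bar>c t + v g\<bar>\<close>, while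
  \<open>\<parallel>a\<parallel> \<rightarrow> 1\<close> makes the right-hand side tend to \<open>\<phi>(t)\<close>. The second derivative of each
  \<open>\<bbbE>\<bar>c t + v g\<bar>\<close> is, at \<open>\<surd>t\<close>, a decaying exponential in \<open>t\<close>, and complete monotonicity of the second
  derivative at \<open>\<surd>t\<close> survives pointwise limits of the functions themselves.

  Conversely, smoothness at \<open>e\<^sub>2\<close> gives \<open>\<phi>(t) - \<bar>t\<bar> \<rightarrow> 0\<close>, hence \<open>2 \<phi>(t) = \<integral>\<bar>t - s\<bar> \<phi>''(s) ds\<close>.
  By Bernstein's theorem \<open>\<phi>''(s)\<close> is a mixture of the functions \<open>exp(- s\<^sup>2 u)\<close>, so \<open>N(r, t)\<close> is a mixture
  of \<open>\<bbbE>\<bar>t + r v g\<bar>\<close>, which is realised by independent Gaussian variables multiplied by a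
  common independent random factor.
\<close>

subsection \<open>Completely monotone functions\<close>

text \<open>In the forward direction only pointwise convergence of functions is available. What
  saves the derivatives is an a priori bound: minus the derivative of a completely monotone f is
  again decreasing, hence at most (2/t) f(t/2) at t. The same closure under limits replaces
  differentiation under the integral sign, since a Gaussian mixture is a limit of finite mixtures.
  In the converse, |t - s| / 2 is a fundamental solution of the second derivative, so \<phi>(t) and
  half the integral of |t - s| \<phi>''(s) agree up to an affine function; evenness and \<phi>(t) -
  |t| -> 0 remove it. Since exp(- s^2 u) is sqrt(pi/u) times the density of a centred Gaussian of
  variance 1/(2u), the mixture has amplitude proportional to sqrt(pi/u) and deviation 1/sqrt(2u).
  The target is L_1 of the interval (0,1) itself, so the random variables realising the embedding
  must live there; they are built from disjoint blocks of binary digits and quantile functions. The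
  embedding is given first on finite combinations of unit vectors, and completeness of
  \<open>L1_01\<close> extends it.\<close>

lemma tendsto_deriv_if_bounded_second_deriv:
  fixes f f' f'' :: "nat \<Rightarrow> real \<Rightarrow> real" and F :: "real \<Rightarrow> real"
  assumes d1: "\<And>n x. x > 0 \<Longrightarrow> (f n has_real_derivative f' n x) (at x)"
    and d2: "\<And>n x. x > 0 \<Longrightarrow> (f' n has_real_derivative f'' n x) (at x)"
    and bd: "\<And>a b. 0 < a \<Longrightarrow> \<exists>C. \<forall>n. \<forall>x\<in>{a..b}. \<bar>f'' n x\<bar> \<le> C"
    and lim: "\<And>x. x > 0 \<Longrightarrow> (\<lambda>n. f n x) \<longlonglongrightarrow> F x"
  obtains G where "\<And>x. x > 0 \<Longrightarrow> (\<lambda>n. f' n x) \<longlonglongrightarrow> G x"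
    and "\<And>x. x > 0 \<Longrightarrow> (F has_real_derivative G x) (at x)"
proof -
  \<comment> \<open>Tangent-line error with a constant independent of \<open>n\<close>. It does the
    work that locally uniform convergence of the derivatives would do.\<close>
  have est: "\<exists>C>0. \<forall>n. \<forall>y\<in>{x/2..2*x}. \<bar>f n y - f n x - f' n x * (y - x)\<bar> \<le> C * (y - x)\<^sup>2"
    if "x > 0" for x
  proof -
    obtain C where C: "\<bar>f'' n z\<bar> \<le> C" if "z \<in> {x/2..2*x}" for n z
      using bd[of "x/2" "2*x"] \<open>x > 0\<close> by (meson half_gt_zero_iff)
    have "C \<ge> 0" using C[of x 0] \<open>x > 0\<close> by auto
    have lip: "\<bar>f' n z - f' n x\<bar> \<le> C * \<bar>z - x\<bar>" if z: "z \<in> {x/2..2*x}" for n z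
    proof -
      have "norm (f' n z - f' n x) \<le> C * norm (z - x)"
      proof (rule field_differentiable_bound[where S="{x/2..2*x}" and f'="f'' n"])
        fix w assume "w \<in> {x/2..2*x}"
        then show "(f' n has_field_derivative f'' n w) (at w within {x/2..2*x})"
          using \<open>x > 0\<close> by (intro has_field_derivative_at_within[OF d2]) auto
        show "norm (f'' n w) \<le> C" using C \<open>w \<in> _\<close> by simp
      qed (use z \<open>x > 0\<close> in auto)
      then show ?thesis by simp
    qed
    have "\<bar>f n y - f n x - f' n x * (y - x)\<bar> \<le> C * (y - x)\<^sup>2" if y: "y \<in> {x/2..2*x}" for n y
    proof -
      let ?g = "\<lambda>z. f n z - f' n x * z"
      let ?S = "{min x y..max x y}"
      have "norm (?g y - ?g x) \<le> (C * \<bar>y - x\<bar>) * norm (y - x)"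
      proof (rule field_differentiable_bound[where S="?S" and f'="\<lambda>z. f' n z - f' n x"])
        fix w assume w: "w \<in> ?S"
        then have w': "w \<in> {x/2..2*x}" using y \<open>x > 0\<close> by (auto simp: min_def max_def split: if_splits)
        then have "w > 0" using \<open>x > 0\<close> by auto
        show "(?g has_field_derivative f' n w - f' n x) (at w within ?S)"
          using has_field_derivative_at_within[OF d1[OF \<open>w > 0\<close>, of n]] by (auto intro!: derivative_eq_intros)
        have "\<bar>w - x\<bar> \<le> \<bar>y - x\<bar>" using w by (auto simp: min_def max_def split: if_splits)
        then show "norm (f' n w - f' n x) \<le> C * \<bar>y - x\<bar>"
          using lip[OF w', of n] \<open>C \<ge> 0\<close> by (smt (verit) mult_left_mono real_norm_def)
      qed auto
      then show ?thesis
        by (simp add: algebra_simps power2_eq_square abs_mult flip: abs_mult)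
    qed
    then have "\<bar>f n y - f n x - f' n x * (y - x)\<bar> \<le> (C+1) * (y - x)\<^sup>2" if "y \<in> {x/2..2*x}" for n y
      using that by (smt (verit) mult_right_mono zero_le_power2)
    then show ?thesis using \<open>C \<ge> 0\<close> by (intro exI[of _ "C+1"]) auto
  qed
  have conv: "\<exists>g. (\<lambda>n. f' n x) \<longlonglongrightarrow> g" if "x > 0" for x
  proof -
    obtain C where "C > 0" and C: "\<And>n y. y\<in>{x/2..2*x} \<Longrightarrow> \<bar>f n y - f n x - f' n x * (y - x)\<bar> \<le> C * (y - x)\<^sup>2"
      using est[OF \<open>x > 0\<close>] by blast
    have "Cauchy (\<lambda>n. f' n x)"
    proof (rule CauchyI)
      fix e :: real assume "e > 0"
      \<comment> \<open>\<open>C * h \<le> e / 4\<close> puts each difference quotient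
        \<open>D n\<close> within \<open>e / 4\<close> of \<open>f' n x\<close>, for all
        \<open>n\<close> at once; with the quotients \<open>e / 4\<close>-close to each other, three
        quarters of \<open>e\<close> are spent. \<open>h \<le> x\<close> keeps \<open>x + h\<close>
        in the interval of \<open>est\<close>.\<close>
      define h where "h = min x (e / (4 * C))"
      have h: "h > 0" "h \<le> x" "C * h \<le> e / 4"
        using \<open>e > 0\<close> \<open>C > 0\<close> \<open>x > 0\<close> by (auto simp: h_def min_def field_simps)
      define D where "D n = (f n (x + h) - f n x) / h" for n
      have D: "\<bar>D n - f' n x\<bar> \<le> e / 4" for n
      proof -
        have "\<bar>f n (x+h) - f n x - f' n x * h\<bar> \<le> C * h\<^sup>2"
          using C[of "x+h" n] h \<open>x > 0\<close> by auto
        moreover have "D n - f' n x = (f n (x+h) - f n x - f' n x * h) / h"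
          using h by (simp add: D_def field_simps)
        ultimately have "\<bar>D n - f' n x\<bar> \<le> C * h\<^sup>2 / h"
          using h by (simp add: divide_right_mono)
        also have "\<dots> = C * h" using h by (simp add: power2_eq_square)
        finally show ?thesis using h by simp
      qed
      have "(\<lambda>n. D n) \<longlonglongrightarrow> (F (x + h) - F x) / h"
        unfolding D_def using \<open>x > 0\<close> h by (intro tendsto_intros lim) auto
      then have "Cauchy D" by (rule LIMSEQ_imp_Cauchy)
      then obtain M where M: "\<And>m n. m \<ge> M \<Longrightarrow> n \<ge> M \<Longrightarrow> norm (D m - D n) < e / 4"
        using CauchyD[of D "e/4"] \<open>e > 0\<close> by auto
      show "\<exists>M. \<forall>m\<ge>M. \<forall>n\<ge>M. norm (f' m x - f' n x) < e"
      proof (intro exI allI impI)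
        fix m n assume "M \<le> m" "M \<le> n"
        then show "norm (f' m x - f' n x) < e"
          using M[of m n] D[of m] D[of n] \<open>e > 0\<close> by (simp add: abs_if split: if_splits)
      qed
    qed
    then show ?thesis using Cauchy_convergent convergent_def by blast
  qed
  then obtain G where G: "\<And>x. x > 0 \<Longrightarrow> (\<lambda>n. f' n x) \<longlonglongrightarrow> G x" by metis
  have "(F has_real_derivative G x) (at x)" if "x > 0" for x
  proof -
    obtain C where "C > 0" and C: "\<And>n y. y\<in>{x/2..2*x} \<Longrightarrow> \<bar>f n y - f n x - f' n x * (y - x)\<bar> \<le> C * (y - x)\<^sup>2"
      using est[OF \<open>x > 0\<close>] by blast
    have CF: "\<bar>F y - F x - G x * (y - x)\<bar> \<le> C * (y - x)\<^sup>2" if y: "y \<in> {x/2..2*x}" for y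
      by (rule tendsto_upperbound[where F=sequentially and f="\<lambda>n. \<bar>f n y - f n x - f' n x * (y - x)\<bar>"])
        (use y \<open>x > 0\<close> C[OF y] in \<open>auto intro!: tendsto_intros lim G\<close>)
    have "((\<lambda>y. (F y - F x) / (y - x) - G x) \<longlongrightarrow> 0) (at x)"
    proof (rule Lim_null_comparison)
      have "eventually (\<lambda>y. y \<in> {x/2<..<2*x}) (at x)"
        using \<open>x > 0\<close> by (intro eventually_at_in_open') auto
      moreover have "eventually (\<lambda>y. y \<noteq> x) (at x)" by (simp add: eventually_neq_at_within)
      ultimately show "eventually (\<lambda>y. norm ((F y - F x) / (y - x) - G x) \<le> C * \<bar>y - x\<bar>) (at x)"
      proof eventually_elim
        case (elim y)
        have "(F y - F x) / (y - x) - G x = (F y - F x - G x * (y - x)) / (y - x)"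
          using elim(2) by (simp add: field_simps)
        then have "norm ((F y - F x) / (y - x) - G x) = \<bar>F y - F x - G x * (y - x)\<bar> / \<bar>y - x\<bar>"
          by simp
        also have "\<dots> \<le> C * (y - x)\<^sup>2 / \<bar>y - x\<bar>"
          using CF[of y] elim by (intro divide_right_mono) auto
        also have "\<dots> = C * \<bar>y - x\<bar>"
          using elim(2) by (auto simp: power2_eq_square abs_if field_simps)
        finally show ?case .
      qed
      show "((\<lambda>y. C * \<bar>y - x\<bar>) \<longlongrightarrow> 0) (at x)" by (auto intro!: tendsto_eq_intros)
    qed
    then have "((\<lambda>y. (F y - F x) / (y - x)) \<longlongrightarrow> G x) (at x)"
      by (simp add: LIM_zero_iff)
    then show ?thesis by (simp add: has_field_derivative_iff)
  qed
  with G that show ?thesis by blast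
qed

text \<open>On the open half-line \<open>deriv\<close> depends only on values at positive points, so
  any explicit sequence of derivatives agrees there with the iterated \<open>deriv\<close>. In this
  form complete monotonicity is shown by exhibiting the sequence.\<close>

lemma completely_monotone_open_iff:
  "completely_monotone_open f \<longleftrightarrow>
    (\<exists>D. (\<forall>t>0. D 0 t = f t) \<and> (\<forall>k. \<forall>t>0. (D k has_real_derivative D (Suc k) t) (at t)) \<and>
         (\<forall>k. \<forall>t>0. (-1) ^ k * D k t \<ge> 0))" (is "_ = ?R")
proof
  assume f: "completely_monotone_open f"
  show ?R
  proof (intro exI[of _ "\<lambda>k. (deriv ^^ k) f"] conjI allI impI)
    fix k and t :: real assume "t > 0"
    then have "(deriv ^^ k) f differentiable (at t)"
      using f differentiable_on_eq_differentiable_at[OF open_greaterThan, of _ "0::real"]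
      unfolding completely_monotone_open_def by blast
    then show "((deriv ^^ k) f has_real_derivative (deriv ^^ Suc k) f t) (at t)"
      by (simp add: DERIV_deriv_iff_real_differentiable)
  qed (use f in \<open>auto simp: completely_monotone_open_def\<close>)
next
  assume ?R
  then obtain D where D0: "\<And>t. t > 0 \<Longrightarrow> D 0 t = f t"
    and D: "\<And>k t. t > 0 \<Longrightarrow> (D k has_real_derivative D (Suc k) t) (at t)"
    and pos: "\<And>k t. t > 0 \<Longrightarrow> (-1) ^ k * D k t \<ge> 0" by blast
  have eq: "(deriv ^^ k) f t = D k t" if "t > 0" for k t
    using that
  proof (induction k arbitrary: t)
    case (Suc k)
    have "((deriv ^^ k) f has_real_derivative D (Suc k) t) (at t)"
      by (rule has_field_derivative_transform_within_open[OF D, where S="{0<..}"])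
        (use Suc in auto)
    then show ?case by (simp add: DERIV_imp_deriv)
  qed (simp add: D0)
  show "completely_monotone_open f"
    unfolding completely_monotone_open_def
  proof (intro conjI allI impI)
    fix k
    have "((deriv ^^ k) f has_real_derivative D (Suc k) t) (at t)" if "t > 0" for t
      by (rule has_field_derivative_transform_within_open[OF D, where S="{0<..}"])
        (use eq that in auto)
    then show "(deriv ^^ k) f differentiable_on {0<..}"
      unfolding differentiable_on_eq_differentiable_at[OF open_greaterThan]
      by (auto simp: real_differentiable_def)
  next
    fix k and t :: real assume "t > 0"
    then show "(-1) ^ k * (deriv ^^ k) f t \<ge> 0" using eq pos by simp
  qed
qed

lemma completely_monotone_open_cong:
  assumes "completely_monotone_open f" and "\<And>t. t > 0 \<Longrightarrow> f t = g t"
  shows "completely_monotone_open g"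
  using assms unfolding completely_monotone_open_iff by metis

lemma completely_monotone_open_has_deriv:
  assumes "completely_monotone_open f" "t > 0"
  shows "(f has_real_derivative deriv f t) (at t)"
proof -
  have "(deriv ^^ 0) f differentiable_on {0<..}"
    using assms(1) unfolding completely_monotone_open_def by blast
  then have "f differentiable (at t)"
    using assms(2) differentiable_on_eq_differentiable_at[OF open_greaterThan, of f "0::real"] by simp
  then show ?thesis by (simp add: DERIV_deriv_iff_real_differentiable)
qed

lemma completely_monotone_open_nonneg:
  assumes "completely_monotone_open f" "t > 0"
  shows "f t \<ge> 0"
proof -
  have "(-1) ^ 0 * (deriv ^^ 0) f t \<ge> 0"
    using assms unfolding completely_monotone_open_def by blast
  then show ?thesis by simp
qed

lemma completely_monotone_open_minus_deriv:
  assumes "completely_monotone_open f"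
  shows "completely_monotone_open (\<lambda>t. - deriv f t)"
proof -
  obtain D where D0: "\<And>t. t > 0 \<Longrightarrow> D 0 t = f t"
    and D: "\<And>k t. t > 0 \<Longrightarrow> (D k has_real_derivative D (Suc k) t) (at t)"
    and pos: "\<And>k t. t > 0 \<Longrightarrow> (-1) ^ k * D k t \<ge> 0"
    using assms unfolding completely_monotone_open_iff by blast
  have "(f has_real_derivative D 1 t) (at t)" if "t > 0" for t
    by (rule has_field_derivative_transform_within_open[where S="{0<..}" and f="D 0"])
      (use that D0 D[OF that, of 0] in auto)
  then have "D 1 t = deriv f t" if "t > 0" for t
    using DERIV_imp_deriv that by metis
  then show ?thesis
    unfolding completely_monotone_open_iff
    by (intro exI[of _ "\<lambda>k t. - D (Suc k) t"])
      (use pos[of _ "Suc _"] in \<open>auto intro!: DERIV_minus D\<close>)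
qed

lemma completely_monotone_open_antimono:
  assumes "completely_monotone_open f" and "0 < s" "s \<le> t"
  shows "f t \<le> f s"
proof -
  have "deriv f u \<le> 0" if "u > 0" for u
    using completely_monotone_open_nonneg[OF completely_monotone_open_minus_deriv[OF assms(1)] that] by simp
  then show ?thesis
    using assms(2,3) completely_monotone_open_has_deriv[OF assms(1)]
    by (intro DERIV_nonpos_imp_nonincreasing[of s t f]) (meson less_le_trans)+
qed

lemma completely_monotone_open_le_limit:
  assumes cm: "completely_monotone_open f" and lim: "(f \<longlongrightarrow> l) (at_right 0)" and y: "y > 0"
  shows "f y \<le> l"
proof (rule tendsto_lowerbound[OF lim])
  have "\<forall>\<^sub>F t in at_right 0. t \<in> {0<..<y}" using y by (rule eventually_at_right_real)
  then show "\<forall>\<^sub>F t in at_right 0. f y \<le> f t"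
    by eventually_elim (auto intro!: completely_monotone_open_antimono[OF cm])
qed simp

text \<open>\<open>- deriv f\<close> is decreasing, so its value at \<open>t\<close> is at most its
  mean over \<open>[t/2, t]\<close>, and that mean is at most
  \<open>f (t/2) / (t/2)\<close>.\<close>

lemma completely_monotone_open_deriv_bound:
  assumes f: "completely_monotone_open f" and t: "t > 0"
  shows "\<bar>deriv f t\<bar> \<le> 2 / t * f (t / 2)"
proof -
  note cm = completely_monotone_open_minus_deriv[OF f]
  have neg: "deriv f t \<le> 0" using completely_monotone_open_nonneg[OF cm t] by simp
  have "\<exists>z>t/2. z < t \<and> f t - f (t/2) = (t - t/2) * deriv f z"
    by (rule MVT2) (use t completely_monotone_open_has_deriv[OF f] in auto)
  then obtain z where z: "t/2 < z" "z < t" "f t - f (t/2) = (t/2) * deriv f z" by auto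
  have "- deriv f t \<le> - deriv f z"
    using completely_monotone_open_antimono[OF cm, of z t] z t by simp
  then have "t/2 * (- deriv f t) \<le> t/2 * (- deriv f z)"
    using t by (intro mult_left_mono) auto
  also have "\<dots> = f (t/2) - f t" using z by simp
  also have "\<dots> \<le> f (t/2)" using completely_monotone_open_nonneg[OF f t] by simp
  finally have "t/2 * \<bar>deriv f t\<bar> \<le> f (t/2)" using neg by simp
  then show ?thesis using t by (simp add: field_simps)
qed

text \<open>The derivative bound used twice controls the second derivatives on \<open>{a..b}\<close>
  by the values at \<open>a/4\<close>, which are bounded in \<open>n\<close> because they converge.
  Passing to minus the derivative stays in the class, so the step can be repeated.\<close>

lemma completely_monotone_open_tendsto_step:
  assumes cm: "\<And>n. completely_monotone_open (f n)"
    and lim: "\<And>t. t > 0 \<Longrightarrow> (\<lambda>n. f n t) \<longlonglongrightarrow> F t"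
  shows "\<exists>f' G. (\<forall>n. completely_monotone_open (f' n)) \<and> (\<forall>t>0. (\<lambda>n. f' n t) \<longlonglongrightarrow> G t) \<and>
    (\<forall>t>0. (F has_real_derivative - G t) (at t))"
proof -
  define f' where "f' n = deriv (f n)" for n
  \<comment> \<open>With this sign \<open>f''\<close> is minus the second derivative of
    \<open>f n\<close>, so the completely monotone function in \<open>cm''\<close> is
    \<open>- f''\<close>.\<close>
  define f'' where "f'' n = deriv (\<lambda>t. - f' n t)" for n
  note cm' = completely_monotone_open_minus_deriv[OF cm, folded f'_def]
  note cm'' = completely_monotone_open_minus_deriv[OF cm', folded f''_def]
  have d1: "(f n has_real_derivative f' n t) (at t)" if "t > 0" for n t
    using completely_monotone_open_has_deriv[OF cm that] unfolding f'_def .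
  have d2: "(f' n has_real_derivative - f'' n t) (at t)" if "t > 0" for n t
    using DERIV_minus[OF completely_monotone_open_has_deriv[OF cm' that, of n]]
    unfolding f''_def by simp
  have bd: "\<exists>C. \<forall>n. \<forall>x\<in>{a..b}. \<bar>- f'' n x\<bar> \<le> C" if "a > 0" for a b
  proof -
    have "convergent (\<lambda>n. f n (a/4))" using lim[of "a/4"] that by (auto simp: convergent_def)
    then have "Bseq (\<lambda>n. f n (a/4))" by (rule convergent_imp_Bseq)
    then obtain K where K: "\<And>n. \<bar>f n (a/4)\<bar> \<le> K" by (auto simp: Bseq_def)
    have "\<bar>- f'' n x\<bar> \<le> 2 / a * (4 / a * K)" if x: "x \<in> {a..b}" for n x
    proof -
      have "\<bar>- f'' n x\<bar> = - f'' n x"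
        using completely_monotone_open_nonneg[OF cm'', of x n] x \<open>a > 0\<close> by auto
      also have "\<dots> \<le> - f'' n a"
        using completely_monotone_open_antimono[OF cm''[of n], of a x] x \<open>a > 0\<close> by auto
      also have "\<dots> \<le> \<bar>f'' n a\<bar>" by simp
      also have "\<dots> \<le> 2 / a * (- f' n (a/2))"
        using completely_monotone_open_deriv_bound[OF cm' \<open>a > 0\<close>] unfolding f''_def .
      also have "\<dots> \<le> 2 / a * (4 / a * K)"
      proof (intro mult_left_mono)
        have "- f' n (a/2) \<le> 2 / (a/2) * f n (a/2/2)"
          using completely_monotone_open_deriv_bound[OF cm, of "a/2" n] \<open>a > 0\<close> unfolding f'_def by auto
        also have "\<dots> = 4 / a * f n (a/4)" by simp
        also have "\<dots> \<le> 4 / a * K" using K[of n] \<open>a > 0\<close> by (intro mult_left_mono) auto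
        finally show "- f' n (a/2) \<le> 4 / a * K" .
      qed (use \<open>a > 0\<close> in auto)
      finally show ?thesis .
    qed
    then show ?thesis by blast
  qed
  obtain G where G: "\<And>x. x > 0 \<Longrightarrow> (\<lambda>n. f' n x) \<longlonglongrightarrow> G x"
    and dG: "\<And>x. x > 0 \<Longrightarrow> (F has_real_derivative G x) (at x)"
    using tendsto_deriv_if_bounded_second_deriv[OF d1 d2 bd lim] by blast
  show ?thesis
    by (intro exI[of _ "\<lambda>n t. - f' n t"] exI[of _ "\<lambda>t. - G t"] conjI allI impI)
      (simp_all add: cm' G dG tendsto_minus)
qed

lemma completely_monotone_open_tendsto:
  assumes cm: "\<And>n. completely_monotone_open (f n)"
    and lim: "\<And>t. t > 0 \<Longrightarrow> (\<lambda>n. f n t) \<longlonglongrightarrow> F t"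
  shows "completely_monotone_open F"
proof -
  \<comment> \<open>Being a pointwise limit of completely monotone functions is the invariant handed
    from a function to minus its derivative. Dependent choice then yields \<open>E k\<close>, which
    is (-1)^k times the k-th derivative of \<open>F\<close>, and its sign is inherited from the
    approximants.\<close>
  define P where "P = (\<lambda>F :: real \<Rightarrow> real. \<exists>f. (\<forall>n::nat. completely_monotone_open (f n)) \<and>
    (\<forall>t>0. (\<lambda>n. f n t) \<longlonglongrightarrow> F t))"
  have step: "\<exists>G. P G \<and> (\<forall>t>0. (F has_real_derivative - G t) (at t))" if "P F" for F
  proof -
    obtain f where f: "\<forall>n. completely_monotone_open (f n)" and l: "\<forall>t>0. (\<lambda>n. f n t) \<longlonglongrightarrow> F t"
      using \<open>P F\<close>[unfolded P_def] by (elim exE conjE)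
    from completely_monotone_open_tendsto_step[OF f[rule_format] l[rule_format]] show ?thesis
      unfolding P_def by blast
  qed
  have "\<exists>E. \<forall>k. (P (E k) \<and> (k = 0 \<longrightarrow> E k = F)) \<and> (\<forall>t>0. (E k has_real_derivative - E (Suc k) t) (at t))"
  proof (rule dependent_nat_choice)
    show "\<exists>x. P x \<and> (0 = 0 \<longrightarrow> x = F)" using cm lim unfolding P_def by blast
    show "\<exists>y. (P y \<and> (Suc n = 0 \<longrightarrow> y = F)) \<and> (\<forall>t>0. (x has_real_derivative - y t) (at t))"
      if "P x \<and> (n = 0 \<longrightarrow> x = F)" for x and n :: nat using step that by simp
  qed
  then obtain E where E: "\<And>k. P (E k)" "E 0 = F"
    and dE: "\<And>k t. t > 0 \<Longrightarrow> (E k has_real_derivative - E (Suc k) t) (at t)" by blast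
  have pos: "E k t \<ge> 0" if "t > 0" for k t
  proof -
    obtain f where f: "\<forall>n. completely_monotone_open (f n)" and l: "\<forall>t>0. (\<lambda>n. f n t) \<longlonglongrightarrow> E k t"
      using E(1)[of k, unfolded P_def] by (elim exE conjE)
    have "f n t \<ge> 0" for n using completely_monotone_open_nonneg[OF f[rule_format] that] .
    then show ?thesis using LIMSEQ_le_const[OF l[rule_format, OF that], of 0] by blast
  qed
  show ?thesis
    unfolding completely_monotone_open_iff
  proof (intro exI[of _ "\<lambda>k t. (-1) ^ k * E k t"] conjI allI impI)
    fix k and t :: real assume t: "t > 0"
    show "((\<lambda>t. (-1) ^ k * E k t) has_real_derivative (-1) ^ Suc k * E (Suc k) t) (at t)"
      using dE[OF t, of k] by (auto intro!: derivative_eq_intros)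
    show "(-1) ^ k * ((-1) ^ k * E k t) \<ge> 0"
      using pos[OF t, of k] by (cases "even k") auto
  qed (simp add: E)
qed

lemma completely_monotone_open_sum:
  assumes "finite J" "\<And>j. j \<in> J \<Longrightarrow> completely_monotone_open (f j)"
  shows "completely_monotone_open (\<lambda>t. \<Sum>j\<in>J. f j t)"
proof -
  have "\<forall>j\<in>J. \<exists>D. (\<forall>t>0. D 0 t = f j t) \<and> (\<forall>k. \<forall>t>0. (D k has_real_derivative D (Suc k) t) (at t)) \<and>
         (\<forall>k. \<forall>t>0. (-1) ^ k * D k t \<ge> 0)"
    using assms(2) unfolding completely_monotone_open_iff by blast
  from bchoice[OF this] obtain D where D: "\<forall>j\<in>J. (\<forall>t>0. D j 0 t = f j t) \<and> (\<forall>k. \<forall>t>0. (D j k has_real_derivative D j (Suc k) t) (at t)) \<and>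
         (\<forall>k. \<forall>t>0. (-1) ^ k * D j k t \<ge> 0)" ..
  show ?thesis
    unfolding completely_monotone_open_iff
    by (rule exI[of _ "\<lambda>k t. \<Sum>j\<in>J. D j k t"])
      (use D in \<open>auto intro!: DERIV_sum sum.cong sum_nonneg simp: sum_distrib_left\<close>)
qed

lemma completely_monotone_open_exp:
  assumes "K \<ge> 0" "c \<ge> 0"
  shows "completely_monotone_open (\<lambda>t. K * exp (- c * t))"
  unfolding completely_monotone_open_iff
proof (intro exI[of _ "\<lambda>k t. (-1) ^ k * (K * c ^ k * exp (- c * t))"] conjI allI impI)
  fix k and t :: real
  show "((\<lambda>t. (-1) ^ k * (K * c ^ k * exp (- c * t))) has_real_derivative
      (-1) ^ Suc k * (K * c ^ Suc k * exp (- c * t))) (at t)"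
    by (auto intro!: derivative_eq_intros)
  show "(-1) ^ k * ((-1) ^ k * (K * c ^ k * exp (- c * t))) \<ge> 0"
    using assms by (cases "even k") auto
qed simp

section \<open>Curvature that is completely monotone in the square of the variable\<close>

text \<open>For \<open>\<Phi> = \<phi>\<close> this is the complete monotonicity condition of the theorem.\<close>

definition cm_curvature :: "(real \<Rightarrow> real) \<Rightarrow> bool" where
  "cm_curvature \<Phi> \<longleftrightarrow> (\<exists>p q. (\<forall>t>0. (\<Phi> has_real_derivative p t) (at t)) \<and>
     (\<forall>t>0. (p has_real_derivative q t) (at t)) \<and> completely_monotone_open (\<lambda>t. q (sqrt t)))"

lemma cm_curvature_imp_deriv:
  assumes "cm_curvature \<Phi>"
  shows "completely_monotone_open (\<lambda>t. deriv (deriv \<Phi>) (sqrt t))"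
proof -
  obtain p q where p: "\<forall>t>0. (\<Phi> has_real_derivative p t) (at t)"
    and q: "\<forall>t>0. (p has_real_derivative q t) (at t)"
    and cm: "completely_monotone_open (\<lambda>t. q (sqrt t))"
    using assms unfolding cm_curvature_def by (elim exE conjE)
  have dp: "deriv \<Phi> t = p t" if "t > 0" for t using p that by (simp add: DERIV_imp_deriv)
  have "(deriv \<Phi> has_real_derivative q t) (at t)" if "t > 0" for t
    by (rule has_field_derivative_transform_within_open[where S="{0<..}" and f=p])
      (use that q dp in auto)
  then have dq: "deriv (deriv \<Phi>) t = q t" if "t > 0" for t using that by (simp add: DERIV_imp_deriv)
  show ?thesis
    by (rule completely_monotone_open_cong[OF cm]) (simp add: dq)
qed

lemma cm_curvature_sum:
  assumes "finite J" "\<And>j. j \<in> J \<Longrightarrow> cm_curvature (f j)"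
  shows "cm_curvature (\<lambda>t. \<Sum>j\<in>J. f j t)"
proof -
  have "\<forall>j\<in>J. \<exists>p q. (\<forall>t>0. (f j has_real_derivative p t) (at t)) \<and>
     (\<forall>t>0. (p has_real_derivative q t) (at t)) \<and> completely_monotone_open (\<lambda>t. q (sqrt t))"
    using assms(2) unfolding cm_curvature_def by blast
  from bchoice[OF this] obtain p where "\<forall>j\<in>J. \<exists>q. (\<forall>t>0. (f j has_real_derivative p j t) (at t)) \<and>
     (\<forall>t>0. (p j has_real_derivative q t) (at t)) \<and> completely_monotone_open (\<lambda>t. q (sqrt t))" ..
  from bchoice[OF this] obtain q where q: "\<forall>j\<in>J. (\<forall>t>0. (f j has_real_derivative p j t) (at t)) \<and>
     (\<forall>t>0. (p j has_real_derivative q j t) (at t)) \<and> completely_monotone_open (\<lambda>t. q j (sqrt t))" ..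
  show ?thesis
    unfolding cm_curvature_def
  proof (rule exI[of _ "\<lambda>t. \<Sum>j\<in>J. p j t"], rule exI[of _ "\<lambda>t. \<Sum>j\<in>J. q j t"], intro conjI allI impI)
    fix t :: real assume "t > 0"
    then show "((\<lambda>t. \<Sum>j\<in>J. f j t) has_real_derivative (\<Sum>j\<in>J. p j t)) (at t)"
      and "((\<lambda>t. \<Sum>j\<in>J. p j t) has_real_derivative (\<Sum>j\<in>J. q j t)) (at t)"
      using q by (auto intro!: DERIV_sum)
  qed (use q in \<open>auto intro!: completely_monotone_open_sum assms(1)\<close>)
qed

lemma convergent_imp_bounded_real:
  fixes X :: "nat \<Rightarrow> real"
  assumes "X \<longlonglongrightarrow> x"
  obtains K where "\<And>n. \<bar>X n\<bar> \<le> K"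
proof -
  have "Bseq X" using assms by (intro convergent_imp_Bseq) (auto simp: convergent_def)
  then obtain K where "\<And>n. \<bar>X n\<bar> \<le> K" by (auto simp: Bseq_def)
  then show ?thesis using that by blast
qed

text \<open>Bounds on three derivatives are extracted from bounded values: convexity bounds
  \<open>p\<close>, monotonicity of \<open>q\<close> bounds \<open>q\<close>, and complete
  monotonicity of \<open>q (sqrt t)\<close> bounds the derivative of \<open>q\<close>. The limit can
  then be taken twice by \<open>tendsto_deriv_if_bounded_second_deriv\<close>, and once more among
  completely monotone functions.\<close>

lemma cm_curvature_tendsto:
  assumes cm: "\<And>n. cm_curvature (f n)"
    and lim: "\<And>t. t > 0 \<Longrightarrow> (\<lambda>n. f n t) \<longlonglongrightarrow> F t"
  shows "cm_curvature F"
proof -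
  have "\<forall>n. \<exists>p q. (\<forall>t>0. (f n has_real_derivative p t) (at t)) \<and>
     (\<forall>t>0. (p has_real_derivative q t) (at t)) \<and> completely_monotone_open (\<lambda>t. q (sqrt t))"
    using cm unfolding cm_curvature_def by blast
  from choice[OF this] obtain p where "\<forall>n. \<exists>q. (\<forall>t>0. (f n has_real_derivative p n t) (at t)) \<and>
     (\<forall>t>0. (p n has_real_derivative q t) (at t)) \<and> completely_monotone_open (\<lambda>t. q (sqrt t))" ..
  from choice[OF this] obtain q where pq: "\<forall>n. (\<forall>t>0. (f n has_real_derivative p n t) (at t)) \<and>
     (\<forall>t>0. (p n has_real_derivative q n t) (at t)) \<and> completely_monotone_open (\<lambda>t. q n (sqrt t))" ..
  have dp: "(f n has_real_derivative p n t) (at t)" and dq: "(p n has_real_derivative q n t) (at t)"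
    if "t > 0" for n t using pq that by auto
  have cmq: "completely_monotone_open (\<lambda>t. q n (sqrt t))" for n using pq by auto
  define c where "c n t = q n (sqrt t)" for n t
  have cmc: "completely_monotone_open (c n)" for n
    using cmq unfolding c_def .
  have qc: "q n s = c n (s\<^sup>2)" if "s > 0" for n s using that by (simp add: c_def)
  have q_nonneg: "q n s \<ge> 0" if "s > 0" for n s
    using completely_monotone_open_nonneg[OF cmc, of "s\<^sup>2" n] that by (simp add: qc)
  have q_anti: "q n t \<le> q n s" if "0 < s" "s \<le> t" for n s t
    using completely_monotone_open_antimono[OF cmc, of "s\<^sup>2" "t\<^sup>2" n] that by (simp add: qc power_mono)
  have p_mono: "p n s \<le> p n t" if "0 < s" "s \<le> t" for n s t
    using that dq q_nonneg by (intro DERIV_nonneg_imp_nondecreasing[of s t "p n"]) (meson less_le_trans)+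
  \<comment> \<open>\<open>p n\<close> is increasing, so \<open>p n a\<close> lies between the mean
    slopes of \<open>f n\<close> over \<open>[a/2, a]\<close> and \<open>[a, 2a]\<close>.\<close>
  have p_bd: "\<exists>K. \<forall>n. \<bar>p n a\<bar> \<le> K" if a: "a > 0" for a
  proof -
    obtain K1 where K1: "\<And>n. \<bar>f n (a/2)\<bar> \<le> K1" using convergent_imp_bounded_real[OF lim[of "a/2"]] a by auto
    obtain K2 where K2: "\<And>n. \<bar>f n a\<bar> \<le> K2" using convergent_imp_bounded_real[OF lim[of a]] a by auto
    obtain K3 where K3: "\<And>n. \<bar>f n (2*a)\<bar> \<le> K3" using convergent_imp_bounded_real[OF lim[of "2*a"]] a by auto
    have "\<bar>p n a\<bar> \<le> (K1 + K2) / (a/2) + (K3 + K2) / a" for n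
    proof -
      have "\<exists>z>a/2. z < a \<and> f n a - f n (a/2) = (a - a/2) * p n z"
        by (rule MVT2) (use a dp in auto)
      then obtain z where z: "a/2 < z" "z < a" "f n a - f n (a/2) = a/2 * p n z" by auto
      have "a/2 * p n z \<le> a/2 * p n a" using z a by (intro mult_left_mono p_mono) auto
      then have 1: "a/2 * (- p n a) \<le> K1 + K2" using z(3) K1[of n] K2[of n] by (simp add: abs_le_iff)
      have "\<exists>z>a. z < 2*a \<and> f n (2*a) - f n a = (2*a - a) * p n z"
        by (rule MVT2) (use a dp in auto)
      then obtain y where y: "a < y" "y < 2*a" "f n (2*a) - f n a = a * p n y" by auto
      have "a * p n a \<le> a * p n y" using y a by (intro mult_left_mono p_mono) auto
      then have 2: "a * p n a \<le> K3 + K2" using y(3) K3[of n] K2[of n] by (simp add: abs_le_iff)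
      have "- p n a \<le> (K1 + K2) / (a/2)" using 1 a by (simp add: field_simps)
      moreover have "p n a \<le> (K3 + K2) / a" using 2 a by (simp add: field_simps)
      moreover have "(K1 + K2) / (a/2) \<ge> 0"
        using a order_trans[OF abs_ge_zero K1[of n]] order_trans[OF abs_ge_zero K2[of n]] by simp
      moreover have "(K3 + K2) / a \<ge> 0"
        using a order_trans[OF abs_ge_zero K3[of n]] order_trans[OF abs_ge_zero K2[of n]] by simp
      ultimately show ?thesis by (smt (verit))
    qed
    then show ?thesis by blast
  qed
  \<comment> \<open>\<open>q n\<close> is decreasing, so \<open>q n a\<close> is at most the mean
    slope of \<open>p n\<close> over \<open>[a/2, a]\<close>.\<close>
  have q_bd: "\<exists>K. \<forall>n. q n a \<le> K" if a: "a > 0" for a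
  proof -
    obtain K1 where K1: "\<And>n. \<bar>p n (a/2)\<bar> \<le> K1" using p_bd[of "a/2"] a by auto
    obtain K2 where K2: "\<And>n. \<bar>p n a\<bar> \<le> K2" using p_bd[of a] a by auto
    have "q n a \<le> (K1 + K2) / (a/2)" for n
    proof -
      have "\<exists>z>a/2. z < a \<and> p n a - p n (a/2) = (a - a/2) * q n z"
        by (rule MVT2) (use a dq in auto)
      then obtain z where z: "a/2 < z" "z < a" "p n a - p n (a/2) = a/2 * q n z" by auto
      have "a/2 * q n a \<le> a/2 * q n z" using z a by (intro mult_left_mono q_anti) auto
      then have "a/2 * q n a \<le> K1 + K2" using z(3) K1[of n] K2[of n] by (simp add: abs_le_iff)
      then show ?thesis using a by (simp add: field_simps)
    qed
    then show ?thesis by blast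
  qed
  have bd1: "\<exists>C. \<forall>n. \<forall>x\<in>{a..b}. \<bar>q n x\<bar> \<le> C" if a: "a > 0" for a b
  proof -
    obtain K where K: "\<And>n. q n a \<le> K" using q_bd[OF a] by auto
    have "\<bar>q n x\<bar> \<le> K" if "x \<in> {a..b}" for n x
      using q_anti[of a x n] q_nonneg[of x n] K[of n] that a by auto
    then show ?thesis by blast
  qed
  \<comment> \<open>Chain rule for \<open>q n s = c n (s\<^sup>2)\<close>. The derivative bound at
    s^2 looks back to s^2 / 2, which explains the reference point
    \<open>sqrt (a\<^sup>2 / 2)\<close> in \<open>bd2\<close>.\<close>
  define r where "r n s = deriv (c n) (s\<^sup>2) * (2 * s)" for n s
  have dr: "(q n has_real_derivative r n s) (at s)" if s: "s > 0" for n s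
  proof (rule has_field_derivative_transform_within_open[where S="{0<..}" and f="\<lambda>s. c n (s\<^sup>2)"])
    have "(c n has_real_derivative deriv (c n) (s\<^sup>2)) (at (s\<^sup>2))"
      using completely_monotone_open_has_deriv[OF cmc, of "s\<^sup>2" n] s by simp
    moreover have "((\<lambda>s. s\<^sup>2) has_real_derivative 2 * s) (at s)"
      by (auto intro!: derivative_eq_intros)
    ultimately show "((\<lambda>s. c n (s\<^sup>2)) has_real_derivative r n s) (at s)"
      unfolding r_def by (rule DERIV_chain2)
  qed (use s qc in auto)
  have bd2: "\<exists>C. \<forall>n. \<forall>x\<in>{a..b}. \<bar>r n x\<bar> \<le> C" if a: "a > 0" for a b
  proof -
    obtain K where K: "\<And>n. q n (sqrt (a\<^sup>2 / 2)) \<le> K" using q_bd[of "sqrt (a\<^sup>2 / 2)"] a by auto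
    have "\<bar>r n s\<bar> \<le> 4 / a * K" if s: "s \<in> {a..b}" for n s
    proof -
      have s0: "s > 0" using s a by simp
      have "c n (s\<^sup>2 / 2) \<le> c n (a\<^sup>2 / 2)"
        using s a by (intro completely_monotone_open_antimono[OF cmc]) (auto intro!: divide_right_mono power_mono)
      then have c: "c n (s\<^sup>2 / 2) \<le> K" using K[of n] by (simp add: c_def)
      have c0: "c n (s\<^sup>2 / 2) \<ge> 0" using completely_monotone_open_nonneg[OF cmc, of "s\<^sup>2/2" n] s0 by simp
      have "\<bar>r n s\<bar> = \<bar>deriv (c n) (s\<^sup>2)\<bar> * (2 * s)" using s0 by (simp add: r_def abs_mult)
      also have "\<dots> \<le> (2 / s\<^sup>2 * c n (s\<^sup>2 / 2)) * (2 * s)"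
        using completely_monotone_open_deriv_bound[OF cmc, of "s\<^sup>2" n] s0 by (intro mult_right_mono) auto
      also have "\<dots> = 4 / s * c n (s\<^sup>2 / 2)" using s0 by (simp add: power2_eq_square)
      also have "\<dots> \<le> 4 / a * K"
        using s a c c0 by (intro mult_mono divide_left_mono) auto
      finally show ?thesis .
    qed
    then show ?thesis by blast
  qed
  obtain G where G: "\<And>x. x > 0 \<Longrightarrow> (\<lambda>n. p n x) \<longlonglongrightarrow> G x"
    and dF: "\<And>x. x > 0 \<Longrightarrow> (F has_real_derivative G x) (at x)"
    using tendsto_deriv_if_bounded_second_deriv[OF dp dq bd1 lim] by blast
  obtain H where H: "\<And>x. x > 0 \<Longrightarrow> (\<lambda>n. q n x) \<longlonglongrightarrow> H x"
    and dG: "\<And>x. x > 0 \<Longrightarrow> (G has_real_derivative H x) (at x)"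
    using tendsto_deriv_if_bounded_second_deriv[OF dq dr bd2 G] by blast
  have "completely_monotone_open (\<lambda>t. H (sqrt t))"
    by (rule completely_monotone_open_tendsto[where f="\<lambda>n t. q n (sqrt t)", OF cmq]) (use H in auto)
  then show ?thesis
    unfolding cm_curvature_def by (rule_tac exI[of _ G], rule_tac exI[of _ H]) (use dF dG in auto)
qed

subsection \<open>Expected absolute value of a Gaussian variable\<close>

text \<open>An antiderivative of \<open>(s - t) * f'' s\<close> is
  \<open>(s - t) * f' s - f s\<close>, which tends to \<open>- t * L\<close>; the half-line above
  \<open>t\<close> thus contributes \<open>f t - t * L\<close>. Reflection turns the half-line below
  \<open>t\<close> into the same integral for \<open>- t\<close>, and the two terms with
  \<open>L\<close> cancel. The identity serves both the Gaussian density and \<phi>''.\<close>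

lemma nn_integral_abs_diff_second_deriv:
  fixes f f' f'' :: "real \<Rightarrow> real"
  assumes d1: "\<And>x. (f has_real_derivative f' x) (at x)"
    and d2: "\<And>x. (f' has_real_derivative f'' x) (at x)"
    and [measurable]: "f'' \<in> borel_measurable borel"
    and nonneg: "\<And>x. f'' x \<ge> 0" and even: "\<And>x. f (- x) = f x" and even'': "\<And>x. f'' (- x) = f'' x"
    and lim: "((\<lambda>x. x * f' x - f x) \<longlongrightarrow> 0) at_top" and lim': "(f' \<longlongrightarrow> L) at_top"
  shows "(\<integral>\<^sup>+s. ennreal (\<bar>t - s\<bar> * f'' s) \<partial>lborel) = ennreal (2 * f t)"
proof -
  have half: "(\<integral>\<^sup>+s. ennreal ((s - t) * f'' s) * indicator {t..} s \<partial>lborel) = ennreal (f t - t * L)"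
    and half_nn: "0 \<le> f t - t * L" for t
  proof -
    have l: "((\<lambda>s. (s * f' s - f s) - t * f' s) \<longlongrightarrow> 0 - t * L) at_top"
      by (intro tendsto_intros lim lim')
    have "(\<integral>\<^sup>+s. ennreal ((s - t) * f'' s) * indicator {t..} s \<partial>lborel)
        = (0 - t * L) - ((t * f' t - f t) - t * f' t)"
      by (rule nn_integral_FTC_atLeast[OF _ _ _ l])
        (use d1 d2 nonneg in \<open>auto intro!: derivative_eq_intros mult_nonneg_nonneg simp: algebra_simps mult_right_mono\<close>)
    then show "(\<integral>\<^sup>+s. ennreal ((s - t) * f'' s) * indicator {t..} s \<partial>lborel) = ennreal (f t - t * L)"
      by simp
    \<comment> \<open>\<open>ennreal\<close> truncates negative reals, so the halves can be added
      only when both are known to be nonnegative. The antiderivative increases from its value at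
      \<open>t\<close> to its limit.\<close>
    have "((t * f' t - f t) - t * f' t) \<le> 0 - t * L"
    proof (rule tendsto_lowerbound[OF l])
      show "\<forall>\<^sub>F s in at_top. t * f' t - f t - t * f' t \<le> s * f' s - f s - t * f' s"
        using eventually_ge_at_top[of t]
      proof eventually_elim
        case (elim s)
        show ?case
        proof (rule DERIV_nonneg_imp_nondecreasing[OF elim])
          fix x assume "t \<le> x"
          then show "\<exists>y. ((\<lambda>s. s * f' s - f s - t * f' s) has_real_derivative y) (at x) \<and> y \<ge> 0"
            by (intro exI[of _ "(x - t) * f'' x"])
              (use nonneg d1 d2 in \<open>auto intro!: derivative_eq_intros simp: algebra_simps mult_right_mono\<close>)
        qed
      qed
    qed auto
    then show "0 \<le> f t - t * L" by simp
  qed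
  have "(\<integral>\<^sup>+s. ennreal (\<bar>t - s\<bar> * f'' s) \<partial>lborel) =
    (\<integral>\<^sup>+s. ennreal ((s - t) * f'' s) * indicator {t..} s + ennreal ((t - s) * f'' s) * indicator {..t} s \<partial>lborel)"
    by (intro nn_integral_cong) (auto simp: indicator_def abs_if)
  also have "\<dots> = (\<integral>\<^sup>+s. ennreal ((s - t) * f'' s) * indicator {t..} s \<partial>lborel) +
      (\<integral>\<^sup>+s. ennreal ((t - s) * f'' s) * indicator {..t} s \<partial>lborel)"
    by (rule nn_integral_add) auto
  also have "(\<integral>\<^sup>+s. ennreal ((t - s) * f'' s) * indicator {..t} s \<partial>lborel) =
     (\<integral>\<^sup>+s. ennreal ((s - (-t)) * f'' s) * indicator {-t..} s \<partial>lborel)"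
    by (subst nn_integral_real_affine[of _ "-1" 0])
      (auto intro!: nn_integral_cong simp: indicator_def even'' add.commute)
  also have "\<dots> = ennreal (f (-t) - (-t) * L)" by (rule half)
  also have "ennreal (f (-t) - (-t) * L) = ennreal (f t + t * L)" by (simp add: even)
  also have "(\<integral>\<^sup>+s. ennreal ((s - t) * f'' s) * indicator {t..} s \<partial>lborel) = ennreal (f t - t * L)"
    by (rule half)
  also have "ennreal (f t - t * L) + ennreal (f t + t * L) = ennreal (2 * f t)"
    using half_nn[of t] half_nn[of "-t"] by (subst ennreal_plus[symmetric]) (auto simp: even)
  finally show ?thesis .
qed

definition gauss_abs :: "real \<Rightarrow> real \<Rightarrow> real" where
  "gauss_abs t v = (LINT x|std_normal_distribution. \<bar>t + v * x\<bar>)"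

lemma integrable_abs_affine_std_normal:
  "integrable std_normal_distribution (\<lambda>x. \<bar>t + v * x\<bar>)"
proof -
  interpret real_distribution std_normal_distribution by (rule real_dist_normal_dist)
  show ?thesis using integrable_std_normal_distribution_moment[of 1] by auto
qed

lemma gauss_abs_nonneg: "gauss_abs t v \<ge> 0"
  unfolding gauss_abs_def by (rule Bochner_Integration.integral_nonneg) auto

lemma nn_integral_gauss_abs:
  "(\<integral>\<^sup>+x. ennreal \<bar>t + v * x\<bar> \<partial>std_normal_distribution) = ennreal (gauss_abs t v)"
  unfolding gauss_abs_def
  by (rule nn_integral_eq_integral[OF integrable_abs_affine_std_normal]) auto

lemma gauss_abs_lborel:
  "(\<integral>\<^sup>+x. ennreal (\<bar>t + v * x\<bar> * std_normal_density x) \<partial>lborel) = ennreal (gauss_abs t v)"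
  unfolding nn_integral_gauss_abs[symmetric]
  by (subst nn_integral_density) (auto simp: ennreal_mult' mult.commute)

lemma gauss_abs_minus: "gauss_abs t (- v) = gauss_abs t v"
proof -
  have "ennreal (gauss_abs t (- v)) = ennreal (gauss_abs t v)"
    unfolding gauss_abs_lborel[symmetric]
    by (subst nn_integral_real_affine[of _ "-1" 0]) (auto simp: normal_density_def)
  then show ?thesis by (simp add: gauss_abs_nonneg)
qed

lemma gauss_abs_scale: "a \<ge> 0 \<Longrightarrow> gauss_abs (a * t) (a * v) = a * gauss_abs t v"
proof -
  assume a: "a \<ge> 0"
  have "gauss_abs (a * t) (a * v) = (LINT x|std_normal_distribution. a * \<bar>t + v * x\<bar>)"
    unfolding gauss_abs_def
    by (rule Bochner_Integration.integral_cong)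
       (use a in \<open>auto simp: abs_mult distrib_left[symmetric] mult.assoc\<close>)
  then show ?thesis by (simp add: gauss_abs_def)
qed

lemma gauss_abs_lipschitz:
  "\<bar>gauss_abs t v - gauss_abs t' v'\<bar> \<le> \<bar>t - t'\<bar> + \<bar>v - v'\<bar>"
proof -
  interpret real_distribution std_normal_distribution by (rule real_dist_normal_dist)
  let ?\<gamma> = "std_normal_distribution"
  have i: "integrable ?\<gamma> (\<lambda>x. x)" using integrable_std_normal_distribution_moment[of 1] by simp
  \<comment> \<open>E|g| is at most the square root of E g^2 = 1, by nonnegativity of a variance;
    this makes the Lipschitz constant in \<open>v\<close> equal to 1.\<close>
  have "(LINT x|?\<gamma>. \<bar>x\<bar>)\<^sup>2 \<le> (LINT x|?\<gamma>. \<bar>x\<bar>\<^sup>2)"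
  proof -
    have i2: "integrable ?\<gamma> (\<lambda>x. \<bar>x\<bar>\<^sup>2)" using integrable_std_normal_distribution_moment[of 2] by simp
    have "0 \<le> variance (\<lambda>x. \<bar>x\<bar>)" by simp
    also have "\<dots> = (LINT x|?\<gamma>. \<bar>x\<bar>\<^sup>2) - (LINT x|?\<gamma>. \<bar>x\<bar>)\<^sup>2"
      using i i2 by (intro variance_eq) auto
    finally show ?thesis by simp
  qed
  also have "\<dots> = 1" using std_normal_distribution_even_moments[of 1] by simp
  finally have m1: "(LINT x|?\<gamma>. \<bar>x\<bar>) \<le> 1"
    using abs_le_square_iff[of "LINT x|?\<gamma>. \<bar>x\<bar>" 1] by simp
  have "\<bar>gauss_abs t v - gauss_abs t' v'\<bar> = \<bar>LINT x|?\<gamma>. \<bar>t + v * x\<bar> - \<bar>t' + v' * x\<bar>\<bar>"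
    unfolding gauss_abs_def
    by (subst Bochner_Integration.integral_diff) (auto simp: integrable_abs_affine_std_normal)
  also have "\<dots> \<le> (LINT x|?\<gamma>. \<bar>\<bar>t + v * x\<bar> - \<bar>t' + v' * x\<bar>\<bar>)"
    by (rule integral_abs_bound)
  also have "\<dots> \<le> (LINT x|?\<gamma>. \<bar>t - t'\<bar> + \<bar>v - v'\<bar> * \<bar>x\<bar>)"
  proof (rule integral_mono)
    fix x :: real
    have "\<bar>\<bar>t + v * x\<bar> - \<bar>t' + v' * x\<bar>\<bar> \<le> \<bar>(t - t') + (v - v') * x\<bar>" by (simp add: algebra_simps)
    also have "\<dots> \<le> \<bar>t - t'\<bar> + \<bar>v - v'\<bar> * \<bar>x\<bar>" unfolding abs_mult[symmetric] by (rule abs_triangle_ineq)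
    finally show "\<bar>\<bar>t + v * x\<bar> - \<bar>t' + v' * x\<bar>\<bar> \<le> \<bar>t - t'\<bar> + \<bar>v - v'\<bar> * \<bar>x\<bar>" .
  qed (use i in \<open>auto intro!: Bochner_Integration.integrable_diff integrable_abs_affine_std_normal\<close>)
  also have "\<dots> = \<bar>t - t'\<bar> + \<bar>v - v'\<bar> * (LINT x|?\<gamma>. \<bar>x\<bar>)"
    using i prob_space by simp
  also have "\<dots> \<le> \<bar>t - t'\<bar> + \<bar>v - v'\<bar> * 1" using m1 by (intro add_mono mult_left_mono) auto
  finally show ?thesis by simp
qed

text \<open>An explicit candidate \<open>Q\<close> with second derivative twice the normal density
  is identified with \<open>gauss_abs t 1\<close> by
  \<open>nn_integral_abs_diff_second_deriv\<close>, so that nothing is differentiated under an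
  integral.\<close>

lemma gauss_abs_second_deriv:
  obtains A where "\<And>x. ((\<lambda>t. gauss_abs t 1) has_real_derivative A x) (at x)"
    "\<And>x. (A has_real_derivative 2 * std_normal_density x) (at x)"
proof -
  interpret real_distribution std_normal_distribution by (rule real_dist_normal_dist)
  let ?n = std_normal_density
  have dn: "(?n has_real_derivative - x * ?n x) (at x)" for x
  proof -
    have "((\<lambda>x. C * exp (- x\<^sup>2 / 2)) has_real_derivative - x * (C * exp (- x\<^sup>2 / 2))) (at x)" for C :: real
      by (auto intro!: derivative_eq_intros)
    from this[of "1 / sqrt (2 * pi)"] show ?thesis by (simp only: std_normal_density_def [abs_def])
  qed
  obtain A0 where A0: "\<And>x::real. (A0 has_vector_derivative ?n x) (at x)"
    using einterval_antiderivative[of "-\<infinity>" "\<infinity>" ?n] dn[THEN DERIV_isCont] by auto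
  define A where "A x = A0 x - A0 0" for x
  have dA: "(A has_real_derivative ?n x) (at x)" for x
    using A0[of x] unfolding A_def has_real_derivative_iff_has_vector_derivative
    by (auto intro!: derivative_eq_intros)
  have odd: "A (- x) = - A x" for x
  proof -
    have "((\<lambda>x. A (- x) + A x) has_real_derivative 0) (at y)" for y
    proof -
      have "((\<lambda>x. A (- x)) has_real_derivative ?n (- y) * (- 1)) (at y)"
        by (rule DERIV_chain2[where g=uminus, OF dA]) (auto intro!: derivative_eq_intros)
      from DERIV_add[OF this dA[of y]] show ?thesis by (simp add: normal_density_def)
    qed
    then have "(\<lambda>x. A (- x) + A x) x = (\<lambda>x. A (- x) + A x) 0"
      using DERIV_isconst_all by blast
    then show ?thesis by (simp add: A_def)
  qed
  have A_mono: "A x \<le> A y" if "x \<le> y" for x y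
    by (rule DERIV_nonneg_imp_nondecreasing[OF that]) (meson dA normal_density_nonneg)
  \<comment> \<open>The comparison with the distribution function gives \<open>A\<close> a finite
    limit at infinity.\<close>
  have A_cdf: "A x = cdf std_normal_distribution x - cdf std_normal_distribution 0" if "x > 0" for x
  proof -
    have mono: "A 0 \<le> A x" using A_mono that by simp
    have "emeasure std_normal_distribution {0<..x} = (\<integral>\<^sup>+y. ennreal (?n y) * indicator {0<..x} y \<partial>lborel)"
      by (rule emeasure_density) auto
    also have "\<dots> = (\<integral>\<^sup>+y. ennreal (?n y) * indicator {0..x} y \<partial>lborel)"
      by (rule nn_integral_cong_AE, use AE_lborel_singleton[of 0] in eventually_elim) (auto simp: indicator_def)
    also have "\<dots> = ennreal (A x - A 0)"
      by (rule nn_integral_FTC_Icc) (use dA that in \<open>auto intro: has_field_derivative_at_within\<close>)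
    finally have "measure std_normal_distribution {0<..x} = A x - A 0"
      using mono by (simp add: measure_def)
    then show ?thesis using cdf_diff_eq[OF that] by (simp add: A_def)
  qed
  have limA: "(A \<longlongrightarrow> 1 - cdf std_normal_distribution 0) at_top"
  proof (rule Lim_transform_eventually)
    show "((\<lambda>x. cdf std_normal_distribution x - cdf std_normal_distribution 0) \<longlongrightarrow> 1 - cdf std_normal_distribution 0) at_top"
      by (intro tendsto_intros cdf_lim_at_top_prob)
    show "\<forall>\<^sub>F x in at_top. cdf std_normal_distribution x - cdf std_normal_distribution 0 = A x"
      using eventually_gt_at_top[of 0] by eventually_elim (simp add: A_cdf)
  qed
  have limn: "(?n \<longlongrightarrow> 0) at_top"
    unfolding normal_density_def by real_asymp
  \<comment> \<open>In the derivative of \<open>Q\<close> the terms \<open>2 * x * ?n x\<close> and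
    \<open>- 2 * x * ?n x\<close> cancel, which leaves \<open>2 * A x\<close>.\<close>
  define Q where "Q x = x * (2 * A x) + 2 * ?n x" for x
  have dQ: "(Q has_real_derivative 2 * A x) (at x)" for x
    unfolding Q_def by (auto intro!: derivative_eq_intros dA dn)
  have dA2: "((\<lambda>x. 2 * A x) has_real_derivative 2 * ?n x) (at x)" for x
    by (auto intro!: derivative_eq_intros dA)
  have "gauss_abs t 1 = Q t" for t
  proof -
    have "ennreal (2 * gauss_abs t 1) = 2 * ennreal (gauss_abs t (-1))"
      by (simp add: gauss_abs_minus gauss_abs_nonneg ennreal_mult')
    also have "\<dots> = (\<integral>\<^sup>+s. 2 * ennreal (\<bar>t + (-1) * s\<bar> * ?n s) \<partial>lborel)"
      unfolding gauss_abs_lborel[symmetric] by (subst nn_integral_cmult) auto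
    also have "\<dots> = (\<integral>\<^sup>+s. ennreal (\<bar>t - s\<bar> * (2 * ?n s)) \<partial>lborel)"
      by (intro nn_integral_cong) (auto simp: ennreal_mult'[symmetric] simp flip: ennreal_numeral intro!: arg_cong[where f=ennreal])
    also have "\<dots> = ennreal (2 * Q t)"
    proof (rule nn_integral_abs_diff_second_deriv[OF dQ dA2])
      show "Q (- x) = Q x" for x by (simp add: Q_def odd normal_density_def)
      show "2 * ?n (- x) = 2 * ?n x" for x by (simp add: normal_density_def)
      have "((\<lambda>x. - 2 * ?n x) \<longlongrightarrow> - 2 * 0) at_top" by (intro tendsto_intros limn)
      then show "((\<lambda>x. x * (2 * A x) - Q x) \<longlongrightarrow> 0) at_top" by (simp add: Q_def)
      show "((\<lambda>x. 2 * A x) \<longlongrightarrow> 2 * (1 - cdf std_normal_distribution 0)) at_top"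
        by (intro tendsto_intros limA)
    qed auto
    finally have "ennreal (2 * gauss_abs t 1) = ennreal (2 * Q t)" .
    moreover have "Q t \<ge> 0"
    proof -
      have pos: "A x \<ge> 0" if "x \<ge> 0" for x
        using A_mono[OF that] by (simp add: A_def)
      show ?thesis
        using pos[of t] pos[of "-t"] odd[of t] by (cases "t \<ge> 0") (auto simp: Q_def mult_nonpos_nonpos)
    qed
    ultimately show ?thesis using gauss_abs_nonneg[of t 1] by simp
  qed
  then have "(\<lambda>t. gauss_abs t 1) = Q" by auto
  then show ?thesis using that[of "\<lambda>x. 2 * A x"] dQ dA2 by simp
qed

lemma cm_curvature_gauss_abs:
  assumes "v \<ge> 0" "w \<ge> 0"
  shows "cm_curvature (\<lambda>t. w * gauss_abs (c * t) v)"
proof (cases "v = 0")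
  \<comment> \<open>Without a Gaussian part the function is a multiple of |t|. Its kink at 0 lies
    outside the range of \<open>cm_curvature\<close>, and its curvature elsewhere is 0.\<close>
  case True
  interpret real_distribution std_normal_distribution by (rule real_dist_normal_dist)
  have eq: "gauss_abs (c * t) v = \<bar>c\<bar> * \<bar>t\<bar>" for t
    using True prob_space by (simp add: gauss_abs_def abs_mult)
  have d: "((\<lambda>t. w * gauss_abs (c * t) v) has_real_derivative w * \<bar>c\<bar>) (at t)" if "t > 0" for t
    by (rule has_field_derivative_transform_within_open[where S="{0<..}" and f="\<lambda>t. w * \<bar>c\<bar> * t"])
      (use that in \<open>auto simp: eq intro!: derivative_eq_intros\<close>)
  have z: "completely_monotone_open (\<lambda>t. 0)"
    using completely_monotone_open_exp[of 0 0] by simp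
  show ?thesis
    unfolding cm_curvature_def
    by (rule exI[of _ "\<lambda>t. w * \<bar>c\<bar>"], rule exI[of _ "\<lambda>t. 0"]) (use d z in auto)
next
  case False
  with assms have v: "v > 0" by simp
  obtain A where dg: "\<And>x. ((\<lambda>t. gauss_abs t 1) has_real_derivative A x) (at x)"
    and dA: "\<And>x. (A has_real_derivative 2 * std_normal_density x) (at x)"
    using gauss_abs_second_deriv by blast
  have eq: "gauss_abs (c * t) v = v * gauss_abs (c / v * t) 1" for t
    using gauss_abs_scale[of v "c / v * t" 1] v by simp
  show ?thesis
    unfolding cm_curvature_def
  proof (rule exI[of _ "\<lambda>t. w * (c * A (c / v * t))"],
      rule exI[of _ "\<lambda>t. w * (c * (2 * std_normal_density (c / v * t) * (c / v)))"], intro conjI allI impI)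
    fix t :: real
    have lin: "((\<lambda>t. c / v * t) has_real_derivative c / v) (at t)" by (rule DERIV_cmult_Id)
    have "((\<lambda>t. w * (v * gauss_abs (c / v * t) 1)) has_real_derivative w * (v * (A (c / v * t) * (c / v)))) (at t)"
      by (intro DERIV_cmult DERIV_chain2[OF dg lin])
    then show "((\<lambda>t. w * gauss_abs (c * t) v) has_real_derivative w * (c * A (c / v * t))) (at t)"
      unfolding eq using v by (simp add: mult_ac)
    show "((\<lambda>t. w * (c * A (c / v * t))) has_real_derivative
        w * (c * (2 * std_normal_density (c / v * t) * (c / v)))) (at t)"
      by (intro DERIV_cmult DERIV_chain2[OF dA lin])
  next
    have "completely_monotone_open (\<lambda>t. (w * (2 * c\<^sup>2 / v / sqrt (2 * pi))) * exp (- (c\<^sup>2 / v\<^sup>2 / 2) * t))"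
      by (rule completely_monotone_open_exp) (use v assms in auto)
    then show "completely_monotone_open (\<lambda>t. w * (c * (2 * std_normal_density (c / v * sqrt t) * (c / v))))"
    proof (rule completely_monotone_open_cong)
      fix t :: real assume "t > 0"
      then have "(c / v * sqrt t)\<^sup>2 / 2 = c\<^sup>2 / v\<^sup>2 / 2 * t"
        by (simp add: power_mult_distrib power_divide)
      then show "w * (2 * c\<^sup>2 / v / sqrt (2 * pi)) * exp (- (c\<^sup>2 / v\<^sup>2 / 2) * t) =
        w * (c * (2 * std_normal_density (c / v * sqrt t) * (c / v)))"
        by (simp add: std_normal_density_def power2_eq_square[of c] power2_eq_square[of v] mult_ac)
    qed
  qed
qed

text \<open>\<open>exp (- s\<^sup>2 * u)\<close> is \<open>sqrt (pi / u)\<close> times the density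
  of a centred normal variable of variance \<open>1 / (2 * u)\<close>; the substitution
  \<open>s = v * x\<close> makes that variable standard.\<close>

lemma nn_integral_abs_diff_exp_square:
  assumes u: "u > 0"
  shows "(\<integral>\<^sup>+s. ennreal (\<bar>t - s\<bar> * exp (- s\<^sup>2 * u)) \<partial>lborel)
    = ennreal (sqrt (pi / u) * gauss_abs t (1 / sqrt (2 * u)))"
proof -
  define v where "v = 1 / sqrt (2 * u)"
  have v: "v > 0" "v\<^sup>2 * u = 1 / 2" using u by (auto simp: v_def power_divide)
  have c: "v * sqrt (2 * pi) = sqrt (pi / u)"
    using u by (simp add: v_def real_sqrt_mult real_sqrt_divide field_simps)
  have "(\<integral>\<^sup>+s. ennreal (\<bar>t - s\<bar> * exp (- s\<^sup>2 * u)) \<partial>lborel)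
      = ennreal v * (\<integral>\<^sup>+x. ennreal (\<bar>t - v * x\<bar> * exp (- (v * x)\<^sup>2 * u)) \<partial>lborel)"
    using v by (subst nn_integral_real_affine[of _ v 0]) auto
  also have "(\<integral>\<^sup>+x. ennreal (\<bar>t - v * x\<bar> * exp (- (v * x)\<^sup>2 * u)) \<partial>lborel)
      = (\<integral>\<^sup>+x. ennreal (sqrt (2 * pi)) * ennreal (\<bar>t + (- v) * x\<bar> * std_normal_density x) \<partial>lborel)"
  proof (rule nn_integral_cong)
    fix x :: real
    have "(v * x)\<^sup>2 * u = x\<^sup>2 / 2" using v(2) by (simp add: power_mult_distrib mult_ac)
    then show "ennreal (\<bar>t - v * x\<bar> * exp (- (v * x)\<^sup>2 * u)) =
      ennreal (sqrt (2 * pi)) * ennreal (\<bar>t + (- v) * x\<bar> * std_normal_density x)"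
      by (subst ennreal_mult'[symmetric]) (auto simp: std_normal_density_def)
  qed
  also have "\<dots> = ennreal (sqrt (2 * pi)) * ennreal (gauss_abs t (- v))"
    unfolding gauss_abs_lborel[symmetric] by (rule nn_integral_cmult) auto
  also have "ennreal v * (ennreal (sqrt (2 * pi)) * ennreal (gauss_abs t (- v))) = ennreal (v * sqrt (2 * pi) * gauss_abs t v)"
    using v by (simp add: ennreal_mult' gauss_abs_minus gauss_abs_nonneg mult.assoc)
  finally show ?thesis unfolding c by (simp only: v_def)
qed

subsection \<open>Independent random variables on the unit interval\<close>

text \<open>\<open>odd \<lfloor>2 ^ Suc j * x\<rfloor>\<close> says that binary digit number
  \<open>j + 1\<close> of \<open>x\<close> is 1. Doubling \<open>x\<close> shifts the digits by one
  and leaves the later ones blind to the integer part, so each induction step either fixes the first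
  digit and halves the integral or leaves the digit free.\<close>

lemma nn_integral_binary_digits:
  fixes J :: "nat set"
  assumes "J \<subseteq> {..<n}"
  shows "(\<integral>\<^sup>+x. (\<Prod>j\<in>J. of_bool (odd \<lfloor>2 ^ Suc j * x\<rfloor>)) * indicator {0..<1::real} x \<partial>lborel)
    = ennreal ((1/2) ^ card J)"
  using assms
proof (induction n arbitrary: J)
  case 0
  then show ?case by simp
next
  case (Suc n)
  \<comment> \<open>\<open>G\<close> collects the conditions on all digits but the first, in the
    coordinate \<open>2 * x\<close>. Its period 1 makes both halves of the interval contribute
    equally.\<close>
  define G :: "real \<Rightarrow> ennreal" where "G x = (\<Prod>j\<in>{j. Suc j \<in> J}. of_bool (odd \<lfloor>2 ^ Suc j * x\<rfloor>))" for x
  have [measurable]: "G \<in> borel_measurable borel" unfolding G_def by measurable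
  have fin: "finite J" "finite {j. Suc j \<in> J}" "{j. Suc j \<in> J} \<subseteq> {..<n}"
    using Suc.prems finite_subset[OF Suc.prems] finite_subset[of "{j. Suc j \<in> J}" "{..<n}"] by auto
  have IH: "(\<integral>\<^sup>+x. G x * indicator {0..<1} x \<partial>lborel) = ennreal ((1/2) ^ card {j. Suc j \<in> J})"
    unfolding G_def by (rule Suc.IH) (rule fin)
  have per: "G (x + 1) = G x" for x
  proof -
    have "\<lfloor>2 ^ Suc j * (x + 1)\<rfloor> = \<lfloor>2 ^ Suc j * x\<rfloor> + 2 * 2 ^ j" for j :: nat
    proof -
      have "2 ^ Suc j * (x + 1) = 2 ^ Suc j * x + of_int (2 * 2 ^ j)" by (simp add: algebra_simps)
      then show ?thesis by (simp only: floor_add_int[symmetric])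
    qed
    then show ?thesis by (simp add: G_def)
  qed
  have shift: "(\<integral>\<^sup>+x. G x * indicator {1..<2} x \<partial>lborel) = (\<integral>\<^sup>+x. G x * indicator {0..<1} x \<partial>lborel)"
    by (subst nn_integral_real_affine[of _ 1 1])
      (auto intro!: nn_integral_cong simp: per add.commute[of 1] indicator_def)
  have dbl: "(\<integral>\<^sup>+x. G (2 * x) * indicator A (2 * x) \<partial>lborel) = ennreal (1/2) * (\<integral>\<^sup>+x. G x * indicator A x \<partial>lborel)"
    if [measurable]: "A \<in> sets borel" for A
    by (subst nn_integral_real_affine[of _ "1/2" 0]) auto
  have half: "ennreal (1/2) * (2 * y) = (y::ennreal)" for y
  proof -
    have "ennreal (1/2) * (2 * y) = ennreal (1/2) * ennreal 2 * y"
      by (simp only: mult.assoc ennreal_numeral)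
    also have "ennreal (1/2) * ennreal 2 = 1" by (subst ennreal_mult'[symmetric]) auto
    finally show ?thesis by simp
  qed
  have prodG: "(\<Prod>j\<in>Suc ` {j. Suc j \<in> J}. of_bool (odd \<lfloor>2 ^ Suc j * x\<rfloor>)) = G (2 * x)" for x
    unfolding G_def by (subst prod.reindex) (auto simp: mult_ac)
  show ?case
  proof (cases "0 \<in> J")
    case True
    then have J: "J = insert 0 (Suc ` {j. Suc j \<in> J})"
      by (auto simp: image_iff) (metis not0_implies_Suc)
    have card: "card J = Suc (card {j. Suc j \<in> J})"
      by (subst J, subst card_insert_disjoint) (auto simp: fin card_image)
    have "(\<integral>\<^sup>+x. (\<Prod>j\<in>J. of_bool (odd \<lfloor>2 ^ Suc j * x\<rfloor>)) * indicator {0..<1::real} x \<partial>lborel)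
        = (\<integral>\<^sup>+x. G (2 * x) * indicator {1..<2} (2 * x) \<partial>lborel)"
    proof (rule nn_integral_cong)
      fix x :: real
      have "x \<in> {0..<1} \<and> odd \<lfloor>2 * x\<rfloor> \<longleftrightarrow> 2 * x \<in> {1..<2}"
      proof safe
        assume x: "x \<in> {0..<1}" "odd \<lfloor>2 * x\<rfloor>"
        then have "\<lfloor>2 * x\<rfloor> \<noteq> 0" "\<lfloor>2 * x\<rfloor> \<ge> 0" by auto
        then have "\<lfloor>2 * x\<rfloor> \<ge> 1" by linarith
        then show "2 * x \<in> {1..<2}" using x by (auto simp: le_floor_iff)
      next
        assume "2 * x \<in> {1..<2}"
        then show "x \<in> {0..<1}" by auto
      next
        assume "2 * x \<in> {1..<2}"
        then have "\<lfloor>2 * x\<rfloor> = 1" by (intro floor_unique) auto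
        moreover assume "even \<lfloor>2 * x\<rfloor>"
        ultimately show False by simp
      qed
      then show "(\<Prod>j\<in>J. of_bool (odd \<lfloor>2 ^ Suc j * x\<rfloor>)) * indicator {0..<1::real} x
        = G (2 * x) * (indicator {1..<2} (2 * x) :: ennreal)"
        by (subst J, subst prod.insert) (auto simp: fin prodG[unfolded power_Suc] indicator_def)
    qed
    also have "\<dots> = ennreal (1/2) * (\<integral>\<^sup>+x. G x * indicator {1..<2} x \<partial>lborel)"
      by (rule dbl) simp
    also have "\<dots> = ennreal (1/2) * ennreal ((1/2) ^ card {j. Suc j \<in> J})" unfolding shift IH ..
    also have "\<dots> = ennreal ((1/2) ^ card J)"
      unfolding card by (subst ennreal_mult'[symmetric]) auto
    finally show ?thesis .
  next
    case False
    have J: "J = Suc ` {j. Suc j \<in> J}"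
    proof safe
      fix x assume "x \<in> J"
      then show "x \<in> Suc ` {j. Suc j \<in> J}" using False by (cases x) auto
    qed
    have card: "card J = card {j. Suc j \<in> J}" by (subst J) (auto simp: card_image)
    have "(\<integral>\<^sup>+x. (\<Prod>j\<in>J. of_bool (odd \<lfloor>2 ^ Suc j * x\<rfloor>)) * indicator {0..<1::real} x \<partial>lborel)
        = (\<integral>\<^sup>+x. G (2 * x) * indicator {0..<2} (2 * x) \<partial>lborel)"
      by (subst J) (auto intro!: nn_integral_cong simp: prodG[unfolded power_Suc] indicator_def)
    also have "\<dots> = ennreal (1/2) * (\<integral>\<^sup>+x. G x * indicator {0..<2} x \<partial>lborel)"
      by (rule dbl) simp
    also have "(\<integral>\<^sup>+x. G x * indicator {0..<2} x \<partial>lborel) =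
       (\<integral>\<^sup>+x. G x * indicator {0..<1} x + G x * indicator {1..<2} x \<partial>lborel)"
      by (intro nn_integral_cong) (auto simp: indicator_def)
    also have "\<dots> = (\<integral>\<^sup>+x. G x * indicator {0..<1} x \<partial>lborel) + (\<integral>\<^sup>+x. G x * indicator {1..<2} x \<partial>lborel)"
      by (rule nn_integral_add) auto
    also have "\<dots> = 2 * (\<integral>\<^sup>+x. G x * indicator {0..<1} x \<partial>lborel)" unfolding shift by (simp add: mult_2)
    also have "ennreal (1/2) * (2 * (\<integral>\<^sup>+x. G x * indicator {0..<1} x \<partial>lborel)) = ennreal ((1/2) ^ card J)"
      unfolding half IH card ..
    finally show ?thesis .
  qed
qed

abbreviation unit_interval :: "real measure" where
  "unit_interval \<equiv> lebesgue_on {0<..<1}"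

lemma prob_space_unit_interval: "prob_space unit_interval"
  by (rule prob_spaceI) (simp add: emeasure_restrict_space)

lemma measurable_unit_intervalI [measurable (raw)]:
  "f \<in> measurable borel N \<Longrightarrow> f \<in> measurable unit_interval N"
  by (simp add: measurable_completion measurable_restrict_space1)

lemma emeasure_unit_interval:
  assumes "{x\<in>{0<..<1}. P x} \<in> sets borel"
  shows "emeasure unit_interval {x\<in>space unit_interval. P x} = emeasure lborel {x\<in>{0<..<1}. P x}"
  using assms by (subst emeasure_restrict_space) auto

text \<open>The partial sums are the dyadic truncations
  \<open>\<lfloor>2 ^ n * x\<rfloor> / 2 ^ n\<close>, because each floor is half of the next one,
  rounded down.\<close>

lemma binary_expansion_sums:
  fixes x :: real
  assumes "0 \<le> x" "x < 1"
  shows "(\<lambda>k. of_bool (odd \<lfloor>2 ^ Suc k * x\<rfloor>) / 2 ^ Suc k) sums x"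
proof -
  have part: "(\<Sum>k<n. of_bool (odd \<lfloor>2 ^ Suc k * x\<rfloor>) / 2 ^ Suc k) = real_of_int \<lfloor>2 ^ n * x\<rfloor> / 2 ^ n" for n
  proof (induction n)
    case 0
    have "\<lfloor>x\<rfloor> = 0" using assms by (intro floor_unique) auto
    then show ?case by simp
  next
    case (Suc n)
    have "\<lfloor>2 ^ n * x\<rfloor> = \<lfloor>2 ^ Suc n * x / of_int 2\<rfloor>" by (simp add: mult_ac)
    also have "\<dots> = \<lfloor>2 ^ Suc n * x\<rfloor> div 2" by (rule floor_divide_real_eq_div) simp
    finally have "\<lfloor>2 ^ n * x\<rfloor> = \<lfloor>2 ^ Suc n * x\<rfloor> div 2" .
    moreover have "real_of_int a = 2 * real_of_int (a div 2) + of_bool (odd a)" for a :: int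
    proof (cases "odd a")
      case True
      then have "a = 2 * (a div 2) + 1" by simp
      then have "real_of_int a = real_of_int (2 * (a div 2) + 1)" by (rule arg_cong)
      also have "\<dots> = 2 * real_of_int (a div 2) + 1"
        by (simp only: of_int_add of_int_mult of_int_numeral of_int_1)
      finally show ?thesis using True by (simp only: of_bool_eq not_False_eq_True)
    next
      case False
      then have "a = 2 * (a div 2)" by simp
      then have "real_of_int a = real_of_int (2 * (a div 2))" by (rule arg_cong)
      also have "\<dots> = 2 * real_of_int (a div 2)" by (simp only: of_int_mult of_int_numeral)
      finally show ?thesis using False by (simp only: of_bool_eq add_0_right)
    qed
    ultimately have eq: "real_of_int \<lfloor>2 ^ Suc n * x\<rfloor> =
        2 * real_of_int \<lfloor>2 ^ n * x\<rfloor> + of_bool (odd \<lfloor>2 ^ Suc n * x\<rfloor>)" by metis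
    have "(\<Sum>k<Suc n. of_bool (odd \<lfloor>2 ^ Suc k * x\<rfloor>) / 2 ^ Suc k)
      = real_of_int \<lfloor>2 ^ n * x\<rfloor> / 2 ^ n + of_bool (odd \<lfloor>2 ^ Suc n * x\<rfloor>) / 2 ^ Suc n"
      unfolding sum.lessThan_Suc Suc.IH ..
    also have "\<dots> = (2 * real_of_int \<lfloor>2 ^ n * x\<rfloor> + of_bool (odd \<lfloor>2 ^ Suc n * x\<rfloor>)) / 2 ^ Suc n"
      unfolding add_divide_distrib power_Suc by (rule arg_cong2[where f="(+)"]) simp_all
    finally show ?case unfolding eq[symmetric] .
  qed
  have "(\<lambda>n. real_of_int \<lfloor>2 ^ n * x\<rfloor> / 2 ^ n) \<longlonglongrightarrow> x"
  proof (rule tendsto_sandwich[where f="\<lambda>n. x - (1/2)^n" and h="\<lambda>n. x"])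
    show "\<forall>\<^sub>F n in sequentially. x - (1/2) ^ n \<le> real_of_int \<lfloor>2 ^ n * x\<rfloor> / 2 ^ n"
    proof (intro always_eventually allI)
      fix n :: nat
      have "(2 ^ n * x - 1) / 2 ^ n \<le> real_of_int \<lfloor>2 ^ n * x\<rfloor> / 2 ^ n"
        by (intro divide_right_mono) (linarith, simp)
      then show "x - (1/2) ^ n \<le> real_of_int \<lfloor>2 ^ n * x\<rfloor> / 2 ^ n"
        by (simp add: diff_divide_distrib power_one_over)
    qed
    show "\<forall>\<^sub>F n in sequentially. real_of_int \<lfloor>2 ^ n * x\<rfloor> / 2 ^ n \<le> x"
      by (intro always_eventually allI) (simp add: divide_le_eq mult.commute)
    show "(\<lambda>n. x - (1/2) ^ n) \<longlonglongrightarrow> x"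
      by (intro tendsto_eq_intros LIMSEQ_power_zero) auto
  qed auto
  then show ?thesis unfolding sums_def part .
qed


lemma emeasure_binary_digits:
  assumes "inj e" "finite J"
  shows "emeasure unit_interval {x\<in>space unit_interval. \<forall>j\<in>J. odd \<lfloor>2 ^ Suc (e j) * x\<rfloor>} = ennreal ((1/2) ^ card J)"
proof -
  obtain n where n: "e ` J \<subseteq> {..<n}"
    using finite_nat_iff_bounded[of "e ` J"] assms by auto
  have "emeasure unit_interval {x\<in>space unit_interval. \<forall>j\<in>J. odd \<lfloor>2 ^ Suc (e j) * x\<rfloor>}
      = emeasure lborel {x\<in>{0<..<1::real}. \<forall>j\<in>J. odd \<lfloor>2 ^ Suc (e j) * x\<rfloor>}"
    using assms by (intro emeasure_unit_interval) measurable
  also have "\<dots> = (\<integral>\<^sup>+x. indicator {x\<in>{0<..<1::real}. \<forall>j\<in>J. odd \<lfloor>2 ^ Suc (e j) * x\<rfloor>} x \<partial>lborel)"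
    using assms by (intro nn_integral_indicator[symmetric]) measurable
  also have "\<dots> = (\<integral>\<^sup>+x. (\<Prod>j\<in>e ` J. of_bool (odd \<lfloor>2 ^ Suc j * x\<rfloor>)) * indicator {0..<1::real} x \<partial>lborel)"
  proof (rule nn_integral_cong_AE, use AE_lborel_singleton[of 0] in eventually_elim)
    case (elim x)
    have "(\<Prod>j\<in>e ` J. of_bool (odd \<lfloor>2 ^ Suc j * x\<rfloor>) :: ennreal) = of_bool (\<forall>j\<in>J. odd \<lfloor>2 ^ Suc (e j) * x\<rfloor>)"
      using \<open>finite J\<close> by (auto simp: of_bool_def intro!: prod.neutral)
    then show ?case using elim by (auto simp: indicator_def)
  qed
  also have "\<dots> = ennreal ((1/2) ^ card (e ` J))"
    by (rule nn_integral_binary_digits[OF n])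
  also have "card (e ` J) = card J" using assms by (intro card_image) (auto intro: inj_on_subset)
  finally show ?thesis .
qed

lemma vimage_bool_cases:
  "p -` B \<inter> S \<in> {{}, {x\<in>S. p x}, S - {x\<in>S. p x}, S}"
proof -
  have "B \<in> Pow (UNIV :: bool set)" by simp
  then have "B \<in> {{}, {True}, {False}, UNIV}" by (auto simp: UNIV_bool Pow_insert)
  then show ?thesis by auto
qed

text \<open>The probabilities of the events that single digits are 1 multiply by
  \<open>emeasure_binary_digits\<close>, and every preimage under a Boolean variable lies in the
  sigma-algebra of one such event. The injection \<open>e\<close> selects the digits in use.\<close>

lemma indep_vars_binary_digits:
  fixes e :: "nat \<Rightarrow> nat"
  assumes "inj e"
  shows "prob_space.indep_vars unit_interval (\<lambda>_. count_space UNIV) (\<lambda>k x. odd \<lfloor>2 ^ Suc (e k) * x\<rfloor>) UNIV"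
proof -
  interpret prob_space unit_interval by (rule prob_space_unit_interval)
  define A where "A k = {x\<in>space unit_interval. odd \<lfloor>2 ^ Suc (e k) * x\<rfloor>}" for k
  have rv: "random_variable (count_space UNIV) (\<lambda>x. odd \<lfloor>2 ^ Suc (e k) * x\<rfloor>)" for k by measurable
  have A: "A k \<in> events" for k unfolding A_def using rv by measurable
  have pr: "prob (\<Inter>j\<in>J. A j) = (1/2) ^ card J" if "finite J" "J \<noteq> {}" for J
  proof -
    have "(\<Inter>j\<in>J. A j) = {x\<in>space unit_interval. \<forall>j\<in>J. odd \<lfloor>2 ^ Suc (e j) * x\<rfloor>}"
      using that by (auto simp: A_def)
    then show ?thesis using emeasure_binary_digits[OF assms that(1)] by (simp add: measure_def)
  qed
  have "prob (A j) = 1/2" for j using pr[of "{j}"] by simp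
  then have "(\<Prod>j\<in>J. prob (A j)) = (1/2) ^ card J" for J by (simp only: prod_constant)
  then have "indep_events A UNIV"
    unfolding indep_events_def using A pr by (simp add: image_subset_iff)
  then have "indep_sets (\<lambda>k. sigma_sets (space unit_interval) {A k}) UNIV"
    unfolding indep_events_def_alt by (rule indep_sets_sigma) (auto simp: Int_stable_def)
  then have "indep_sets (\<lambda>k. {(\<lambda>x. odd \<lfloor>2 ^ Suc (e k) * x\<rfloor>) -` B \<inter> space unit_interval | B. B \<in> sets (count_space UNIV)}) UNIV"
  proof (rule indep_sets_mono_sets)
    fix k :: nat
    show "{(\<lambda>x. odd \<lfloor>2 ^ Suc (e k) * x\<rfloor>) -` B \<inter> space unit_interval | B. B \<in> sets (count_space UNIV)}
      \<subseteq> sigma_sets (space unit_interval) {A k}"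
    proof safe
      fix B :: "bool set"
      have "(\<lambda>x. odd \<lfloor>2 ^ Suc (e k) * x\<rfloor>) -` B \<inter> space unit_interval \<in>
        {{}, A k, space unit_interval - A k, space unit_interval}"
        unfolding A_def by (rule vimage_bool_cases)
      moreover have "{{}, A k, space unit_interval - A k, space unit_interval} \<subseteq> sigma_sets (space unit_interval) {A k}"
        by (auto intro: sigma_sets.intros sigma_sets_top)
      ultimately show "(\<lambda>x. odd \<lfloor>2 ^ Suc (e k) * x\<rfloor>) -` B \<inter> space unit_interval \<in> sigma_sets (space unit_interval) {A k}"
        by blast
    qed
  qed
  then show ?thesis unfolding indep_vars_def2 using rv by blast
qed

section \<open>From independent digits to independent variables with prescribed laws\<close>

lemma distr_binary_digit:
  fixes k l :: nat
  shows "distr unit_interval (count_space UNIV) (\<lambda>x. odd \<lfloor>2 ^ Suc k * x\<rfloor>) =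
    distr unit_interval (count_space UNIV) (\<lambda>x. odd \<lfloor>2 ^ Suc l * x\<rfloor>)"
proof (rule measure_eqI_countable[of _ UNIV])
  interpret prob_space unit_interval by (rule prob_space_unit_interval)
  have T: "emeasure (distr unit_interval (count_space UNIV) (\<lambda>x. odd \<lfloor>2 ^ Suc k * x\<rfloor>)) {True} = ennreal (1/2)" for k
  proof -
    have "(\<lambda>x. odd \<lfloor>2 ^ Suc k * x\<rfloor>) -` {True} \<inter> space unit_interval =
       {x\<in>space unit_interval. \<forall>j\<in>{k}. odd \<lfloor>2 ^ Suc (id j) * x\<rfloor>}" by auto
    then show ?thesis using emeasure_binary_digits[of id "{k}"] by (subst emeasure_distr) auto
  qed
  have F: "emeasure (distr unit_interval (count_space UNIV) (\<lambda>x. odd \<lfloor>2 ^ Suc k * x\<rfloor>)) {False} = 1 - ennreal (1/2)" for k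
  proof -
    interpret D: prob_space "distr unit_interval (count_space UNIV) (\<lambda>x. odd \<lfloor>2 ^ Suc k * x\<rfloor>)"
      by (rule prob_space_distr) measurable
    have "{False} = space (distr unit_interval (count_space UNIV) (\<lambda>x. odd \<lfloor>2 ^ Suc k * x\<rfloor>)) - {True}" by auto
    then show ?thesis using emeasure_compl[of "{True}" "distr unit_interval (count_space UNIV) (\<lambda>x. odd \<lfloor>2 ^ Suc k * x\<rfloor>)"] D.emeasure_space_1 T[of k] by simp
  qed
  fix b :: bool
  show "emeasure (distr unit_interval (count_space UNIV) (\<lambda>x. odd \<lfloor>2 ^ Suc k * x\<rfloor>)) {b} =
    emeasure (distr unit_interval (count_space UNIV) (\<lambda>x. odd \<lfloor>2 ^ Suc l * x\<rfloor>)) {b}"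
    using T F by (cases b) simp_all
qed auto

text \<open>Independent digits with equal laws have the same joint law for every injective
  selection, and for the identity selection the series returns \<open>x\<close>. Hence every such
  selection reassembles to a uniform variable.\<close>

lemma distr_binary_series:
  assumes "inj e"
  shows "distr unit_interval borel (\<lambda>x. \<Sum>k. of_bool (odd \<lfloor>2 ^ Suc (e k) * x\<rfloor>) / 2 ^ Suc k) =
    distr unit_interval borel (\<lambda>x. x)"
proof -
  interpret prob_space unit_interval by (rule prob_space_unit_interval)
  let ?P = "\<Pi>\<^sub>M k\<in>(UNIV::nat set). count_space (UNIV::bool set)"
  define h where "h \<omega> = (\<Sum>k. of_bool (\<omega> k) / 2 ^ Suc k :: real)" for \<omega>
  have h[measurable]: "h \<in> borel_measurable ?P" unfolding h_def by measurable
  have law: "distr unit_interval ?P (\<lambda>x k. odd \<lfloor>2 ^ Suc (e k) * x\<rfloor>) =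
    (\<Pi>\<^sub>M k\<in>UNIV. distr unit_interval (count_space UNIV) (\<lambda>x. odd \<lfloor>2 ^ Suc (e k) * x\<rfloor>))" if "inj e" for e
    using indep_vars_binary_digits[OF that] by (subst (asm) indep_vars_iff_distr_eq_PiM) (auto simp: restrict_def)
  have m: "(\<lambda>x k. odd \<lfloor>2 ^ Suc (e k) * x\<rfloor>) \<in> measurable unit_interval ?P" for e :: "nat \<Rightarrow> nat"
    by (rule measurable_PiM_single') auto
  have "distr unit_interval borel (\<lambda>x. \<Sum>k. of_bool (odd \<lfloor>2 ^ Suc (e k) * x\<rfloor>) / 2 ^ Suc k) =
    distr (distr unit_interval ?P (\<lambda>x k. odd \<lfloor>2 ^ Suc (e k) * x\<rfloor>)) borel h"
    using m by (subst distr_distr) (auto simp: comp_def h_def)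
  also have "distr unit_interval ?P (\<lambda>x k. odd \<lfloor>2 ^ Suc (e k) * x\<rfloor>) =
      distr unit_interval ?P (\<lambda>x k. odd \<lfloor>2 ^ Suc (id k) * x\<rfloor>)"
    unfolding law[OF assms] law[OF inj_on_id] by (intro PiM_cong refl distr_binary_digit)
  also have "distr (distr unit_interval ?P (\<lambda>x k. odd \<lfloor>2 ^ Suc (id k) * x\<rfloor>)) borel h =
    distr unit_interval borel (\<lambda>x. h (\<lambda>k. odd \<lfloor>2 ^ Suc (id k) * x\<rfloor>))"
    using m by (subst distr_distr) (auto simp: comp_def)
  also have "\<dots> = distr unit_interval borel (\<lambda>x. x)"
    by (rule distr_cong) (use binary_expansion_sums in \<open>auto simp: h_def sums_iff\<close>)
  finally show ?thesis .
qed

text \<open>The witness is the quantile function of \<open>\<mu>\<close> on the unit interval. The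
  uniform law is written as an image measure on the Borel sets, the form in which
  \<open>distr_binary_series\<close> delivers it.\<close>

lemma distr_quantile:
  assumes "real_distribution \<mu>"
  shows "\<exists>q. q \<in> borel_measurable borel \<and> distr (distr unit_interval borel (\<lambda>x. x)) borel q = \<mu>"
proof -
  interpret cdf_distribution \<mu> using assms by (simp add: cdf_distribution_def)
  define q where "q x = (if x \<in> {0<..<1} then Inf {y. x \<le> cdf \<mu> y} else 0)" for x
  have q: "q \<in> borel_measurable borel"
    unfolding q_def by (rule measurable_If_restrict_space_iff[THEN iffD2]) (use measurable_CI in \<open>auto simp: greaterThanLessThan_eq greaterThan_def lessThan_def Int_def\<close>)
  have "distr (distr unit_interval borel (\<lambda>x. x)) borel q = distr unit_interval borel q"
    using q by (subst distr_distr) (auto simp: comp_def)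
  \<comment> \<open>\<open>unit_interval\<close> carries all Lebesgue sets; on preimages of Borel
    sets under the Borel function \<open>q\<close> it agrees with the restriction of
    \<open>lborel\<close>.\<close>
  also have "\<dots> = distr (restrict_space lborel {0<..<1}) borel q"
  proof (rule measure_eqI)
    fix A assume "A \<in> sets (distr unit_interval borel q)"
    then have [measurable]: "A \<in> sets borel" by simp
    note [measurable] = q
    have qm: "q \<in> measurable (restrict_space lborel {0<..<1}) borel"
      by (rule measurable_restrict_space1) simp
    have S: "{x \<in> {0<..<1}. q x \<in> A} \<in> sets borel" by measurable
    have "emeasure (distr unit_interval borel q) A = emeasure unit_interval {x\<in>space unit_interval. q x \<in> A}"
      by (subst emeasure_distr) (auto intro!: arg_cong[where f="emeasure _"])
    also have "\<dots> = emeasure lborel {x\<in>{0<..<1}. q x \<in> A}"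
      by (rule emeasure_unit_interval[OF S])
    also have "\<dots> = emeasure (restrict_space lborel {0<..<1}) {x\<in>{0<..<1}. q x \<in> A}"
      by (subst emeasure_restrict_space) auto
    also have "\<dots> = emeasure (distr (restrict_space lborel {0<..<1}) borel q) A"
      using qm by (subst emeasure_distr) (auto intro!: arg_cong[where f="emeasure _"] simp: space_restrict_space)
    finally show "emeasure (distr unit_interval borel q) A = emeasure (distr (restrict_space lborel {0<..<1}) borel q) A" .
  qed simp
  also have "\<dots> = distr (restrict_space lborel {0<..<1}) borel I"
    by (rule distr_cong) (auto simp: q_def space_restrict_space)
  also have "\<dots> = \<mu>" by (rule distr_I_eq_M)
  finally show ?thesis using q by blast
qed

text \<open>\<open>prod_encode\<close> splits the digit positions into infinitely many disjoint
  infinite blocks \<open>K j\<close>. The blocks are independent, each one yields a uniform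
  variable, and quantile functions turn the uniform laws into the prescribed ones.\<close>

theorem ex_indep_vars_unit_interval:
  fixes \<mu> :: "nat \<Rightarrow> real measure"
  assumes "\<And>j. real_distribution (\<mu> j)"
  obtains X :: "nat \<Rightarrow> real \<Rightarrow> real" where "prob_space.indep_vars unit_interval (\<lambda>_. borel) X UNIV"
    "\<And>j. distr unit_interval borel (X j) = \<mu> j" "\<And>j. X j \<in> borel_measurable unit_interval"
proof -
  interpret prob_space unit_interval by (rule prob_space_unit_interval)
  have "\<forall>j. \<exists>q. q \<in> borel_measurable borel \<and> distr (distr unit_interval borel (\<lambda>x. x)) borel q = \<mu> j"
    using distr_quantile[OF assms] by (intro allI)
  from choice[OF this] obtain q where q[measurable]: "\<And>j. q j \<in> borel_measurable borel"
    and dq: "\<And>j. distr (distr unit_interval borel (\<lambda>x. x)) borel (q j) = \<mu> j" by blast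
  define K where "K j = range (\<lambda>k. prod_encode (j, k))" for j
  have "indep_vars (\<lambda>_. count_space UNIV) (\<lambda>k x. odd \<lfloor>2 ^ Suc (id k) * x\<rfloor>) UNIV"
    by (rule indep_vars_binary_digits) simp
  then have "indep_vars (\<lambda>j. PiM (K j) (\<lambda>_. count_space UNIV)) (\<lambda>j x. restrict (\<lambda>k. odd \<lfloor>2 ^ Suc (id k) * x\<rfloor>) (K j)) UNIV"
    by (rule indep_vars_restrict) (auto simp: K_def disjoint_family_on_def)
  moreover have "(\<lambda>\<omega>. q j (\<Sum>k. of_bool (\<omega> (prod_encode (j, k))) / 2 ^ Suc k)) \<in> measurable (PiM (K j) (\<lambda>_. count_space UNIV)) borel" for j
  proof -
    have [measurable]: "(\<lambda>\<omega>. \<omega> (prod_encode (j, k))) \<in> measurable (PiM (K j) (\<lambda>_. count_space (UNIV::bool set))) (count_space UNIV)" for k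
      by (rule measurable_component_singleton) (auto simp: K_def)
    show ?thesis by measurable
  qed
  ultimately have ind: "indep_vars (\<lambda>_. borel) (\<lambda>j x. q j (\<Sum>k. of_bool (restrict (\<lambda>k. odd \<lfloor>2 ^ Suc (id k) * x\<rfloor>) (K j) (prod_encode (j, k))) / 2 ^ Suc k)) UNIV"
    by (rule indep_vars_compose2)
  define X :: "nat \<Rightarrow> real \<Rightarrow> real" where "X j x = q j (\<Sum>k. of_bool (odd \<lfloor>2 ^ Suc (prod_encode (j, k)) * x\<rfloor>) / 2 ^ Suc k)" for j x
  have "indep_vars (\<lambda>_. borel) X UNIV"
    using ind by (simp add: K_def X_def[abs_def])
  moreover have "distr unit_interval borel (X j) = \<mu> j" for j
  proof -
    have "distr unit_interval borel (X j) =
      distr (distr unit_interval borel (\<lambda>x. \<Sum>k. of_bool (odd \<lfloor>2 ^ Suc (prod_encode (j, k)) * x\<rfloor>) / 2 ^ Suc k)) borel (q j)"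
      by (subst distr_distr) (auto simp: comp_def X_def[abs_def])
    also have "\<dots> = distr (distr unit_interval borel (\<lambda>x. x)) borel (q j)"
      by (subst distr_binary_series) (auto simp: inj_on_def)
    finally show ?thesis using dq by simp
  qed
  moreover have Xm: "X j \<in> borel_measurable unit_interval" for j unfolding X_def by measurable
  ultimately show ?thesis by (rule that)
qed

subsection \<open>Gaussian averages\<close>

text \<open>Characteristic functions of independent summands multiply. The law is written as an
  image of the standard normal rather than by a normal density, so that deviation 0 is
  covered.\<close>

lemma (in prob_space) distr_sum_std_normal:
  fixes X :: "'i \<Rightarrow> 'a \<Rightarrow> real"
  assumes ind: "indep_vars (\<lambda>_. borel) X I" and "finite I"
    and law: "\<And>i. i \<in> I \<Longrightarrow> distr M borel (X i) = std_normal_distribution"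
  shows "distr M borel (\<lambda>\<omega>. \<Sum>i\<in>I. b i * X i \<omega>) =
    distr std_normal_distribution borel (\<lambda>x. sqrt (\<Sum>i\<in>I. (b i)\<^sup>2) * x)"
proof (rule Levy_uniqueness)
  interpret n: real_distribution std_normal_distribution by (rule real_dist_normal_dist)
  have X: "random_variable borel (X i)" if "i \<in> I" for i
    using ind that unfolding indep_vars_def by blast
  have sc: "char (distr M' borel (\<lambda>\<omega>. c * Y \<omega>)) t = char (distr M' borel Y) (t * c)"
    if [measurable]: "Y \<in> borel_measurable M'" for M' :: "'b measure" and Y :: "'b \<Rightarrow> real" and c t
    by (simp add: char_def integral_distr mult_ac)
  have ind': "indep_vars (\<lambda>_. borel) (\<lambda>i \<omega>. b i * X i \<omega>) I"
    using ind by (rule indep_vars_compose2[where Y="\<lambda>i x. b i * x"]) auto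
  show "real_distribution (distr M borel (\<lambda>\<omega>. \<Sum>i\<in>I. b i * X i \<omega>))"
    using X by (intro real_distribution_distr borel_measurable_sum borel_measurable_times) auto
  show "real_distribution (distr std_normal_distribution borel (\<lambda>x. sqrt (\<Sum>i\<in>I. (b i)\<^sup>2) * x))"
    by (intro n.real_distribution_distr) auto
  show "char (distr M borel (\<lambda>\<omega>. \<Sum>i\<in>I. b i * X i \<omega>)) =
    char (distr std_normal_distribution borel (\<lambda>x. sqrt (\<Sum>i\<in>I. (b i)\<^sup>2) * x))"
  proof
    fix t :: real
    have "char (distr M borel (\<lambda>\<omega>. \<Sum>i\<in>I. b i * X i \<omega>)) t = (\<Prod>i\<in>I. char (distr M borel (\<lambda>\<omega>. b i * X i \<omega>)) t)"
      using ind' by (rule char_distr_sum)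
    also have "\<dots> = (\<Prod>i\<in>I. complex_of_real (exp (- (t\<^sup>2 * (b i)\<^sup>2) / 2)))"
      using X law by (intro prod.cong) (auto simp: sc char_std_normal_distribution power_mult_distrib)
    also have "\<dots> = complex_of_real (exp (\<Sum>i\<in>I. - (t\<^sup>2 * (b i)\<^sup>2) / 2))"
      using \<open>finite I\<close> by (simp add: exp_sum)
    also have "(\<Sum>i\<in>I. - (t\<^sup>2 * (b i)\<^sup>2) / 2) = - (t\<^sup>2 * (\<Sum>i\<in>I. (b i)\<^sup>2)) / 2"
      by (simp add: sum_distrib_left sum_negf sum_divide_distrib)
    also have "complex_of_real (exp \<dots>) = char (distr std_normal_distribution borel (\<lambda>x. sqrt (\<Sum>i\<in>I. (b i)\<^sup>2) * x)) t"
    proof -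
      have "char (distr std_normal_distribution borel (\<lambda>x. sqrt (\<Sum>i\<in>I. (b i)\<^sup>2) * x)) t =
         char (distr std_normal_distribution borel (\<lambda>x. x)) (t * sqrt (\<Sum>i\<in>I. (b i)\<^sup>2))"
        by (rule sc) simp
      also have "distr std_normal_distribution borel (\<lambda>x. x) = std_normal_distribution"
        by (rule distr_id2) simp
      also have "char std_normal_distribution (t * sqrt (\<Sum>i\<in>I. (b i)\<^sup>2)) = complex_of_real (exp (- (t\<^sup>2 * (\<Sum>i\<in>I. (b i)\<^sup>2)) / 2))"
        by (simp add: char_std_normal_distribution power_mult_distrib sum_nonneg)
      finally show ?thesis by simp
    qed
    finally show "char (distr M borel (\<lambda>\<omega>. \<Sum>i\<in>I. b i * X i \<omega>)) t =
      char (distr std_normal_distribution borel (\<lambda>x. sqrt (\<Sum>i\<in>I. (b i)\<^sup>2) * x)) t" .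
  qed
qed

lemma (in prob_space) nn_integral_abs_sum_std_normal:
  fixes X :: "'i \<Rightarrow> 'a \<Rightarrow> real"
  assumes "indep_vars (\<lambda>_. borel) X I" "finite I"
    and "\<And>i. i \<in> I \<Longrightarrow> distr M borel (X i) = std_normal_distribution"
  shows "(\<integral>\<^sup>+\<omega>. ennreal \<bar>t + (\<Sum>i\<in>I. b i * X i \<omega>)\<bar> \<partial>M) = ennreal (gauss_abs t (sqrt (\<Sum>i\<in>I. (b i)\<^sup>2)))"
proof -
  have X: "random_variable borel (X i)" if "i \<in> I" for i
    using assms(1) that unfolding indep_vars_def by blast
  have S: "random_variable borel (\<lambda>\<omega>. \<Sum>i\<in>I. b i * X i \<omega>)"
    using X by (intro borel_measurable_sum borel_measurable_times) auto
  have "(\<integral>\<^sup>+\<omega>. ennreal \<bar>t + (\<Sum>i\<in>I. b i * X i \<omega>)\<bar> \<partial>M) =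
      (\<integral>\<^sup>+s. ennreal \<bar>t + s\<bar> \<partial>distr M borel (\<lambda>\<omega>. \<Sum>i\<in>I. b i * X i \<omega>))"
    using S by (subst nn_integral_distr) auto
  also have "\<dots> = (\<integral>\<^sup>+s. ennreal \<bar>t + s\<bar> \<partial>distr std_normal_distribution borel (\<lambda>x. sqrt (\<Sum>i\<in>I. (b i)\<^sup>2) * x))"
    by (rule arg_cong[OF distr_sum_std_normal[OF assms], where f="\<lambda>N. nn_integral N (\<lambda>s. ennreal \<bar>t + s\<bar>)"])
  also have "\<dots> = ennreal (gauss_abs t (sqrt (\<Sum>i\<in>I. (b i)\<^sup>2)))"
    by (subst nn_integral_distr) (auto simp: nn_integral_gauss_abs)
  finally show ?thesis .
qed

lemma (in prob_space) second_moment_sum_indep: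
  fixes Y :: "'i \<Rightarrow> 'a \<Rightarrow> real" and s :: real
  assumes "finite I" "indep_vars (\<lambda>_. borel) Y I"
    and "\<And>i. i \<in> I \<Longrightarrow> integrable M (\<lambda>\<omega>. (Y i \<omega>)\<^sup>2)"
    and "\<And>i. i \<in> I \<Longrightarrow> expectation (Y i) = 0" "\<And>i. i \<in> I \<Longrightarrow> expectation (\<lambda>\<omega>. (Y i \<omega>)\<^sup>2) = s"
  shows "integrable M (\<lambda>\<omega>. (\<Sum>i\<in>I. Y i \<omega>)\<^sup>2) \<and> expectation (\<lambda>\<omega>. (\<Sum>i\<in>I. Y i \<omega>)\<^sup>2) = card I * s"
  using assms
proof (induction I rule: finite_induct)
  case (insert i I)
  have ind: "indep_vars (\<lambda>_. borel) Y I" using insert.prems(1) by (rule indep_vars_subset) auto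
  have Y[measurable]: "random_variable borel (Y j)" if "j \<in> insert i I" for j
    using insert.prems(1) that unfolding indep_vars_def by blast
  have Ym: "random_variable borel (Y i)" using Y by blast
  have Sm: "random_variable borel (\<lambda>\<omega>. \<Sum>i\<in>I. Y i \<omega>)" using Y by (intro borel_measurable_sum) auto
  have IH: "integrable M (\<lambda>\<omega>. (\<Sum>i\<in>I. Y i \<omega>)\<^sup>2)" "expectation (\<lambda>\<omega>. (\<Sum>i\<in>I. Y i \<omega>)\<^sup>2) = card I * s"
    using insert.IH[OF ind] insert.prems by auto
  have i1: "integrable M (Y i)" "integrable M (\<lambda>\<omega>. (Y i \<omega>)\<^sup>2)"
    using square_integrable_imp_integrable[OF Ym] insert.prems(2)[of i] by auto
  have i2: "integrable M (\<lambda>\<omega>. \<Sum>i\<in>I. Y i \<omega>)"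
    using square_integrable_imp_integrable[OF Sm] IH by auto
  have iv: "indep_var borel (Y i) borel (\<lambda>\<omega>. \<Sum>i\<in>I. Y i \<omega>)"
    by (rule indep_vars_sum) (use insert in auto)
  have cross: "integrable M (\<lambda>\<omega>. Y i \<omega> * (\<Sum>i\<in>I. Y i \<omega>))" "expectation (\<lambda>\<omega>. Y i \<omega> * (\<Sum>i\<in>I. Y i \<omega>)) = 0"
    using indep_var_integrable[OF iv i1(1) i2] indep_var_lebesgue_integral[OF iv i1(1) i2] insert.prems(3)[of i] by auto
  have eq: "(\<Sum>i\<in>insert i I. Y i \<omega>)\<^sup>2 = (Y i \<omega>)\<^sup>2 + 2 * (Y i \<omega> * (\<Sum>i\<in>I. Y i \<omega>)) + (\<Sum>i\<in>I. Y i \<omega>)\<^sup>2" for \<omega>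
    using insert.hyps by (simp add: power2_sum mult.assoc)
  show ?case
    unfolding eq using i1 IH cross insert.hyps insert.prems(4)[of i]
    by (simp add: algebra_simps)
qed simp

text \<open>A law of large numbers in mean for the squares: \<open>(X i)\<^sup>2 - 1\<close> has
  mean 0 and second moment 3 - 2 + 1 = 2, so the average of \<open>n\<close> of them has mean
  modulus at most \<open>sqrt (2 / n)\<close>.\<close>

lemma (in prob_space) expectation_norm_std_normal:
  fixes X :: "nat \<Rightarrow> 'a \<Rightarrow> real"
  assumes ind: "indep_vars (\<lambda>_. borel) X UNIV"
    and law: "\<And>i. distr M borel (X i) = std_normal_distribution"
  shows "integrable M (\<lambda>\<omega>. sqrt (\<Sum>i<n. (X i \<omega> / sqrt n)\<^sup>2))"
    and "n > 0 \<Longrightarrow> expectation (\<lambda>\<omega>. \<bar>sqrt (\<Sum>i<n. (X i \<omega> / sqrt n)\<^sup>2) - 1\<bar>) \<le> sqrt (2 / n)"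
proof -
  have X[measurable]: "random_variable borel (X i)" for i
    using ind unfolding indep_vars_def by blast
  define Y where "Y i \<omega> = (X i \<omega>)\<^sup>2 - 1" for i \<omega>
  have mom: "integrable M (\<lambda>\<omega>. (X i \<omega>) ^ (2*k))" "expectation (\<lambda>\<omega>. (X i \<omega>) ^ (2*k)) = fact (2 * k) / (2^k * fact k)" for i k
  proof -
    have "integrable (distr M borel (X i)) (\<lambda>x. x ^ (2*k))"
      unfolding law by (rule std_normal_distribution_even_moments)
    then show "integrable M (\<lambda>\<omega>. (X i \<omega>) ^ (2*k))" by (subst (asm) integrable_distr_eq) auto
    have "expectation (\<lambda>\<omega>. (X i \<omega>) ^ (2*k)) = (LINT x|distr M borel (X i). x ^ (2*k))"
      by (subst integral_distr) auto
    then show "expectation (\<lambda>\<omega>. (X i \<omega>) ^ (2*k)) = fact (2 * k) / (2^k * fact k)"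
      unfolding law std_normal_distribution_even_moments(1) .
  qed
  have m2: "integrable M (\<lambda>\<omega>. (X i \<omega>)\<^sup>2)" "expectation (\<lambda>\<omega>. (X i \<omega>)\<^sup>2) = 1" for i
    using mom[of i 1] by (auto simp: fact_numeral)
  have m4: "integrable M (\<lambda>\<omega>. (X i \<omega>) ^ 4)" "expectation (\<lambda>\<omega>. (X i \<omega>) ^ 4) = 3" for i
    using mom[of i 2] by (auto simp: fact_numeral)
  have Y2: "(Y i \<omega>)\<^sup>2 = (X i \<omega>) ^ 4 - 2 * (X i \<omega>)\<^sup>2 + 1" for i \<omega>
    by (simp add: Y_def power2_eq_square power4_eq_xxxx algebra_simps)
  have S: "integrable M (\<lambda>\<omega>. (\<Sum>i<n. Y i \<omega>)\<^sup>2) \<and> expectation (\<lambda>\<omega>. (\<Sum>i<n. Y i \<omega>)\<^sup>2) = real (card {..<n}) * 2"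
  proof (rule second_moment_sum_indep)
    show "indep_vars (\<lambda>_. borel) Y {..<n}"
      unfolding Y_def using indep_vars_subset[OF ind] by (rule indep_vars_compose2[where Y="\<lambda>i x. x\<^sup>2 - 1"]) auto
    show "integrable M (\<lambda>\<omega>. (Y i \<omega>)\<^sup>2)" for i unfolding Y2 using m2 m4 by auto
    show "expectation (Y i) = 0" for i unfolding Y_def using m2 prob_space by simp
    show "expectation (\<lambda>\<omega>. (Y i \<omega>)\<^sup>2) = 2" for i unfolding Y2 using m2 m4 prob_space by simp
  qed simp
  have Sm: "random_variable borel (\<lambda>\<omega>. \<Sum>i<n. Y i \<omega>)" unfolding Y_def by measurable
  have iS: "integrable M (\<lambda>\<omega>. \<Sum>i<n. Y i \<omega>)" using square_integrable_imp_integrable[OF Sm] S by auto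
  \<comment> \<open>The square root is removed by |r - 1| \<le> |r - 1| (r + 1) = |r^2 - 1| for r
    \<ge> 0.\<close>
  have bound: "\<bar>sqrt (\<Sum>i<n. (X i \<omega> / sqrt n)\<^sup>2) - 1\<bar> \<le> \<bar>\<Sum>i<n. Y i \<omega>\<bar> / n" if "n > 0" for \<omega>
  proof -
    define r where "r = sqrt (\<Sum>i<n. (X i \<omega> / sqrt n)\<^sup>2)"
    have r: "r \<ge> 0" by (simp add: r_def sum_nonneg)
    have "r\<^sup>2 = (\<Sum>i<n. (X i \<omega>)\<^sup>2) / n"
      by (simp add: r_def sum_nonneg power_divide sum_divide_distrib)
    then have "r\<^sup>2 - 1 = (\<Sum>i<n. Y i \<omega>) / n"
      using that by (simp add: Y_def sum_subtractf diff_divide_distrib)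
    then have "\<bar>\<Sum>i<n. Y i \<omega>\<bar> / n = \<bar>(r - 1) * (r + 1)\<bar>"
      using that by (simp add: power2_eq_square algebra_simps)
    also have "\<dots> \<ge> \<bar>r - 1\<bar> * 1" unfolding abs_mult using r by (intro mult_left_mono) auto
    finally show ?thesis by (simp add: r_def)
  qed
  have Rm: "random_variable borel (\<lambda>\<omega>. sqrt (\<Sum>i<n. (X i \<omega> / sqrt n)\<^sup>2))" by measurable
  show int: "integrable M (\<lambda>\<omega>. sqrt (\<Sum>i<n. (X i \<omega> / sqrt n)\<^sup>2))"
  proof (cases "n = 0")
    case False
    show ?thesis
    proof (rule Bochner_Integration.integrable_bound)
      show "integrable M (\<lambda>\<omega>. \<bar>\<Sum>i<n. Y i \<omega>\<bar> / n + 1)" using iS by auto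
      show "AE \<omega> in M. norm (sqrt (\<Sum>i<n. (X i \<omega> / sqrt n)\<^sup>2)) \<le> norm (\<bar>\<Sum>i<n. Y i \<omega>\<bar> / n + 1)"
      proof (rule AE_I2)
        fix \<omega>
        show "norm (sqrt (\<Sum>i<n. (X i \<omega> / sqrt n)\<^sup>2)) \<le> norm (\<bar>\<Sum>i<n. Y i \<omega>\<bar> / n + 1)"
          using bound[of \<omega>] False by (simp add: sum_nonneg)
      qed
    qed (rule Rm)
  qed simp
  show "expectation (\<lambda>\<omega>. \<bar>sqrt (\<Sum>i<n. (X i \<omega> / sqrt n)\<^sup>2) - 1\<bar>) \<le> sqrt (2 / n)" if n: "n > 0"
  proof -
  have "expectation (\<lambda>\<omega>. \<bar>sqrt (\<Sum>i<n. (X i \<omega> / sqrt n)\<^sup>2) - 1\<bar>) \<le> expectation (\<lambda>\<omega>. \<bar>\<Sum>i<n. Y i \<omega>\<bar> / n)"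
    using int iS bound[OF n] by (intro integral_mono) auto
  also have "\<dots> = expectation (\<lambda>\<omega>. \<bar>\<Sum>i<n. Y i \<omega>\<bar>) / n" by simp
  also have "\<dots> \<le> sqrt (2 * n) / n"
  proof (rule divide_right_mono)
    have "0 \<le> variance (\<lambda>\<omega>. \<bar>\<Sum>i<n. Y i \<omega>\<bar>)" by simp
    also have "\<dots> = expectation (\<lambda>\<omega>. \<bar>\<Sum>i<n. Y i \<omega>\<bar>\<^sup>2) - (expectation (\<lambda>\<omega>. \<bar>\<Sum>i<n. Y i \<omega>\<bar>))\<^sup>2"
      using iS S by (intro variance_eq) auto
    finally have "(expectation (\<lambda>\<omega>. \<bar>\<Sum>i<n. Y i \<omega>\<bar>))\<^sup>2 \<le> 2 * n" using S by simp
    then show "expectation (\<lambda>\<omega>. \<bar>\<Sum>i<n. Y i \<omega>\<bar>) \<le> sqrt (2 * n)"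
      by (rule real_le_rsqrt)
  qed simp
  also have "\<dots> = sqrt (2 / n)" using n by (simp add: real_sqrt_mult real_sqrt_divide real_div_sqrt field_simps)
  finally show ?thesis .
  qed
qed

section \<open>Mixtures of Gaussian expectations and the forward direction\<close>

lemma (in finite_measure) integral_comp_simple_function:
  fixes h :: "'b \<Rightarrow> real"
  assumes s: "simple_function M s"
  shows "integrable M (\<lambda>x. h (s x))"
    and "(LINT x|M. h (s x)) = (\<Sum>y\<in>s ` space M. measure M (s -` {y} \<inter> space M) * h y)"
proof -
  have fin: "finite (s ` space M)" using s by (rule simple_functionD)
  have meas: "s -` {y} \<inter> space M \<in> sets M" for y using s by (rule simple_functionD)
  have eq: "h (s x) = (\<Sum>y\<in>s ` space M. h y * indicator (s -` {y} \<inter> space M) x)" if "x \<in> space M" for x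
  proof -
    have "(\<Sum>y\<in>s ` space M. h y * indicator (s -` {y} \<inter> space M) x) = (\<Sum>y\<in>s ` space M. if y = s x then h y else 0)"
      using that by (intro sum.cong) (auto simp: indicator_def)
    then show ?thesis using fin that by simp
  qed
  have int: "integrable M (\<lambda>x. \<Sum>y\<in>s ` space M. h y * indicator (s -` {y} \<inter> space M) x)"
    using meas by (intro Bochner_Integration.integrable_sum integrable_mult_right) (auto simp: emeasure_eq_measure)
  show "integrable M (\<lambda>x. h (s x))"
    using int by (subst Bochner_Integration.integrable_cong[OF refl eq]) auto
  have "(LINT x|M. h (s x)) = (LINT x|M. (\<Sum>y\<in>s ` space M. h y * indicator (s -` {y} \<inter> space M) x))"
    by (rule Bochner_Integration.integral_cong[OF refl eq])
  also have "\<dots> = (\<Sum>y\<in>s ` space M. (LINT x|M. h y * indicator (s -` {y} \<inter> space M) x))"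
    using meas by (intro Bochner_Integration.integral_sum integrable_mult_right) (auto simp: emeasure_eq_measure)
  also have "\<dots> = (\<Sum>y\<in>s ` space M. measure M (s -` {y} \<inter> space M) * h y)"
    using meas by (intro sum.cong) (auto simp: mult.commute Int_commute intro!: arg_cong[where f="(*) _"])
  finally show "(LINT x|M. h (s x)) = (\<Sum>y\<in>s ` space M. measure M (s -` {y} \<inter> space M) * h y)" .
qed

text \<open>The pair \<open>(c, v)\<close> is approximated by simple functions, for which the
  integral is a finite sum. Dominated convergence gives pointwise convergence in \<open>t\<close>,
  which is all that \<open>cm_curvature_tendsto\<close> asks for.\<close>

lemma (in finite_measure) cm_curvature_gauss_abs_mixture:
  assumes c: "integrable M c" and v: "integrable M v"
  shows "cm_curvature (\<lambda>t. LINT x|M. gauss_abs (c x * t) (v x))"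
proof -
  have [measurable]: "c \<in> borel_measurable M" "v \<in> borel_measurable M" using c v by auto
  define f where "f x = (c x, v x)" for x
  have "f \<in> borel_measurable M" unfolding f_def by measurable
  note [measurable] = this
  obtain s where s0: "\<forall>i. simple_function M (s i)" "\<forall>x\<in>space M. (\<lambda>i. s i x) \<longlonglongrightarrow> f x"
    "\<forall>i. \<forall>x\<in>space M. dist (s i x) 0 \<le> 2 * dist (f x) 0"
    using borel_measurable_implies_sequence_metric[OF \<open>f \<in> borel_measurable M\<close>, of 0] by (elim exE conjE)
  note s = s0(1)[rule_format] s0(2)[rule_format] s0(3)[rule_format]
  have cont: "continuous_on UNIV (\<lambda>p. gauss_abs (fst p * t) (snd p))" for t
  proof -
    have "((\<lambda>p. gauss_abs (fst p * t) (snd p)) \<longlongrightarrow> gauss_abs (fst q * t) (snd q)) (at q)" for q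
    proof (rule LIM_zero_cancel, rule Lim_null_comparison)
      show "\<forall>\<^sub>F p in at q. norm (gauss_abs (fst p * t) (snd p) - gauss_abs (fst q * t) (snd q)) \<le>
        \<bar>fst p * t - fst q * t\<bar> + \<bar>snd p - snd q\<bar>"
        using gauss_abs_lipschitz by simp
      show "((\<lambda>p. \<bar>fst p * t - fst q * t\<bar> + \<bar>snd p - snd q\<bar>) \<longlongrightarrow> 0) (at q)"
        by (auto intro!: tendsto_eq_intros)
    qed
    then show ?thesis by (simp add: continuous_on_def)
  qed
  have lim: "(\<lambda>i. LINT x|M. gauss_abs (fst (s i x) * t) (snd (s i x))) \<longlonglongrightarrow> (LINT x|M. gauss_abs (c x * t) (v x))" for t
  proof (rule integral_dominated_convergence)
    have [measurable]: "(\<lambda>p. gauss_abs (fst p * t) (snd p)) \<in> borel_measurable borel"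
      using cont by (rule borel_measurable_continuous_onI)
    have "(\<lambda>x. gauss_abs (fst (f x) * t) (snd (f x))) \<in> borel_measurable M" by measurable
    then show "(\<lambda>x. gauss_abs (c x * t) (v x)) \<in> borel_measurable M" by (simp add: f_def)
    show "(\<lambda>x. gauss_abs (fst (s i x) * t) (snd (s i x))) \<in> borel_measurable M" for i
      using borel_measurable_simple_function[OF s(1)[of i]] by measurable
    \<comment> \<open>The factor 2 is that of the approximating sequence;
      \<open>\<bar>t\<bar> + 1\<close> comes from the Lipschitz estimate of \<open>gauss_abs\<close>
      against its value 0 at the origin.\<close>
    show "integrable M (\<lambda>x. (\<bar>t\<bar> + 1) * (2 * (\<bar>c x\<bar> + \<bar>v x\<bar>)))" using c v by auto
    show "AE x in M. (\<lambda>i. gauss_abs (fst (s i x) * t) (snd (s i x))) \<longlonglongrightarrow> gauss_abs (c x * t) (v x)"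
    proof (rule AE_I2)
      fix x assume "x \<in> space M"
      from s(2)[OF this] have "(\<lambda>i. gauss_abs (fst (s i x) * t) (snd (s i x))) \<longlonglongrightarrow> gauss_abs (fst (f x) * t) (snd (f x))"
        using continuous_on_tendsto_compose[OF cont] by fastforce
      then show "(\<lambda>i. gauss_abs (fst (s i x) * t) (snd (s i x))) \<longlonglongrightarrow> gauss_abs (c x * t) (v x)" by (simp add: f_def)
    qed
    show "AE x in M. norm (gauss_abs (fst (s i x) * t) (snd (s i x))) \<le> (\<bar>t\<bar> + 1) * (2 * (\<bar>c x\<bar> + \<bar>v x\<bar>))" for i
    proof (rule AE_I2)
      fix x assume x: "x \<in> space M"
      have z: "gauss_abs 0 0 = 0" by (simp add: gauss_abs_def)
      have "norm (gauss_abs (fst (s i x) * t) (snd (s i x))) \<le> \<bar>t\<bar> * \<bar>fst (s i x)\<bar> + \<bar>snd (s i x)\<bar>"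
        using gauss_abs_lipschitz[of "fst (s i x) * t" "snd (s i x)" 0 0] by (simp add: z abs_mult mult.commute)
      also have "\<dots> \<le> \<bar>t\<bar> * norm (s i x) + norm (s i x)"
        using norm_fst_le[of "fst (s i x)" "snd (s i x)"] norm_snd_le[of "snd (s i x)" "fst (s i x)"]
        by (intro add_mono mult_left_mono) auto
      also have "\<dots> = (\<bar>t\<bar> + 1) * norm (s i x)" by (simp add: algebra_simps)
      also have "\<dots> \<le> (\<bar>t\<bar> + 1) * (2 * (\<bar>c x\<bar> + \<bar>v x\<bar>))"
        using s(3)[OF x, of i] norm_Pair_le[of "c x" "v x"] by (intro mult_left_mono) (auto simp: f_def)
      finally show "norm (gauss_abs (fst (s i x) * t) (snd (s i x))) \<le> (\<bar>t\<bar> + 1) * (2 * (\<bar>c x\<bar> + \<bar>v x\<bar>))" .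
    qed
  qed
  show ?thesis
  proof (rule cm_curvature_tendsto[where f="\<lambda>i t. LINT x|M. gauss_abs (fst (s i x) * t) (snd (s i x))", OF _ lim])
    fix i
    \<comment> \<open>The second components of the simple functions may be negative; symmetry in the
      deviation replaces them by their moduli, as \<open>cm_curvature_gauss_abs\<close>
      expects.\<close>
    have "gauss_abs a b = gauss_abs a \<bar>b\<bar>" for a b by (cases "b \<ge> 0") (auto simp: gauss_abs_minus)
    then have eq: "(\<lambda>t. LINT x|M. gauss_abs (fst (s i x) * t) (snd (s i x))) =
      (\<lambda>t. \<Sum>y\<in>s i ` space M. measure M (s i -` {y} \<inter> space M) * gauss_abs (fst y * t) \<bar>snd y\<bar>)"
      using integral_comp_simple_function(2)[OF s(1)[of i], of "\<lambda>p. gauss_abs (fst p * _) \<bar>snd p\<bar>"] by simp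
    show "cm_curvature (\<lambda>t. LINT x|M. gauss_abs (fst (s i x) * t) (snd (s i x)))"
      unfolding eq
      by (intro cm_curvature_sum cm_curvature_gauss_abs) (auto intro: simple_functionD s)
  qed
qed

lemma cm_curvature_of_L1_isometry:
  fixes nrm :: "real \<Rightarrow> real \<Rightarrow> real" and F :: "nat \<Rightarrow> real \<Rightarrow> real"
  assumes F0: "integrable unit_interval F0" and F: "\<And>i. integrable unit_interval (F i)"
    and iso: "\<And>n a t. (LINT x|unit_interval. \<bar>t * F0 x + (\<Sum>i<n. a i * F i x)\<bar>) = nrm (sqrt (\<Sum>i<n. (a i)\<^sup>2)) t"
    and lip: "\<And>r r' t. \<bar>nrm r t - nrm r' t\<bar> \<le> \<bar>r - r'\<bar>"
  shows "cm_curvature (nrm 1)"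
proof -
  interpret prob_space unit_interval by (rule prob_space_unit_interval)
  interpret PP: pair_sigma_finite unit_interval unit_interval ..
  have rd: "real_distribution std_normal_distribution" by (rule real_dist_normal_dist)
  obtain G :: "nat \<Rightarrow> real \<Rightarrow> real" where ind: "indep_vars (\<lambda>_. borel) G UNIV"
    and law: "\<And>j. distr unit_interval borel (G j) = std_normal_distribution"
    and G: "\<And>j. G j \<in> borel_measurable unit_interval"
    by (rule ex_indep_vars_unit_interval[of "\<lambda>_. std_normal_distribution", OF rd], rule that)
  note [measurable] = G
  have Fm: "F0 \<in> borel_measurable unit_interval" "\<And>i. F i \<in> borel_measurable unit_interval"
    using F0 F by auto
  note [measurable] = Fm
  \<comment> \<open>\<open>R n\<close> is the length of the Gaussian coefficient vector, scaled by
    \<open>1 / sqrt n\<close>. \<open>V n x\<close> is the deviation of the Gaussian combination of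
    the \<open>F i x\<close> for fixed \<open>x\<close>.\<close>
  define R where "R n \<omega> = sqrt (\<Sum>i<n. (G i \<omega> / sqrt (real n))\<^sup>2)" for n \<omega>
  define V where "V n x = sqrt (\<Sum>i<n. (F i x / sqrt (real n))\<^sup>2)" for n x
  have Rm: "R n \<in> borel_measurable unit_interval" for n unfolding R_def by measurable
  have Vm: "V n \<in> borel_measurable unit_interval" for n unfolding V_def by measurable
  note [measurable] = Rm Vm
  have Vint: "integrable unit_interval (V n)" for n
  proof (rule Bochner_Integration.integrable_bound)
    show "integrable unit_interval (\<lambda>x. \<Sum>i<n. \<bar>F i x / sqrt (real n)\<bar>)" using F by auto
    show "AE x in unit_interval. norm (V n x) \<le> norm (\<Sum>i<n. \<bar>F i x / sqrt (real n)\<bar>)"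
    proof (rule AE_I2)
      fix x
      have "V n x \<le> (\<Sum>i<n. \<bar>F i x / sqrt (real n)\<bar>)"
        unfolding V_def L2_set_def[symmetric] by (rule L2_set_le_sum_abs)
      moreover have "0 \<le> V n x" unfolding V_def by (intro real_sqrt_ge_zero sum_nonneg zero_le_power2)
      ultimately show "norm (V n x) \<le> norm (\<Sum>i<n. \<bar>F i x / sqrt (real n)\<bar>)" by simp
    qed
  qed (rule Vm)
  have nrm_cont: "continuous_on UNIV (\<lambda>r. nrm r t)" for t
  proof -
    have "((\<lambda>r. nrm r t) \<longlongrightarrow> nrm q t) (at q)" for q
    proof (rule LIM_zero_cancel, rule Lim_null_comparison)
      show "\<forall>\<^sub>F r in at q. norm (nrm r t - nrm q t) \<le> \<bar>r - q\<bar>" using lip by simp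
      show "((\<lambda>r. \<bar>r - q\<bar>) \<longlongrightarrow> 0) (at q)" by (auto intro!: tendsto_eq_intros)
    qed
    then show ?thesis by (simp add: continuous_on_def)
  qed
  have nrm_m: "(\<lambda>r. nrm r t) \<in> borel_measurable borel" for t
    using nrm_cont by (rule borel_measurable_continuous_onI)
  have nrmR_m: "(\<lambda>\<omega>. nrm (R n \<omega>) t) \<in> borel_measurable unit_interval" for n t
    using measurable_compose[OF Rm nrm_m] .
  have nrmR: "nrm (R n \<omega>) t = (LINT x|unit_interval. \<bar>t * F0 x + (\<Sum>i<n. (G i \<omega> / sqrt (real n)) * F i x)\<bar>)" for n t \<omega>
    unfolding iso R_def ..
  \<comment> \<open>Fubini on two copies of the interval: integrating over \<open>x\<close> first
    gives the norm through \<open>iso\<close>, integrating over the Gaussian sample point first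
    gives \<open>gauss_abs\<close>.\<close>
  have eq: "(LINT x|unit_interval. gauss_abs (F0 x * t) (V n x)) = (LINT \<omega>|unit_interval. nrm (R n \<omega>) t)" for n t
  proof -
    have nn: "ennreal (nrm (R n \<omega>) t) = (\<integral>\<^sup>+x. ennreal \<bar>t * F0 x + (\<Sum>i<n. (G i \<omega> / sqrt (real n)) * F i x)\<bar> \<partial>unit_interval)" for \<omega>
      unfolding nrmR using F0 F by (intro nn_integral_eq_integral[symmetric]) auto
    have "(\<integral>\<^sup>+\<omega>. ennreal (nrm (R n \<omega>) t) \<partial>unit_interval) =
      (\<integral>\<^sup>+x. \<integral>\<^sup>+\<omega>. ennreal \<bar>t * F0 x + (\<Sum>i<n. (G i \<omega> / sqrt (real n)) * F i x)\<bar> \<partial>unit_interval \<partial>unit_interval)"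
      unfolding nn by (rule PP.Fubini') measurable
    also have "\<dots> = (\<integral>\<^sup>+x. ennreal (gauss_abs (F0 x * t) (V n x)) \<partial>unit_interval)"
    proof (rule nn_integral_cong)
      fix x
      have "(\<integral>\<^sup>+\<omega>. ennreal \<bar>t * F0 x + (\<Sum>i<n. (F i x / sqrt (real n)) * G i \<omega>)\<bar> \<partial>unit_interval) =
        ennreal (gauss_abs (t * F0 x) (V n x))"
        unfolding V_def by (rule nn_integral_abs_sum_std_normal) (use indep_vars_subset[OF ind] law in auto)
      then show "(\<integral>\<^sup>+\<omega>. ennreal \<bar>t * F0 x + (\<Sum>i<n. (G i \<omega> / sqrt (real n)) * F i x)\<bar> \<partial>unit_interval) =
        ennreal (gauss_abs (F0 x * t) (V n x))"
        by (simp add: mult.commute)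
    qed
    finally have nneq: "(\<integral>\<^sup>+\<omega>. ennreal (nrm (R n \<omega>) t) \<partial>unit_interval) = (\<integral>\<^sup>+x. ennreal (gauss_abs (F0 x * t) (V n x)) \<partial>unit_interval)" .
    have pos: "nrm (R n \<omega>) t \<ge> 0" for \<omega> unfolding nrmR by (rule Bochner_Integration.integral_nonneg) auto
    have gm: "(\<lambda>x. gauss_abs (F0 x * t) (V n x)) \<in> borel_measurable unit_interval"
    proof -
      have "(\<lambda>x. LINT y|std_normal_distribution. \<bar>F0 x * t + V n x * y\<bar>) \<in> borel_measurable unit_interval"
      proof -
        interpret r: real_distribution std_normal_distribution by (rule rd)
        show ?thesis by measurable
      qed
      then show ?thesis by (simp add: gauss_abs_def)
    qed
    have "(LINT \<omega>|unit_interval. nrm (R n \<omega>) t) = enn2real (\<integral>\<^sup>+\<omega>. ennreal (nrm (R n \<omega>) t) \<partial>unit_interval)"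
      using nrmR_m pos by (intro integral_eq_nn_integral) auto
    moreover have "(LINT x|unit_interval. gauss_abs (F0 x * t) (V n x)) = enn2real (\<integral>\<^sup>+x. ennreal (gauss_abs (F0 x * t) (V n x)) \<partial>unit_interval)"
      using gm gauss_abs_nonneg by (intro integral_eq_nn_integral) auto
    ultimately show ?thesis unfolding nneq by simp
  qed
  \<comment> \<open>Lipschitz continuity in the radius turns the mean distance of \<open>R n\<close>
    from 1 into a bound for the distance of the integrals from \<open>nrm 1 t\<close>.\<close>
  have lim: "(\<lambda>n. LINT x|unit_interval. gauss_abs (F0 x * t) (V n x)) \<longlonglongrightarrow> nrm 1 t" for t
  proof (rule LIM_zero_cancel, rule Lim_null_comparison)
    show "\<forall>\<^sub>F n in sequentially. norm ((LINT x|unit_interval. gauss_abs (F0 x * t) (V n x)) - nrm 1 t) \<le> sqrt (2 / real n)"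
      using eventually_gt_at_top[of 0]
    proof eventually_elim
      case (elim n)
      have Rint: "integrable unit_interval (R n)"
        unfolding R_def using expectation_norm_std_normal(1)[OF ind law] .
      have int: "integrable unit_interval (\<lambda>\<omega>. nrm (R n \<omega>) t)"
      proof (rule Bochner_Integration.integrable_bound)
        show "integrable unit_interval (\<lambda>\<omega>. \<bar>nrm 0 t\<bar> + \<bar>R n \<omega>\<bar>)" using Rint by auto
        have b: "norm (nrm r t) \<le> norm (\<bar>nrm 0 t\<bar> + \<bar>r\<bar>)" for r
          using lip[of r t 0] by (simp add: abs_if split: if_splits)
        show "AE \<omega> in unit_interval. norm (nrm (R n \<omega>) t) \<le> norm (\<bar>nrm 0 t\<bar> + \<bar>R n \<omega>\<bar>)"
          by (rule AE_I2) (rule b)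
      qed (rule nrmR_m)
      have "(LINT x|unit_interval. gauss_abs (F0 x * t) (V n x)) - nrm 1 t = (LINT \<omega>|unit_interval. nrm (R n \<omega>) t - nrm 1 t)"
        unfolding eq using int prob_space by (subst Bochner_Integration.integral_diff) auto
      then have "norm ((LINT x|unit_interval. gauss_abs (F0 x * t) (V n x)) - nrm 1 t) \<le> (LINT \<omega>|unit_interval. \<bar>nrm (R n \<omega>) t - nrm 1 t\<bar>)"
        using integral_abs_bound by simp
      also have "\<dots> \<le> (LINT \<omega>|unit_interval. \<bar>R n \<omega> - 1\<bar>)"
        using int Rint lip by (intro integral_mono) auto
      also have "\<dots> \<le> sqrt (2 / real n)"
        unfolding R_def using expectation_norm_std_normal(2)[OF ind law elim] .
      finally show ?case .
    qed
    have "(\<lambda>n. sqrt (2 / real n)) \<longlonglongrightarrow> sqrt 0"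
      by (intro tendsto_real_sqrt lim_const_over_n)
    then show "(\<lambda>n. sqrt (2 / real n)) \<longlonglongrightarrow> 0" by simp
  qed
  show ?thesis
    by (rule cm_curvature_tendsto[where f="\<lambda>n t. LINT x|unit_interval. gauss_abs (F0 x * t) (V n x)", OF _ lim])
      (rule cm_curvature_gauss_abs_mixture[OF F0 Vint])
qed

subsection \<open>Isometric embeddings into \<open>L\<^sub>1\<close>\<close>

lemma L1_eq_refl_iff: "L1_eq f f \<longleftrightarrow> integrable unit_interval f"
  by (simp add: L1_eq_def)

lemma abs_L1_01_add:
  "integrable unit_interval f \<Longrightarrow> integrable unit_interval g \<Longrightarrow>
    abs_L1_01 f + abs_L1_01 g = abs_L1_01 (\<lambda>x. f x + g x)"
  by (rule plus_L1_01.abs_eq) (simp_all add: L1_eq_refl_iff)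

lemma abs_L1_01_scaleR:
  "integrable unit_interval f \<Longrightarrow> c *\<^sub>R abs_L1_01 f = abs_L1_01 (\<lambda>x. c * f x)"
  by (rule scaleR_L1_01.abs_eq) (simp_all add: L1_eq_refl_iff)

lemma norm_abs_L1_01:
  "integrable unit_interval f \<Longrightarrow> norm (abs_L1_01 f) = (LINT x|unit_interval. \<bar>f x\<bar>)"
  by (rule norm_L1_01.abs_eq) (simp_all add: L1_eq_refl_iff)

lemma abs_L1_01_sum:
  "(\<And>i. i \<in> I \<Longrightarrow> integrable unit_interval (f i)) \<Longrightarrow>
    (\<Sum>i\<in>I. abs_L1_01 (f i)) = abs_L1_01 (\<lambda>x. \<Sum>i\<in>I. f i x)"
  by (induction I rule: infinite_finite_induct) (simp_all add: abs_L1_01_add zero_L1_01_def)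

lemma abs_L1_01_surj: "\<exists>f. integrable unit_interval f \<and> X = abs_L1_01 f"
proof -
  have "L1_eq (rep_L1_01 X) (rep_L1_01 X)" by (rule Quotient_rep_reflp[OF Quotient_L1_01])
  moreover have "abs_L1_01 (rep_L1_01 X) = X" by (rule Quotient_abs_rep[OF Quotient_L1_01])
  ultimately show ?thesis unfolding L1_eq_refl_iff by metis
qed

text \<open>The Riesz-Fischer argument: summable norms make the representatives absolutely summable
  almost everywhere, and the sum of their moduli supplies an integrable majorant for the partial
  sums.\<close>

lemma L1_01_summable:
  fixes X :: "nat \<Rightarrow> L1_01"
  assumes "summable (\<lambda>k. norm (X k))"
  shows "convergent (\<lambda>n. \<Sum>k<n. X k)"
proof -
  have "\<forall>k. \<exists>f. integrable unit_interval f \<and> X k = abs_L1_01 f" by (intro allI abs_L1_01_surj)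
  from choice[OF this] obtain g where g0: "\<forall>k. integrable unit_interval (g k) \<and> X k = abs_L1_01 (g k)" ..
  then have g: "integrable unit_interval (g k)" and X: "X k = abs_L1_01 (g k)" for k by auto
  have nX: "norm (X k) = (LINT x|unit_interval. norm (g k x))" for k
    unfolding X using norm_abs_L1_01[OF g] by simp
  have sm: "summable (\<lambda>k. LINT x|unit_interval. norm (g k x))" using assms unfolding nX .
  have gm[measurable]: "g k \<in> borel_measurable unit_interval" for k using g by auto
  have "(\<integral>\<^sup>+x. (\<Sum>k. ennreal (norm (g k x))) \<partial>unit_interval) = (\<Sum>k. \<integral>\<^sup>+x. ennreal (norm (g k x)) \<partial>unit_interval)"
    by (rule nn_integral_suminf) auto
  also have "\<dots> = (\<Sum>k. ennreal (LINT x|unit_interval. norm (g k x)))"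
    using g by (intro suminf_cong nn_integral_eq_integral) auto
  also have "\<dots> = ennreal (\<Sum>k. LINT x|unit_interval. norm (g k x))"
    by (rule suminf_ennreal2) (use sm in \<open>auto intro!: Bochner_Integration.integral_nonneg\<close>)
  also have "\<dots> < \<infinity>" by simp
  finally have "AE x in unit_interval. (\<Sum>k. ennreal (norm (g k x))) \<noteq> \<infinity>"
    by (intro nn_integral_PInf_AE) auto
  then have AEs: "AE x in unit_interval. summable (\<lambda>k. norm (g k x))"
    by eventually_elim (rule summable_suminf_not_top, auto)
  define S where "S x = (\<Sum>k. g k x)" for x
  have Sint: "integrable unit_interval S"
    unfolding S_def by (rule integrable_suminf[OF g AEs sm])
  have nint: "integrable unit_interval (\<lambda>x. \<Sum>k. norm (g k x))"
    by (rule integrable_suminf) (use g AEs sm in auto)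
  have "(\<lambda>n. LINT x|unit_interval. \<bar>(\<Sum>k<n. g k x) - S x\<bar>) \<longlonglongrightarrow> (LINT x|unit_interval. 0)"
  proof (rule integral_dominated_convergence)
    show "integrable unit_interval (\<lambda>x. (\<Sum>k. norm (g k x)) + \<bar>S x\<bar>)" using nint Sint by auto
    show "AE x in unit_interval. (\<lambda>n. \<bar>(\<Sum>k<n. g k x) - S x\<bar>) \<longlonglongrightarrow> 0"
      using AEs
    proof eventually_elim
      case (elim x)
      have "(\<lambda>n. \<Sum>k<n. g k x) \<longlonglongrightarrow> S x"
        unfolding S_def by (rule summable_LIMSEQ[OF summable_norm_cancel[OF elim]])
      then show ?case by (intro tendsto_rabs_zero LIM_zero)
    qed
    show "AE x in unit_interval. norm \<bar>(\<Sum>k<n. g k x) - S x\<bar> \<le> (\<Sum>k. norm (g k x)) + \<bar>S x\<bar>" for n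
      using AEs
    proof eventually_elim
      case (elim x)
      have "\<bar>\<Sum>k<n. g k x\<bar> \<le> (\<Sum>k<n. norm (g k x))" using norm_sum[of "\<lambda>k. g k x" "{..<n}"] by simp
      also have "\<dots> \<le> (\<Sum>k. norm (g k x))" using elim by (intro sum_le_suminf) auto
      finally show ?case by simp
    qed
    show "(\<lambda>x. \<bar>(\<Sum>k<n. g k x) - S x\<bar>) \<in> borel_measurable unit_interval" for n
      using Sint by measurable
  qed simp
  moreover have "norm ((\<Sum>k<n. X k) - abs_L1_01 S) = (LINT x|unit_interval. \<bar>(\<Sum>k<n. g k x) - S x\<bar>)" for n
  proof -
    have "(\<Sum>k<n. X k) = abs_L1_01 (\<lambda>x. \<Sum>k<n. g k x)" unfolding X by (rule abs_L1_01_sum) (rule g)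
    moreover have "abs_L1_01 (\<lambda>x. \<Sum>k<n. g k x) - abs_L1_01 S = abs_L1_01 (\<lambda>x. (\<Sum>k<n. g k x) - S x)"
      using g Sint by (intro minus_L1_01.abs_eq) (auto simp: L1_eq_refl_iff)
    ultimately show ?thesis using g Sint by (simp add: norm_abs_L1_01)
  qed
  ultimately have "(\<lambda>n. norm ((\<Sum>k<n. X k) - abs_L1_01 S)) \<longlonglongrightarrow> 0" by simp
  then have "(\<lambda>n. \<Sum>k<n. X k) \<longlonglongrightarrow> abs_L1_01 S"
    by (rule LIM_zero_cancel[OF tendsto_norm_zero_cancel])
  then show ?thesis by (rule convergentI)
qed

text \<open>Along a subsequence the successive differences have norm at most
  \<open>(1/2) ^ k\<close>, so \<open>L1_01_summable\<close> applies to the telescoping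
  series.\<close>

lemma L1_01_Cauchy_convergent:
  fixes s :: "nat \<Rightarrow> L1_01"
  assumes s: "Cauchy s"
  shows "convergent s"
proof -
  have "\<exists>M. \<forall>m\<ge>M. \<forall>n\<ge>M. norm (s m - s n) < (1/2) ^ k" for k :: nat
    using CauchyD[OF s, of "(1/2) ^ k"] by simp
  then have "\<forall>k. \<exists>M. \<forall>m\<ge>M. \<forall>n\<ge>M. norm (s m - s n) < (1/2) ^ k" by blast
  from choice[OF this] obtain M where M: "\<forall>k. \<forall>m\<ge>M k. \<forall>n\<ge>M k. norm (s m - s n) < (1/2) ^ k" ..
  \<comment> \<open>The sum makes \<open>r\<close> dominate every \<open>M k\<close>, and the added
    \<open>k\<close> makes it strictly increasing.\<close>
  define r where "r k = (\<Sum>j\<le>k. M j) + k" for k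
  have r_mono: "strict_mono r" by (rule strict_mono_Suc_iff[THEN iffD2]) (simp add: r_def)
  have rM: "M k \<le> r k" for k
  proof -
    have "M k \<le> (\<Sum>j\<le>k. M j)" by (rule member_le_sum) auto
    then show ?thesis by (simp add: r_def)
  qed
  define X where "X k = s (r (Suc k)) - s (r k)" for k
  have bound: "norm (X k) \<le> (1/2) ^ k" for k
  proof -
    have "r k \<le> r (Suc k)" using r_mono by (simp add: strict_mono_less_eq)
    then have "norm (X k) < (1/2) ^ k"
      unfolding X_def using M rM[of k] by (meson order_trans)
    then show ?thesis by simp
  qed
  have "summable (\<lambda>k. norm (X k))"
    by (rule summable_comparison_test'[of "\<lambda>k. (1/2) ^ k" 0]) (use bound in \<open>auto intro!: summable_geometric\<close>)
  then have "convergent (\<lambda>n. \<Sum>k<n. X k)" by (rule L1_01_summable)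
  then obtain l where l: "(\<lambda>n. \<Sum>k<n. X k) \<longlonglongrightarrow> l" unfolding convergent_def by blast
  have "(\<Sum>k<n. X k) = s (r n) - s (r 0)" for n
    unfolding X_def by (rule sum_lessThan_telescope)
  then have "(\<lambda>n. s (r n) - s (r 0)) \<longlonglongrightarrow> l" using l by simp
  from tendsto_add[OF this tendsto_const[of "s (r 0)"]] have "(s \<circ> r) \<longlonglongrightarrow> l + s (r 0)" by (simp add: comp_def)
  from Cauchy_converges_subseq[OF s r_mono this] show ?thesis by (rule convergentI)
qed

section \<open>Coordinates in \<open>ell2\<close> and embeddings of H(E)\<close>

lift_definition ell2_unit :: "nat \<Rightarrow> ell2" is "\<lambda>i j. of_bool (i = j)"
proof -
  fix i :: nat
  show "summable (\<lambda>j. (of_bool (i = j) :: real)\<^sup>2)"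
    by (rule summable_finite[of "{i}"]) auto
qed

lemma ell2_nth_sum: "ell2_nth (\<Sum>i\<in>I. f i) j = (\<Sum>i\<in>I. ell2_nth (f i) j)"
  by (induction I rule: infinite_finite_induct) (simp_all add: zero_ell2.rep_eq plus_ell2.rep_eq)

lemma norm_ell2_finite_sum: "norm (\<Sum>i<n. a i *\<^sub>R ell2_unit i) = sqrt (\<Sum>i<n. (a i)\<^sup>2)"
proof -
  have "ell2_nth (\<Sum>i<n. a i *\<^sub>R ell2_unit i) j = (if j < n then a j else 0)" for j
  proof -
    have "ell2_nth (\<Sum>i<n. a i *\<^sub>R ell2_unit i) j = (\<Sum>i<n. if i = j then a i else 0)"
      unfolding ell2_nth_sum by (rule sum.cong) (auto simp: scaleR_ell2.rep_eq ell2_unit.rep_eq)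
    then show ?thesis by simp
  qed
  then have "norm (\<Sum>i<n. a i *\<^sub>R ell2_unit i) = sqrt (\<Sum>j. (if j < n then a j else 0)\<^sup>2)"
    by (simp add: norm_ell2.rep_eq)
  also have "(\<Sum>j. (if j < n then a j else 0)\<^sup>2) = (\<Sum>j<n. (if j < n then a j else 0)\<^sup>2)"
    by (rule suminf_finite) auto
  finally show ?thesis by simp
qed

lemma norm_ell2_partial_tendsto:
  "(\<lambda>n. sqrt (\<Sum>i<n. (ell2_nth a i)\<^sup>2)) \<longlonglongrightarrow> norm a"
proof -
  have "summable (\<lambda>i. (ell2_nth a i)\<^sup>2)" using ell2_nth[of a] by simp
  from tendsto_real_sqrt[OF summable_LIMSEQ[OF this]] show ?thesis
    by (simp add: norm_ell2.rep_eq)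
qed

text \<open>Integrable representatives of the images of the unit vectors are chosen once. Linearity
  of the embedding then settles all finite combinations.\<close>

lemma H_norm_isometry_imp_functions:
  assumes "L1_subspace (H_norm N)"
  obtains F0 F where "integrable unit_interval F0" "\<And>i::nat. integrable unit_interval (F i)"
    "\<And>n a t. (LINT x|unit_interval. \<bar>t * F0 x + (\<Sum>i<n. a i * F i x)\<bar>) =
      N (sqrt (\<Sum>i<n. (a i)\<^sup>2) *\<^sub>R axis 1 1 + t *\<^sub>R axis 2 1)"
proof -
  obtain T :: "real \<times> ell2 \<Rightarrow> L1_01" where T: "linear T" and iso: "\<And>x. norm (T x) = H_norm N x"
    using assms unfolding L1_subspace_def by blast
  obtain F0 where F0: "integrable unit_interval F0" "T (1, 0) = abs_L1_01 F0"
    using abs_L1_01_surj by blast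
  have "\<forall>i. \<exists>f. integrable unit_interval f \<and> T (0, ell2_unit i) = abs_L1_01 f" by (intro allI abs_L1_01_surj)
  from choice[OF this] obtain F where "\<forall>i. integrable unit_interval (F i) \<and> T (0, ell2_unit i) = abs_L1_01 (F i)" ..
  then have F: "integrable unit_interval (F i)" "T (0, ell2_unit i) = abs_L1_01 (F i)" for i by auto
  show ?thesis
  proof (rule that[OF F0(1) F(1)])
    fix n :: nat and a :: "nat \<Rightarrow> real" and t :: real
    have dec: "(t, \<Sum>i<n. a i *\<^sub>R ell2_unit i) = t *\<^sub>R (1, 0) + (\<Sum>i<n. a i *\<^sub>R (0, ell2_unit i))"
      by (simp add: prod_eq_iff fst_sum snd_sum)
    have "T (t, \<Sum>i<n. a i *\<^sub>R ell2_unit i) = t *\<^sub>R T (1, 0) + (\<Sum>i<n. a i *\<^sub>R T (0, ell2_unit i))"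
      unfolding dec by (simp only: linear_add[OF T] linear_scale[OF T] linear_sum[OF T])
    also have "\<dots> = abs_L1_01 (\<lambda>x. t * F0 x + (\<Sum>i<n. a i * F i x))"
      using F F0 by (simp add: abs_L1_01_scaleR abs_L1_01_sum abs_L1_01_add)
    finally have "H_norm N (t, \<Sum>i<n. a i *\<^sub>R ell2_unit i) = (LINT x|unit_interval. \<bar>t * F0 x + (\<Sum>i<n. a i * F i x)\<bar>)"
      using F F0 by (simp add: iso[symmetric] norm_abs_L1_01)
    then show "(LINT x|unit_interval. \<bar>t * F0 x + (\<Sum>i<n. a i * F i x)\<bar>) =
      N (sqrt (\<Sum>i<n. (a i)\<^sup>2) *\<^sub>R axis 1 1 + t *\<^sub>R axis 2 1)"
      by (simp add: H_norm_def norm_ell2_finite_sum)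
  qed
qed

lemma is_norm_lipschitz:
  assumes N: "is_norm N" and one: "N v = 1"
  shows "\<bar>N (r *\<^sub>R v + w) - N (r' *\<^sub>R v + w)\<bar> \<le> \<bar>r - r'\<bar>"
proof -
  have Nsc: "N (c *\<^sub>R x) = \<bar>c\<bar> * N x" and Ntri: "N (x + y) \<le> N x + N y" for c x y
    using N unfolding is_norm_def by auto
  have le: "N (r *\<^sub>R v + w) - N (r' *\<^sub>R v + w) \<le> \<bar>r - r'\<bar>" for r r'
  proof -
    have "(r - r') *\<^sub>R v + (r' *\<^sub>R v + w) = r *\<^sub>R v + w" by (simp add: algebra_simps)
    moreover have "N ((r - r') *\<^sub>R v) = \<bar>r - r'\<bar>" by (simp only: Nsc one mult_1_right)
    ultimately have "N (r *\<^sub>R v + w) \<le> \<bar>r - r'\<bar> + N (r' *\<^sub>R v + w)"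
      using Ntri[of "(r - r') *\<^sub>R v" "r' *\<^sub>R v + w"] by (simp only:)
    then show ?thesis by simp
  qed
  show ?thesis using le[of r r'] le[of r' r] by (simp add: abs_minus_commute abs_le_iff)
qed

text \<open>An isometry on finite combinations is extended by the limit \<open>L a\<close> over
  truncations. These are Cauchy because on combinations of the \<open>f i\<close> the norm is the
  \<open>\<ell>\<^sub>2\<close> norm of the coefficients. Linearity passes to the limit by
  uniqueness of limits, the norm identity by Lipschitz continuity of \<open>N\<close>.\<close>

lemma H_norm_isometryI:
  fixes f :: "nat \<Rightarrow> L1_01"
  assumes N: "is_norm N" and one: "N (axis 1 1) = 1" and two: "N (axis 2 1) = 1"
    and iso: "\<And>n a t. norm (t *\<^sub>R f0 + (\<Sum>i<n. a i *\<^sub>R f i)) =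
      N (sqrt (\<Sum>i<n. (a i)\<^sup>2) *\<^sub>R axis 1 1 + t *\<^sub>R axis 2 1)"
  shows "L1_subspace (H_norm N)"
proof -
  have N0: "\<And>x. N x = 0 \<longleftrightarrow> x = 0" and Nsc: "\<And>c x. N (c *\<^sub>R x) = \<bar>c\<bar> * N x"
    and Ntri: "\<And>x y. N (x + y) \<le> N x + N y" using N unfolding is_norm_def by auto
  define S where "S a n = (\<Sum>i<n. ell2_nth a i *\<^sub>R f i)" for a n
  have iso0: "norm (\<Sum>i<n. a i *\<^sub>R f i) = N (sqrt (\<Sum>i<n. (a i)\<^sup>2) *\<^sub>R axis 1 1)" for n a
    using iso[of 0 a n] by simp
  have "Cauchy (S a)" for a
  proof (rule CauchyI)
    fix e :: real assume "e > 0"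
    have "summable (\<lambda>i. (ell2_nth a i)\<^sup>2)" using ell2_nth[of a] by simp
    moreover have "e\<^sup>2 > 0" using \<open>e > 0\<close> by simp
    ultimately have "\<exists>M. \<forall>m\<ge>M. \<forall>n. norm (\<Sum>i=m..<n. (ell2_nth a i)\<^sup>2) < e\<^sup>2"
      unfolding summable_Cauchy by blast
    then obtain M where M: "\<And>m n. m \<ge> M \<Longrightarrow> norm (\<Sum>i=m..<n. (ell2_nth a i)\<^sup>2) < e\<^sup>2"
      by blast
    have *: "norm (S a n - S a m) < e" if "M \<le> m" "m \<le> n" for m n
    proof -
      have "S a n - S a m = (\<Sum>i=m..<n. ell2_nth a i *\<^sub>R f i)"
        unfolding S_def using sum_diff_nat_ivl[of 0 m n "\<lambda>i. ell2_nth a i *\<^sub>R f i"] that by (simp add: atLeast0LessThan)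
      \<comment> \<open>A block starting at \<open>m\<close> is rewritten as an initial segment with
        zero coefficients in front, the shape that \<open>iso0\<close> accepts.\<close>
      also have "\<dots> = (\<Sum>i<n. (if m \<le> i then ell2_nth a i else 0) *\<^sub>R f i)"
        by (rule sum.mono_neutral_cong_left) auto
      finally have "norm (S a n - S a m) = N (sqrt (\<Sum>i<n. (if m \<le> i then ell2_nth a i else 0)\<^sup>2) *\<^sub>R axis 1 1)"
        by (simp only: iso0)
      also have "\<dots> = sqrt (\<Sum>i<n. (if m \<le> i then ell2_nth a i else 0)\<^sup>2)"
        by (simp add: Nsc one sum_nonneg)
      also have "(\<Sum>i<n. (if m \<le> i then ell2_nth a i else 0)\<^sup>2) = (\<Sum>i=m..<n. (ell2_nth a i)\<^sup>2)"
        by (rule sum.mono_neutral_cong_right) auto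
      also have "sqrt \<dots> < sqrt (e\<^sup>2)"
        using M[OF that(1), of n] by (intro real_sqrt_less_mono) (simp add: sum_nonneg)
      finally show ?thesis using \<open>e > 0\<close> by simp
    qed
    show "\<exists>M. \<forall>m\<ge>M. \<forall>n\<ge>M. norm (S a m - S a n) < e"
    proof (intro exI allI impI)
      fix m n assume "M \<le> m" "M \<le> n"
      then show "norm (S a m - S a n) < e"
        using *[of m n] *[of n m] by (cases "m \<le> n") (auto simp: norm_minus_commute)
    qed
  qed
  then have "\<forall>a. \<exists>l. S a \<longlonglongrightarrow> l"
    using L1_01_Cauchy_convergent unfolding convergent_def by blast
  from choice[OF this] obtain L where "\<forall>a. S a \<longlonglongrightarrow> L a" ..
  then have L: "S a \<longlonglongrightarrow> L a" for a by simp
  define T where "T = (\<lambda>(t, a). t *\<^sub>R f0 + L a)"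
  have L_add: "L (a + b) = L a + L b" for a b
  proof (rule LIMSEQ_unique[OF L])
    have "S (a + b) = (\<lambda>n. S a n + S b n)"
      by (auto simp: S_def plus_ell2.rep_eq scaleR_left_distrib sum.distrib)
    then show "S (a + b) \<longlonglongrightarrow> L a + L b" using tendsto_add[OF L L] by simp
  qed
  have L_scale: "L (c *\<^sub>R a) = c *\<^sub>R L a" for a c
  proof (rule LIMSEQ_unique[OF L])
    have "S (c *\<^sub>R a) = (\<lambda>n. c *\<^sub>R S a n)"
      by (auto simp: S_def scaleR_ell2.rep_eq scaleR_sum_right)
    then show "S (c *\<^sub>R a) \<longlonglongrightarrow> c *\<^sub>R L a" using tendsto_scaleR[OF tendsto_const L] by simp
  qed
  have lin: "linear T"
    by (rule linearI) (auto simp: T_def L_add L_scale algebra_simps)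
  have normT: "norm (T x) = H_norm N x" for x
  proof -
    obtain t a where x: "x = (t, a)" by (cases x)
    note Nlip = is_norm_lipschitz[where v="axis 1 1", OF N one]
    have "(\<lambda>n. norm (t *\<^sub>R f0 + S a n)) \<longlonglongrightarrow> norm (T x)"
      unfolding T_def x by (auto intro!: tendsto_intros L)
    moreover have "(\<lambda>n. norm (t *\<^sub>R f0 + S a n)) \<longlonglongrightarrow> N (norm a *\<^sub>R axis 1 1 + t *\<^sub>R axis 2 1)"
    proof (rule LIM_zero_cancel, rule Lim_null_comparison)
      show "\<forall>\<^sub>F n in sequentially. norm (norm (t *\<^sub>R f0 + S a n) - N (norm a *\<^sub>R axis 1 1 + t *\<^sub>R axis 2 1)) \<le>
        \<bar>sqrt (\<Sum>i<n. (ell2_nth a i)\<^sup>2) - norm a\<bar>"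
        unfolding S_def iso using Nlip by simp
      show "(\<lambda>n. \<bar>sqrt (\<Sum>i<n. (ell2_nth a i)\<^sup>2) - norm a\<bar>) \<longlonglongrightarrow> 0"
        by (rule tendsto_rabs_zero[OF LIM_zero[OF norm_ell2_partial_tendsto]])
    qed
    ultimately show ?thesis unfolding x H_norm_def by (auto dest: LIMSEQ_unique)
  qed
  have inj: "inj T"
  proof (rule linear_injective_0[OF lin, THEN iffD2], intro allI impI)
    fix x assume "T x = 0"
    obtain t a where x: "x = (t, a)" by (cases x)
    have "N (norm a *\<^sub>R axis 1 1 + t *\<^sub>R axis 2 1) = 0"
      using normT[of x] \<open>T x = 0\<close> by (simp add: x H_norm_def)
    then have z: "norm a *\<^sub>R axis 1 1 + t *\<^sub>R axis 2 1 = (0 :: real^2)" using N0 by simp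
    have "norm a = 0" using arg_cong[OF z, of "\<lambda>v. v $ 1"] by (simp add: axis_def)
    moreover have "t = 0" using arg_cong[OF z, of "\<lambda>v. v $ 2"] by (simp add: axis_def)
    ultimately show "x = 0" by (simp add: x zero_prod_def)
  qed
  show ?thesis
    unfolding L1_subspace_def
  proof (intro exI conjI allI)
    show "subspace (range T)" using lin by (simp add: linear_subspace_image)
    show "bij_betw T UNIV (range T)" using inj by (simp add: bij_betw_def)
  qed (use lin normT in auto)
qed

subsection \<open>Bernstein's theorem\<close>

text \<open>To the left of the centre the alternating signs of the derivatives cancel those of
  \<open>(y - x) ^ k\<close>, so all Taylor terms are nonnegative. This positivity bounds the
  coefficients and makes the series converge to \<open>f\<close> at every point between 0 and the
  centre.\<close>

lemma completely_monotone_open_taylor: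
  assumes cm: "completely_monotone_open f"
  obtains a where "\<And>k t. t > 0 \<Longrightarrow> a k t \<ge> 0"
    "\<And>x y. 0 < y \<Longrightarrow> y < x \<Longrightarrow> (\<lambda>k. a k x * (x - y) ^ k) sums f y"
proof -
  obtain D where D0: "\<forall>t>0. D 0 t = f t"
    and DD: "\<forall>k. \<forall>t>0. (D k has_real_derivative D (Suc k) t) (at t)"
    and Dp: "\<forall>k. \<forall>t>0. (-1) ^ k * D k t \<ge> 0"
    using cm[unfolded completely_monotone_open_iff] by (elim exE conjE)
  have D: "(D k has_real_derivative D (Suc k) t) (at t)" if "t > 0" for k t using DD that by blast
  have pos: "(-1) ^ k * D k t \<ge> 0" if "t > 0" for k t using Dp that by blast
  define a where "a k t = (-1) ^ k * D k t / fact k" for k :: nat and t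
  have a_nonneg: "a k t \<ge> 0" if "t > 0" for k t using pos[OF that] by (simp add: a_def)
  have aD: "a k x * (x - y) ^ k = D k x / fact k * (y - x) ^ k" for k x y
  proof -
    have "(y - x) ^ k = (-1) ^ k * (x - y) ^ k" by (simp flip: power_mult_distrib)
    then show ?thesis by (simp add: a_def)
  qed
  have a_anti: "a k t \<le> a k s" if "0 < s" "s \<le> t" for k s t
  proof -
    have "(-1) ^ k * D k t \<le> (-1) ^ k * D k s"
    proof (rule DERIV_nonpos_imp_nonincreasing[OF that(2)])
      fix u assume "s \<le> u"
      then have u: "u > 0" using that by simp
      show "\<exists>y. ((\<lambda>t. (-1) ^ k * D k t) has_real_derivative y) (at u) \<and> y \<le> 0"
      proof (intro exI conjI)
        show "((\<lambda>t. (-1) ^ k * D k t) has_real_derivative (-1) ^ k * D (Suc k) u) (at u)"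
          by (rule DERIV_cmult[OF D[OF u]])
        show "(-1) ^ k * D (Suc k) u \<le> 0" using pos[OF u, of "Suc k"] by simp
      qed
    qed
    then show ?thesis by (simp add: a_def divide_right_mono)
  qed
  \<comment> \<open>In the Taylor expansion at \<open>z\<close>, evaluated at \<open>w < z\<close>,
    every term is nonnegative, so the remainder alone is at most \<open>f w\<close>. Since
    \<open>a m\<close> is decreasing, the intermediate point \<open>t\<close> may be replaced by
    \<open>z\<close>.\<close>
  have bound: "a m z * (z - w) ^ m \<le> f w" if "0 < w" "w < z" for m w z
  proof (cases "m = 0")
    case True
    have "D 0 z = f z" "D 0 w = f w" using D0 that by auto
    then show ?thesis using completely_monotone_open_antimono[OF cm that(1), of z] that True by (simp add: a_def)
  next
    case False
    have "\<exists>t. w < t \<and> t < z \<and> f w = (\<Sum>k<m. (D k z / fact k) * (w - z) ^ k) + (D m t / fact m) * (w - z) ^ m"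
    proof -
      have "\<exists>t. w < t \<and> t < z \<and> D 0 w = (\<Sum>k<m. (D k z / fact k) * (w - z) ^ k) + (D m t / fact m) * (w - z) ^ m"
        by (rule Taylor_down[where b=z]) (use False that D in auto)
      then show ?thesis using D0 that by simp
    qed
    then obtain t where t: "w < t" "t < z" "f w = (\<Sum>k<m. (D k z / fact k) * (w - z) ^ k) + (D m t / fact m) * (w - z) ^ m"
      by blast
    have "f w = (\<Sum>k<m. a k z * (z - w) ^ k) + a m t * (z - w) ^ m"
    proof -
      have "D m t / fact m * (w - z) ^ m = a m t * (z - w) ^ m"
      proof -
        have "(w - z) ^ m = (-1) ^ m * (z - w) ^ m" by (simp flip: power_mult_distrib)
        then show ?thesis by (simp add: a_def)
      qed
      then show ?thesis using t(3) by (simp add: aD)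
    qed
    moreover have "(\<Sum>k<m. a k z * (z - w) ^ k) \<ge> 0"
      using that a_nonneg by (intro sum_nonneg mult_nonneg_nonneg) auto
    moreover have "a m z * (z - w) ^ m \<le> a m t * (z - w) ^ m"
      using t that by (intro mult_right_mono a_anti) auto
    ultimately show ?thesis by linarith
  qed
  \<comment> \<open>Differentiating the Taylor polynomial with respect to its centre telescopes to
    one term. The mean value theorem then gives the remainder in Cauchy form, whose factor
    \<open>(y - z) ^ m\<close> offsets the growth of the coefficients near \<open>y\<close>.\<close>
  have deriv_h: "((\<lambda>z. \<Sum>k<Suc m. D k z / fact k * (y - z) ^ k) has_real_derivative
      D (Suc m) z / fact m * (y - z) ^ m) (at z)" if "z > 0" for m y z
  proof (induction m)
    case 0
    then show ?case using D[OF that, of 0] by simp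
  next
    case (Suc m)
    have "((\<lambda>z. D (Suc m) z / fact (Suc m) * (y - z) ^ Suc m) has_real_derivative
      D (Suc (Suc m)) z / fact (Suc m) * (y - z) ^ Suc m
        + - (real (Suc m) * (y - z) ^ m) * (D (Suc m) z / fact (Suc m))) (at z)"
    proof (rule DERIV_mult)
      have "((\<lambda>z. y - z) has_real_derivative - 1) (at z)" by (auto intro!: derivative_eq_intros)
      from DERIV_power_Suc[OF this, of m]
      show "((\<lambda>z. (y - z) ^ Suc m) has_real_derivative - (real (Suc m) * (y - z) ^ m)) (at z)"
        by (simp add: algebra_simps)
      show "((\<lambda>z. D (Suc m) z / fact (Suc m)) has_real_derivative D (Suc (Suc m)) z / fact (Suc m)) (at z)"
        by (rule DERIV_cdivide[OF D[OF that]])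
    qed
    moreover have "- (real (Suc m) * w) * (d / fact (Suc m)) = - (d / fact m * w)" for w d :: real
      by (simp add: fact_Suc)
    ultimately show ?case
      by (subst sum.lessThan_Suc) (rule DERIV_cong[OF DERIV_add[OF Suc]], assumption, simp)
  qed
  have sums: "(\<lambda>k. a k x * (x - y) ^ k) sums f y" if y: "0 < y" and xy: "y < x" for x y
  proof -
    \<comment> \<open>The intermediate point \<open>z\<close> is unknown, but
      \<open>(z - y) / (z - y/2)\<close> increases with \<open>z\<close>, so its value
      \<open>q < 1\<close> at \<open>x\<close> bounds it. The point \<open>y/2\<close> is the
      reserve at which \<open>bound\<close> is applied, and the factor \<open>2 / y\<close> in
      \<open>C\<close> bounds \<open>1 / (z - y/2)\<close>.\<close>
    define q where "q = (x - y) / (x - y/2)"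
    have q: "0 \<le> q" "q < 1" using y xy by (auto simp: q_def)
    define C where "C = (x - y) * f (y/2) * (2 / y)"
    have est: "\<bar>(\<Sum>k<Suc m. a k x * (x - y) ^ k) - f y\<bar> \<le> C * (real (Suc m) * q ^ m)" for m
    proof -
      let ?h = "\<lambda>z. \<Sum>k<Suc m. D k z / fact k * (y - z) ^ k"
      have "\<exists>z>y. z < x \<and> ?h x - ?h y = (x - y) * (D (Suc m) z / fact m * (y - z) ^ m)"
        by (rule MVT2[OF xy], rule deriv_h) (use y in linarith)
      then obtain z where z: "y < z" "z < x"
        and eq: "?h x - ?h y = (x - y) * (D (Suc m) z / fact m * (y - z) ^ m)" by blast
      have "?h y = (\<Sum>k<Suc m. if k = 0 then D 0 y else 0)"
        by (rule sum.cong) auto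
      then have hy: "?h y = f y" using D0 y by simp
      have "\<bar>D (Suc m) z\<bar> = a (Suc m) z * fact (Suc m)"
        using pos[of z "Suc m"] z y by (cases "even m") (auto simp: a_def)
      then have "\<bar>D (Suc m) z / fact m * (y - z) ^ m\<bar> = a (Suc m) z * real (Suc m) * (z - y) ^ m"
        using z by (simp add: abs_mult power_abs field_simps)
      moreover have "\<bar>?h x - f y\<bar> = \<bar>x - y\<bar> * \<bar>D (Suc m) z / fact m * (y - z) ^ m\<bar>"
        using eq unfolding hy by (simp only: abs_mult)
      moreover have "\<bar>x - y\<bar> = x - y" using xy by simp
      ultimately have e1: "\<bar>?h x - f y\<bar> = (x - y) * (a (Suc m) z * real (Suc m) * (z - y) ^ m)"
        by (simp only:)
      have zw: "z - y/2 > 0" "z - y / 2 \<ge> y / 2" using z y by auto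
      have b: "a (Suc m) z \<le> f (y/2) / (z - y/2) ^ Suc m"
        using bound[of "y/2" z "Suc m"] y z zw by (simp add: pos_le_divide_eq)
      have f0: "f (y/2) \<ge> 0" using completely_monotone_open_nonneg[OF cm, of "y/2"] y by simp
      have "a (Suc m) z * (z - y) ^ m \<le> f (y/2) / (z - y/2) ^ Suc m * (z - y) ^ m"
        using b z by (intro mult_right_mono) auto
      also have "\<dots> = f (y/2) * (1 / (z - y/2)) * ((z - y) / (z - y/2)) ^ m"
        by (simp add: power_divide)
      also have "\<dots> \<le> f (y/2) * (2 / y) * q ^ m"
      proof (intro mult_mono power_mono mult_left_mono)
        show "1 / (z - y / 2) \<le> 2 / y" using zw y by (simp add: field_simps)
        have "(z - y) * (x - y/2) \<le> (x - y) * (z - y/2)"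
        proof -
          have "(x - y) * (z - y/2) - (z - y) * (x - y/2) = (x - z) * (y / 2)" by (simp add: field_simps)
          also have "\<dots> \<ge> 0" using z y by simp
          finally show ?thesis by simp
        qed
        then show "(z - y) / (z - y / 2) \<le> q" unfolding q_def using zw y xy by (simp add: pos_divide_le_eq pos_le_divide_eq)
      qed (use f0 zw z y q in auto)
      finally have e2: "a (Suc m) z * (z - y) ^ m \<le> f (y/2) * (2 / y) * q ^ m" .
      have "\<bar>?h x - f y\<bar> = (x - y) * real (Suc m) * (a (Suc m) z * (z - y) ^ m)" unfolding e1 by simp
      also have "\<dots> \<le> (x - y) * real (Suc m) * (f (y/2) * (2 / y) * q ^ m)"
        using e2 xy by (intro mult_left_mono) auto
      also have "\<dots> = C * (real (Suc m) * q ^ m)" by (simp add: C_def)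
      finally show ?thesis by (simp only: aD)
    qed
    have "(\<lambda>m. C * (real (Suc m) * q ^ m)) \<longlonglongrightarrow> C * 0"
    proof (intro tendsto_mult tendsto_const)
      have "(\<lambda>m. of_nat m * q ^ m) \<longlonglongrightarrow> 0" by (rule powser_times_n_limit_0) (use q in simp)
      moreover have "(\<lambda>m. q ^ m) \<longlonglongrightarrow> 0" using q by (intro LIMSEQ_power_zero) simp
      ultimately have "(\<lambda>m. of_nat m * q ^ m + q ^ m) \<longlonglongrightarrow> 0 + 0" by (rule tendsto_add)
      then show "(\<lambda>m. real (Suc m) * q ^ m) \<longlonglongrightarrow> 0" by (simp add: algebra_simps)
    qed
    then have lim0: "(\<lambda>m. C * (real (Suc m) * q ^ m)) \<longlonglongrightarrow> 0" by (simp only: mult_zero_right)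
    have "\<forall>m. norm ((\<Sum>k<Suc m. a k x * (x - y) ^ k) - f y) \<le> C * (real (Suc m) * q ^ m)"
      using est unfolding real_norm_def by (rule allI)
    from Lim_null_comparison[OF always_eventually[OF this] lim0]
    have "(\<lambda>m. (\<Sum>k<Suc m. a k x * (x - y) ^ k) - f y) \<longlonglongrightarrow> 0" .
    then have "(\<lambda>m. \<Sum>k<Suc m. a k x * (x - y) ^ k) \<longlonglongrightarrow> f y" by (rule LIM_zero_cancel)
    then show ?thesis unfolding sums_def by (rule filterlim_sequentially_Suc[THEN iffD1])
  qed
  show ?thesis by (rule that[OF a_nonneg sums])
qed


lemma integrable_exp_minus_max:
  assumes "real_distribution \<mu>" "t \<ge> 0"
  shows "integrable \<mu> (\<lambda>u. exp (- t * max u 0))"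
proof -
  interpret real_distribution \<mu> by fact
  show ?thesis
    by (rule integrable_const_bound[of _ 1]) (use \<open>t \<ge> 0\<close> in auto)
qed

text \<open>A Laplace transform close to 1 at a small \<open>t\<close> leaves little mass beyond
  \<open>1/t\<close>, because there \<open>1 - exp (- t * u)\<close> is at least
  \<open>1 - exp (- 1)\<close>. The common lower bound \<open>g\<close> makes the choice of
  \<open>t\<close> uniform in \<open>n\<close>.\<close>

lemma tight_if_laplace_bound:
  assumes \<mu>: "\<And>n. real_distribution (\<mu> n)" and supp: "\<And>n. AE u in \<mu> n. u \<ge> 0"
    and lap: "\<And>n t. t > 0 \<Longrightarrow> g t \<le> (LINT u|\<mu> n. exp (- t * max u 0))"
    and g: "(g \<longlongrightarrow> 1) (at_right 0)"
  shows "tight \<mu>"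
  unfolding tight_def
proof (intro conjI allI impI \<mu>)
  fix e :: real assume e: "e > 0"
  define d where "d = 1 - exp (- 1 :: real)"
  have d: "d > 0" by (simp add: d_def)
  have "eventually (\<lambda>t. g t > 1 - e * d) (at_right 0)"
    using order_tendstoD(1)[OF g, of "1 - e * d"] e d by simp
  then have "eventually (\<lambda>t. g t > 1 - e * d \<and> t > 0) (at_right 0)"
    by (intro eventually_conj eventually_at_right_less)
  then obtain t where t: "g t > 1 - e * d" "t > 0"
    using eventually_happens'[of "at_right (0::real)"] by force
  \<comment> \<open>The left end -1 keeps a possible atom at 0 inside the half-open
    interval.\<close>
  have "measure (\<mu> n) {-1<..1/t} > 1 - e" for n
  proof -
    interpret real_distribution "\<mu> n" by (rule \<mu>)
    have "d * indicator {1/t<..} u \<le> 1 - exp (- t * max u 0)" for u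
    proof (cases "u > 1/t")
      case True
      then have "t * u > 1" using t by (simp add: field_simps)
      moreover have "u > 0" using True t by (meson divide_pos_pos less_trans zero_less_one)
      ultimately have "exp (- t * max u 0) \<le> exp (- 1)" by simp
      then show ?thesis using True by (simp add: d_def)
    next
      case False
      have "exp (- t * max u 0) \<le> 1" using t by simp
      then show ?thesis using False by simp
    qed
    then have "(LINT u|\<mu> n. d * indicator {1/t<..} u) \<le> (LINT u|\<mu> n. 1 - exp (- t * max u 0))"
      using t integrable_exp_minus_max[OF \<mu>, of t n]
      by (intro integral_mono) (auto simp: emeasure_eq_measure intro!: integrable_mult_right)
    also have "\<dots> = 1 - (LINT u|\<mu> n. exp (- t * max u 0))"
      using t integrable_exp_minus_max[OF \<mu>, of t n] prob_space
      by (subst Bochner_Integration.integral_diff) auto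
    also have "\<dots> < e * d" using lap[OF t(2), of n] t by simp
    finally have "d * measure (\<mu> n) {1/t<..} < e * d" by simp
    then have tail: "measure (\<mu> n) {1/t<..} < e" using d by (simp add: mult.commute)
    have "AE u in \<mu> n. u \<in> {-1<..1/t} \<union> {1/t<..}" using supp[of n] by eventually_elim auto
    then have "measure (\<mu> n) ({-1<..1/t} \<union> {1/t<..}) = 1"
      by (subst prob_eq_1) auto
    moreover have "measure (\<mu> n) ({-1<..1/t} \<union> {1/t<..}) \<le> measure (\<mu> n) {-1<..1/t} + measure (\<mu> n) {1/t<..}"
      by (rule measure_Un_le) auto
    ultimately show ?thesis using tail by linarith
  qed
  moreover have "-1 < 1/t" using t by (smt (verit) divide_pos_pos)
  ultimately show "\<exists>a b. a < b \<and> (\<forall>n. 1 - e < measure (\<mu> n) {a<..b})" by blast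
qed

text \<open>Feller's argument: the Taylor series of \<open>f\<close> at \<open>n\<close>, evaluated at \<open>n (1 - exp(- t / n))\<close>, is the
  Laplace transform of a discrete measure on the multiples of \<open>1 / n\<close>, and these measures are
  tight. The integrand \<open>exp(- t * max u 0)\<close> spares proving that the limit measure lives on \<open>{0..}\<close>.\<close>

theorem bernstein:
  assumes cm: "completely_monotone_open f" and cont: "(f \<longlongrightarrow> f 0) (at_right 0)" and f0: "f 0 > 0"
  obtains \<mu> where "real_distribution \<mu>"
    "\<And>t. t \<ge> 0 \<Longrightarrow> f t = f 0 * (LINT u|\<mu>. exp (- t * max u 0))"
proof -
  obtain a where a: "\<And>k t. t > 0 \<Longrightarrow> a k t \<ge> 0"
    and sums: "\<And>x y. 0 < y \<Longrightarrow> y < x \<Longrightarrow> (\<lambda>k. a k x * (x - y) ^ k) sums f y"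
    by (rule completely_monotone_open_taylor[OF cm], rule that)
  have f_le: "f y \<le> f 0" if "y > 0" for y
    using completely_monotone_open_le_limit[OF cm cont that] .
  \<comment> \<open>\<open>p n k\<close> becomes the mass at \<open>k / Suc n\<close>; expanding at
    \<open>Suc n\<close> rather than \<open>n\<close> avoids the centre 0. With
    \<open>s = exp (- t / Suc n)\<close> the Taylor series at the point
    \<open>Suc n * (1 - s)\<close> has the terms \<open>p n k * s ^ k\<close>, up to the factor
    \<open>f 0\<close>.\<close>
  define p where "p n k = a k (real (Suc n)) * real (Suc n) ^ k / f 0" for n k
  have p_nonneg: "p n k \<ge> 0" for n k using a f0 by (simp add: p_def)
  have p_sums: "(\<lambda>k. p n k * s ^ k) sums (f (real (Suc n) * (1 - s)) / f 0)" if "0 < s" "s < 1" for n s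
  proof -
    have "(\<lambda>k. a k (real (Suc n)) * (real (Suc n) - real (Suc n) * (1 - s)) ^ k) sums f (real (Suc n) * (1 - s))"
      using that by (intro sums) auto
    moreover have "real (Suc n) - real (Suc n) * (1 - s) = real (Suc n) * s" by (simp add: algebra_simps)
    ultimately have "(\<lambda>k. a k (real (Suc n)) * (real (Suc n) * s) ^ k) sums f (real (Suc n) * (1 - s))" by simp
    from sums_divide[OF this, of "f 0"] show ?thesis by (simp add: p_def power_mult_distrib mult_ac)
  qed
  \<comment> \<open>Abel's argument: for \<open>s < 1\<close> the partial sums are bounded by a
    value of \<open>f\<close> divided by \<open>f 0\<close>, and \<open>s\<close> may increase to
    1.\<close>
  have p_part: "(\<Sum>k<m. p n k) \<le> 1" for n m
  proof (rule tendsto_upperbound)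
    show "((\<lambda>s. \<Sum>k<m. p n k * s ^ k) \<longlongrightarrow> (\<Sum>k<m. p n k)) (at_left 1)"
      by (auto intro!: tendsto_eq_intros)
    have "\<forall>\<^sub>F s in at_left (1::real). s \<in> {0<..<1}" by (rule eventually_at_left_real) simp
    then show "\<forall>\<^sub>F s in at_left 1. (\<Sum>k<m. p n k * s ^ k) \<le> 1"
    proof eventually_elim
      case (elim s)
      then have s: "0 < s" "s < 1" by auto
      have "(\<Sum>k<m. p n k * s ^ k) \<le> (\<Sum>k. p n k * s ^ k)"
        using p_nonneg s by (intro sum_le_suminf sums_summable[OF p_sums[OF s]]) auto
      also have "\<dots> = f (real (Suc n) * (1 - s)) / f 0" using sums_unique[OF p_sums[OF s]] by simp
      also have "\<dots> \<le> 1" using f_le[of "real (Suc n) * (1 - s)"] s f0 by simp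
      finally show ?case .
    qed
  qed simp
  have p_summable: "summable (p n)" for n
    by (rule summableI_nonneg_bounded[OF p_nonneg p_part])
  \<comment> \<open>No mass is lost: the sum dominates \<open>f y / f 0\<close> for small
    \<open>y > 0\<close>, and right-continuity at 0 makes this quotient tend to 1.\<close>
  have p_sum: "(\<Sum>k. p n k) = 1" for n
  proof (rule antisym)
    show "(\<Sum>k. p n k) \<le> 1" by (rule suminf_le_const[OF p_summable p_part])
    show "1 \<le> (\<Sum>k. p n k)"
    proof (rule tendsto_upperbound)
      show "((\<lambda>y. f y / f 0) \<longlongrightarrow> 1) (at_right 0)"
        using tendsto_divide[OF cont tendsto_const[of "f 0"]] f0 by simp
      have "\<forall>\<^sub>F y in at_right (0::real). y \<in> {0<..<1}" by (rule eventually_at_right_real) simp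
      then show "\<forall>\<^sub>F y in at_right 0. f y / f 0 \<le> (\<Sum>k. p n k)"
      proof eventually_elim
        case (elim y)
        define s where "s = 1 - y / real (Suc n)"
        have y: "0 < y" "y < real (Suc n)" using elim by auto
        have s: "0 < s" "s < 1" using y by (auto simp: s_def field_simps)
        have "real (Suc n) * (1 - s) = y" by (simp add: s_def)
        then have "f y / f 0 = (\<Sum>k. p n k * s ^ k)" using sums_unique[OF p_sums[OF s, of n]] by simp
        also have "\<dots> \<le> (\<Sum>k. p n k)"
          using p_nonneg s by (intro suminf_le p_summable sums_summable[OF p_sums[OF s]])
            (auto intro!: mult_left_le power_le_one)
        finally show ?case .
      qed
    qed simp
  qed
  define P where "P n = embed_pmf (p n)" for n
  have pmf_P: "pmf (P n) k = p n k" for n k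
    unfolding P_def
  proof (rule pmf_embed_pmf[OF p_nonneg])
    have "(\<integral>\<^sup>+k. ennreal (p n k) \<partial>count_space UNIV) = (\<Sum>k. ennreal (p n k))"
      by (rule nn_integral_count_space_nat)
    also have "\<dots> = ennreal (\<Sum>k. p n k)" by (rule suminf_ennreal2[OF p_nonneg p_summable])
    finally show "(\<integral>\<^sup>+k. ennreal (p n k) \<partial>count_space UNIV) = 1" by (simp add: p_sum)
  qed
  define \<mu> where "\<mu> n = distr (measure_pmf (P n)) borel (\<lambda>k. real k / real (Suc n))" for n
  have \<mu>: "real_distribution (\<mu> n)" for n
    unfolding \<mu>_def by (rule prob_space.real_distribution_distr) (auto intro: measure_pmf.prob_space_axioms)
  have supp: "AE u in \<mu> n. u \<ge> 0" for n
    unfolding \<mu>_def by (subst AE_distr_iff) auto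
  have lap: "(LINT u|\<mu> n. exp (- t * max u 0)) = f (real (Suc n) * (1 - exp (- t / real (Suc n)))) / f 0"
    if t: "t > 0" for n t
  proof -
    define s where "s = exp (- t / real (Suc n))"
    have s: "0 < s" "s < 1" using t by (auto simp: s_def)
    have sk: "exp (- t * max (real k / real (Suc n)) 0) = s ^ k" for k
    proof -
      have "max (real k / real (Suc n)) 0 = real k / real (Suc n)" by (intro max_absorb1) simp
      then show ?thesis unfolding s_def by (simp add: exp_of_nat_mult[symmetric])
    qed
    have "(LINT u|\<mu> n. exp (- t * max u 0)) = (LINT k|measure_pmf (P n). exp (- t * max (real k / real (Suc n)) 0))"
      unfolding \<mu>_def by (rule integral_distr) auto
    also have "\<dots> = (LINT k|measure_pmf (P n). s ^ k)" by (simp only: sk)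
    also have "\<dots> = enn2real (\<integral>\<^sup>+k. ennreal (s ^ k) \<partial>measure_pmf (P n))"
      using s by (intro integral_eq_nn_integral) auto
    also have "(\<integral>\<^sup>+k. ennreal (s ^ k) \<partial>measure_pmf (P n)) = (\<integral>\<^sup>+k. ennreal (p n k) * ennreal (s ^ k) \<partial>count_space UNIV)"
      by (simp add: nn_integral_measure_pmf pmf_P)
    also have "\<dots> = (\<Sum>k. ennreal (p n k * s ^ k))"
      using p_nonneg s by (simp add: nn_integral_count_space_nat ennreal_mult')
    also have "\<dots> = ennreal (\<Sum>k. p n k * s ^ k)"
      using p_nonneg s sums_summable[OF p_sums[OF s]] by (intro suminf_ennreal2) auto
    also have "(\<Sum>k. p n k * s ^ k) = f (real (Suc n) * (1 - s)) / f 0"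
      using sums_unique[OF p_sums[OF s]] by simp
    also have "enn2real (ennreal \<dots>) = f (real (Suc n) * (1 - s)) / f 0"
      using completely_monotone_open_nonneg[OF cm, of "real (Suc n) * (1 - s)"] f0 s by simp
    finally show ?thesis unfolding s_def .
  qed
  have "tight \<mu>"
  proof (rule tight_if_laplace_bound[OF \<mu> supp])
    show "((\<lambda>t. f t / f 0) \<longlongrightarrow> 1) (at_right 0)"
      using tendsto_divide[OF cont tendsto_const[of "f 0"]] f0 by simp
    fix n and t :: real assume t: "t > 0"
    \<comment> \<open>The evaluation point \<open>Suc n * (1 - exp (- t / Suc n))\<close> never
      exceeds \<open>t\<close>, so all the Laplace transforms at \<open>t\<close> lie above
      \<open>f t / f 0\<close>. This is the uniform bound behind tightness.\<close>
    have "1 + (- t / real (Suc n)) \<le> exp (- t / real (Suc n))" by (rule exp_ge_add_one_self)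
    then have "real (Suc n) * (1 - exp (- t / real (Suc n))) \<le> t" by (simp add: field_simps)
    moreover have "0 < real (Suc n) * (1 - exp (- t / real (Suc n)))" using t by simp
    ultimately have "f t \<le> f (real (Suc n) * (1 - exp (- t / real (Suc n))))"
      by (intro completely_monotone_open_antimono[OF cm])
    then show "f t / f 0 \<le> (LINT u|\<mu> n. exp (- t * max u 0))"
      unfolding lap[OF t] using f0 by (intro divide_right_mono) auto
  qed
  from tight_imp_convergent_subsubsequence[OF this strict_mono_id]
  obtain r M where r: "strict_mono r" and M: "real_distribution M" and conv: "weak_conv_m (\<mu> \<circ> id \<circ> r) M"
    by blast
  have main: "f t = f 0 * (LINT u|M. exp (- t * max u 0))" if "t > 0" for t
  proof -
    have "(\<lambda>n. LINT u|(\<mu> \<circ> id \<circ> r) n. exp (- t * max u 0)) \<longlonglongrightarrow> (LINT u|M. exp (- t * max u 0))"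
    proof (rule weak_conv_imp_integral_bdd_continuous_conv[OF _ M conv, of _ 1])
      show "real_distribution ((\<mu> \<circ> id \<circ> r) n)" for n by (simp add: \<mu>)
      show "isCont (\<lambda>u. exp (- t * max u 0)) u" for u by (intro continuous_intros)
      show "norm (exp (- t * max u 0)) \<le> 1" for u using that by simp
    qed
    then have l1: "(\<lambda>n. f (real (Suc (r n)) * (1 - exp (- t / real (Suc (r n))))) / f 0) \<longlonglongrightarrow> (LINT u|M. exp (- t * max u 0))"
      using lap[OF that] by simp
    have "(\<lambda>n. real n * (1 - exp (- t / real n))) \<longlonglongrightarrow> t" by real_asymp
    then have "(\<lambda>n. real (Suc n) * (1 - exp (- t / real (Suc n)))) \<longlonglongrightarrow> t"
      by (rule LIMSEQ_Suc)
    from LIMSEQ_subseq_LIMSEQ[OF this r]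
    have "(\<lambda>n. real (Suc (r n)) * (1 - exp (- t / real (Suc (r n))))) \<longlonglongrightarrow> t" by (simp add: comp_def)
    moreover have "isCont f t" using completely_monotone_open_has_deriv[OF cm that] by (rule DERIV_isCont)
    ultimately have "(\<lambda>n. f (real (Suc (r n)) * (1 - exp (- t / real (Suc (r n)))))) \<longlonglongrightarrow> f t"
      by (rule isCont_tendsto_compose[rotated])
    then have "(\<lambda>n. f (real (Suc (r n)) * (1 - exp (- t / real (Suc (r n))))) / f 0) \<longlonglongrightarrow> f t / f 0"
      using f0 by (intro tendsto_divide tendsto_const) auto
    from LIMSEQ_unique[OF this l1] show ?thesis using f0 by (simp add: field_simps)
  qed
  show ?thesis
  proof (rule that[OF M])
    fix t :: real assume "t \<ge> 0"
    interpret real_distribution M by (rule M)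
    show "f t = f 0 * (LINT u|M. exp (- t * max u 0))"
      using main[of t] \<open>t \<ge> 0\<close> prob_space by (cases "t = 0") auto
  qed
qed

subsection \<open>Representation of the norm as a Gaussian mixture\<close>

text \<open>The laws for \<open>v\<close> and \<open>- v\<close> coincide, and |t + v x| + |t - v x|
  \<ge> 2 |t|.\<close>

lemma gauss_abs_ge: "\<bar>t\<bar> \<le> gauss_abs t v"
proof -
  interpret real_distribution std_normal_distribution by (rule real_dist_normal_dist)
  have "2 * \<bar>t\<bar> = (LINT x|std_normal_distribution. 2 * \<bar>t\<bar>)" using prob_space by simp
  also have "\<dots> \<le> (LINT x|std_normal_distribution. \<bar>t + v * x\<bar> + \<bar>t + (- v) * x\<bar>)"
    by (intro integral_mono Bochner_Integration.integrable_add integrable_abs_affine_std_normal) auto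
  also have "\<dots> = gauss_abs t v + gauss_abs t (- v)"
    unfolding gauss_abs_def by (intro Bochner_Integration.integral_add integrable_abs_affine_std_normal)
  finally show ?thesis by (simp add: gauss_abs_minus)
qed

lemma gauss_abs_le: "gauss_abs t v \<le> \<bar>t\<bar> + gauss_abs 0 v"
proof -
  interpret real_distribution std_normal_distribution by (rule real_dist_normal_dist)
  have "gauss_abs t v \<le> (LINT x|std_normal_distribution. \<bar>t\<bar> + \<bar>0 + v * x\<bar>)"
    unfolding gauss_abs_def
    by (intro integral_mono Bochner_Integration.integrable_add integrable_abs_affine_std_normal) auto
  also have "\<dots> = \<bar>t\<bar> + gauss_abs 0 v"
    unfolding gauss_abs_def
    using prob_space by (subst Bochner_Integration.integral_add) (use integrable_abs_affine_std_normal[of 0 v] in auto)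
  finally show ?thesis .
qed

lemma borel_measurable_gauss_abs [measurable]:
  assumes [measurable]: "f \<in> borel_measurable M" "g \<in> borel_measurable M"
  shows "(\<lambda>x. gauss_abs (f x) (g x)) \<in> borel_measurable M"
proof -
  interpret real_distribution std_normal_distribution by (rule real_dist_normal_dist)
  show ?thesis unfolding gauss_abs_def by measurable
qed

text \<open>A convex function asymptotic to the diagonal has tangents approaching the diagonal.
  Since \<open>f'\<close> increases, \<open>x * f' x\<close> lies between 2 (f(x) - f(x/2)) and
  f(2x) - f(x); after subtracting f(x) the linear parts of both bounds cancel. Division by
  \<open>x\<close> then gives the slope.\<close>

lemma convex_asymptotics:
  fixes f f' f'' :: "real \<Rightarrow> real"
  assumes d1: "\<And>x. (f has_real_derivative f' x) (at x)"
    and d2: "\<And>x. (f' has_real_derivative f'' x) (at x)"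
    and nonneg: "\<And>x. f'' x \<ge> 0" and lim: "((\<lambda>t. f t - t) \<longlongrightarrow> 0) at_top"
  shows "((\<lambda>x. x * f' x - f x) \<longlongrightarrow> 0) at_top" and "(f' \<longlongrightarrow> 1) at_top"
proof -
  have mono: "f' x \<le> f' y" if "x \<le> y" for x y
    by (rule DERIV_nonneg_imp_nondecreasing[OF that]) (meson d2 nonneg)
  have half: "filterlim (\<lambda>x::real. x / 2) at_top at_top" and dbl: "filterlim (\<lambda>x::real. 2 * x) at_top at_top"
    by real_asymp+
  note l2 = filterlim_compose[OF lim dbl] and l3 = filterlim_compose[OF lim half]
  show main: "((\<lambda>x. x * f' x - f x) \<longlongrightarrow> 0) at_top"
  proof (rule tendsto_sandwich)
    have "((\<lambda>x. (f x - x) - 2 * (f (x/2) - x/2)) \<longlongrightarrow> 0 - 2 * 0) at_top"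
      by (intro tendsto_diff[OF lim] tendsto_mult tendsto_const l3)
    then show "((\<lambda>x. (f x - x) - 2 * (f (x/2) - x/2)) \<longlongrightarrow> 0) at_top"
      by (simp only: mult_zero_right diff_zero)
    have "((\<lambda>x. (f (2 * x) - 2 * x) - 2 * (f x - x)) \<longlongrightarrow> 0 - 2 * 0) at_top"
      by (intro tendsto_diff[OF l2] tendsto_mult tendsto_const lim)
    then show "((\<lambda>x. (f (2 * x) - 2 * x) - 2 * (f x - x)) \<longlongrightarrow> 0) at_top"
      by (simp only: mult_zero_right diff_zero)
    show "\<forall>\<^sub>F x in at_top. (f x - x) - 2 * (f (x/2) - x/2) \<le> x * f' x - f x"
      using eventually_gt_at_top[of 0]
    proof eventually_elim
      case (elim x)
      have "\<exists>z>x/2. z < x \<and> f x - f (x/2) = (x - x/2) * f' z"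
        by (rule MVT2) (use elim d1 in auto)
      then obtain z where z: "x/2 < z" "z < x" "f x - f (x/2) = x/2 * f' z" by auto
      have "x * f' z \<le> x * f' x" using z elim by (intro mult_left_mono mono) auto
      moreover have "2 * (f x - f (x/2)) = x * f' z" using z(3) by simp
      ultimately have "2 * (f x - f (x/2)) \<le> x * f' x" by (simp only:)
      then show ?case by (simp add: right_diff_distrib)
    qed
    show "\<forall>\<^sub>F x in at_top. x * f' x - f x \<le> (f (2 * x) - 2 * x) - 2 * (f x - x)"
      using eventually_gt_at_top[of 0]
    proof eventually_elim
      case (elim x)
      have "\<exists>z>x. z < 2*x \<and> f (2*x) - f x = (2*x - x) * f' z"
        by (rule MVT2) (use elim d1 in auto)
      then obtain z where z: "x < z" "z < 2*x" "f (2*x) - f x = x * f' z" by auto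
      have "x * f' x \<le> x * f' z" using z elim by (intro mult_left_mono mono) auto
      then have "f (2*x) - f x \<ge> x * f' x" using z(3) by (simp only:)
      then show ?case by (simp add: right_diff_distrib)
    qed
  qed
  have inv: "((\<lambda>x::real. inverse x) \<longlongrightarrow> 0) at_top" by (rule tendsto_inverse_0_at_top) (rule filterlim_ident)
  have "((\<lambda>x. (x * f' x - f x) * inverse x + (f x - x) * inverse x + 1) \<longlongrightarrow> 0 * 0 + 0 * 0 + 1) at_top"
    by (intro tendsto_add tendsto_mult tendsto_const main lim inv)
  then have l: "((\<lambda>x. (x * f' x - f x) * inverse x + (f x - x) * inverse x + 1) \<longlongrightarrow> 1) at_top"
    by (simp only: mult_zero_right add_0)
  show "(f' \<longlongrightarrow> 1) at_top"
  proof (rule Lim_transform_eventually[OF l])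
    show "\<forall>\<^sub>F x in at_top. (x * f' x - f x) * inverse x + (f x - x) * inverse x + 1 = f' x"
      using eventually_gt_at_top[of 0] by eventually_elim (simp add: field_simps)
  qed
qed

text \<open>Smoothness at \<open>e\<^sub>2\<close> enters here. By sign symmetry \<open>g\<close> is
  even, so its derivative at 0 vanishes, and by homogeneity
  \<open>N (e\<^sub>1 + t *\<^sub>R e\<^sub>2) - t\<close> is the difference quotient of
  \<open>g\<close> at 0 with step \<open>1 / t\<close>.\<close>

lemma smooth_norm_asymptotics:
  fixes N :: "'a::real_normed_vector \<Rightarrow> real"
  assumes N: "is_norm N" and sym: "sign_symmetric N e\<^sub>1 e\<^sub>2" and one: "N e\<^sub>2 = 1"
    and diff: "N differentiable (at e\<^sub>2)"
  shows "((\<lambda>t. N (e\<^sub>1 + t *\<^sub>R e\<^sub>2) - t) \<longlongrightarrow> 0) at_top"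
proof -
  have Nsc: "N (c *\<^sub>R x) = \<bar>c\<bar> * N x" for c x using N unfolding is_norm_def by auto
  define g where "g s = N (e\<^sub>2 + s *\<^sub>R e\<^sub>1)" for s
  have even: "g (- s) = g s" for s
  proof -
    have "N (- s *\<^sub>R e\<^sub>1 + 1 *\<^sub>R e\<^sub>2) = N (s *\<^sub>R e\<^sub>1 + 1 *\<^sub>R e\<^sub>2)"
      using sym unfolding sign_symmetric_def by blast
    then show ?thesis by (simp add: g_def add.commute)
  qed
  obtain D where D: "(N has_derivative D) (at e\<^sub>2)" using diff unfolding differentiable_def by blast
  have "((\<lambda>s. e\<^sub>2 + s *\<^sub>R e\<^sub>1) has_derivative (\<lambda>s. s *\<^sub>R e\<^sub>1)) (at 0)"
    by (auto intro!: derivative_eq_intros)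
  moreover have "(N has_derivative D) (at (e\<^sub>2 + 0 *\<^sub>R e\<^sub>1))" using D by simp
  ultimately have "(g has_derivative (\<lambda>s. D (s *\<^sub>R e\<^sub>1))) (at 0)"
    unfolding g_def by (rule has_derivative_compose)
  then have "g differentiable (at 0)" unfolding differentiable_def by blast
  then obtain d where d: "(g has_real_derivative d) (at 0)" by (auto simp: real_differentiable_def)
  have "((\<lambda>s. g (- s)) has_real_derivative d * (- 1)) (at 0)"
    by (rule DERIV_chain2[where g=uminus]) (use d in \<open>auto intro!: derivative_eq_intros\<close>)
  then have "(g has_real_derivative - d) (at 0)" by (simp add: even)
  with d have "d = - d" by (rule DERIV_unique)
  then have "d = 0" by simp
  have "g 0 = 1" by (simp add: g_def one)
  then have "((\<lambda>s. (g s - 1) / s) \<longlongrightarrow> 0) (at 0)"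
    using d \<open>d = 0\<close> by (simp add: has_field_derivative_iff)
  then have "((\<lambda>s. (g s - 1) / s) \<longlongrightarrow> 0) (at_right 0)" by (rule filterlim_mono) (auto simp: at_within_le_at)
  from filterlim_compose[OF this filterlim_inverse_at_right_top]
  have l: "((\<lambda>t. (g (inverse t) - 1) / inverse t) \<longlongrightarrow> 0) at_top" .
  show ?thesis
  proof (rule Lim_transform_eventually[OF l])
    show "\<forall>\<^sub>F t in at_top. (g (inverse t) - 1) / inverse t = N (e\<^sub>1 + t *\<^sub>R e\<^sub>2) - t"
      using eventually_gt_at_top[of 0]
    proof eventually_elim
      case (elim t)
      have "e\<^sub>1 + t *\<^sub>R e\<^sub>2 = t *\<^sub>R (e\<^sub>2 + inverse t *\<^sub>R e\<^sub>1)" using elim by (simp add: algebra_simps)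
      then have "N (e\<^sub>1 + t *\<^sub>R e\<^sub>2) = t * g (inverse t)" using elim by (simp add: Nsc g_def)
      then show ?case using elim by (simp add: field_simps)
    qed
  qed
qed

text \<open>This excludes mass of the mixing measure at \<open>u \<le> 0\<close>, where the weight
  \<open>exp (- s\<^sup>2 * max u 0)\<close> degenerates to the constant 1.\<close>

lemma nn_integral_abs_infinite: "(\<integral>\<^sup>+s. ennreal \<bar>s\<bar> \<partial>lborel) = \<infinity>"
proof -
  have "\<infinity> = (\<integral>\<^sup>+s. 1 \<partial>(lborel::real measure))" by simp
  also have "\<dots> \<le> (\<integral>\<^sup>+s. ennreal \<bar>s\<bar> + indicator {-1..1} s \<partial>lborel)"
    by (rule nn_integral_mono) (auto simp: indicator_def)
  also have "\<dots> = (\<integral>\<^sup>+s. ennreal \<bar>s\<bar> \<partial>lborel) + emeasure lborel {-1..1::real}"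
    by (subst nn_integral_add) auto
  finally show ?thesis by (simp add: top_unique)
qed

lemma cm_curvature_gaussian_mixture:
  fixes nrm :: "real \<Rightarrow> real \<Rightarrow> real" and \<phi>' \<phi>'' :: "real \<Rightarrow> real"
  defines "\<phi> \<equiv> nrm 1"
  assumes d1: "\<And>x. (\<phi> has_real_derivative \<phi>' x) (at x)"
    and d2: "\<And>x. (\<phi>' has_real_derivative \<phi>'' x) (at x)"
    and cont: "continuous_on UNIV \<phi>''"
    and even: "\<And>x. \<phi> (- x) = \<phi> x" and asym: "((\<lambda>t. \<phi> t - t) \<longlongrightarrow> 0) at_top"
    and hom: "\<And>c r t. c \<ge> 0 \<Longrightarrow> nrm (c * r) (c * t) = c * nrm r t"
    and lip: "\<And>r r' t. \<bar>nrm r t - nrm r' t\<bar> \<le> \<bar>r - r'\<bar>"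
    and nrm10: "nrm 1 0 = 1" and nrm01: "\<And>t. nrm 0 t = \<bar>t\<bar>" and nrm_nonneg: "\<And>r t. nrm r t \<ge> 0"
    and cm: "completely_monotone_open (\<lambda>t. \<phi>'' (sqrt t))"
  obtains \<mu> W V where "real_distribution \<mu>" "W \<in> borel_measurable borel" "V \<in> borel_measurable borel"
    "\<And>u. W u \<ge> 0" "\<And>u. V u \<ge> 0"
    "\<And>r t. r \<ge> 0 \<Longrightarrow> (\<integral>\<^sup>+u. ennreal (W u * gauss_abs t (r * V u)) \<partial>\<mu>) = ennreal (nrm r t)"
proof -
  have odd': "\<phi>' (- x) = - \<phi>' x" for x
  proof -
    have "((\<lambda>s. \<phi> (- s)) has_real_derivative \<phi>' (- x) * (- 1)) (at x)"
      by (rule DERIV_chain2[where g=uminus, OF d1]) (auto intro!: derivative_eq_intros)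
    then have "(\<phi> has_real_derivative - \<phi>' (- x)) (at x)" by (simp add: even)
    from DERIV_unique[OF this d1[of x]] show ?thesis by simp
  qed
  have even'': "\<phi>'' (- x) = \<phi>'' x" for x
  proof -
    have "((\<lambda>s. \<phi>' (- s)) has_real_derivative \<phi>'' (- x) * (- 1)) (at x)"
      by (rule DERIV_chain2[where g=uminus, OF d2]) (auto intro!: derivative_eq_intros)
    then have "((\<lambda>s. - \<phi>' s) has_real_derivative - \<phi>'' (- x)) (at x)" by (simp add: odd')
    from DERIV_unique[OF DERIV_minus[OF this] , of "\<phi>'' x"] d2[of x] show ?thesis by simp
  qed
  define f where "f t = \<phi>'' (sqrt t)" for t
  have cmf: "completely_monotone_open f" using cm unfolding f_def .
  \<comment> \<open>\<open>sqrt (s\<^sup>2)\<close> is |s|, and evenness of \<phi>'' covers negative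
    \<open>s\<close>.\<close>
  have ff: "f (s\<^sup>2) = \<phi>'' s" for s using even''[of s] by (cases "s \<ge> 0") (auto simp: f_def)
  have contf: "(f \<longlongrightarrow> f 0) (at_right 0)"
  proof -
    have "continuous_on UNIV f" unfolding f_def
      by (rule continuous_on_compose2[OF cont]) (auto intro!: continuous_intros)
    then have "(f \<longlongrightarrow> f 0) (at 0)" by (simp add: continuous_on_def)
    then show ?thesis by (rule filterlim_mono) (auto simp: at_within_le_at)
  qed
  have f_le: "f y \<le> f 0" if "y > 0" for y
    using completely_monotone_open_le_limit[OF cmf contf that] .
  have f_nonneg: "f y \<ge> 0" if "y \<ge> 0" for y
    using completely_monotone_open_nonneg[OF cmf, of y] completely_monotone_open_nonneg[OF cmf, of 1] f_le[of 1] that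
    by (cases "y = 0") auto
  have nonneg: "\<phi>'' s \<ge> 0" for s using f_nonneg[of "s\<^sup>2"] ff[of s] by simp
  have [measurable]: "\<phi>'' \<in> borel_measurable borel" using cont by (rule borel_measurable_continuous_onI)
  have kernel: "(\<integral>\<^sup>+s. ennreal (\<bar>t - s\<bar> * \<phi>'' s) \<partial>lborel) = ennreal (2 * \<phi> t)" for t
    by (rule nn_integral_abs_diff_second_deriv[OF d1 d2 _ nonneg even even''])
      (use convex_asymptotics[OF d1 d2 nonneg asym] in auto)
  define c where "c = f 0"
  \<comment> \<open>Otherwise \<phi>'' would vanish everywhere, and the kernel identity at 0 would
    contradict \<phi>(0) = 1.\<close>
  have c: "c > 0"
  proof (rule ccontr)
    assume "\<not> c > 0"
    then have "f (s\<^sup>2) = 0" for s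
      using f_nonneg[of "s\<^sup>2"] f_le[of "s\<^sup>2"] f_nonneg[of 0] by (cases "s = 0") (auto simp: c_def)
    then have "\<phi>'' s = 0" for s by (simp add: ff)
    then have "ennreal (2 * \<phi> 0) = 0" using kernel[of 0] by simp
    then show False using nrm10 by (simp add: \<phi>_def)
  qed
  obtain \<mu> where \<mu>: "real_distribution \<mu>"
    and lap: "\<And>t. t \<ge> 0 \<Longrightarrow> f t = f 0 * (LINT u|\<mu>. exp (- t * max u 0))"
    by (rule bernstein[OF cmf contf c[unfolded c_def]], rule that)
  interpret real_distribution \<mu> by (rule \<mu>)
  interpret L: pair_sigma_finite lborel \<mu> ..
  have repr: "ennreal (\<phi>'' s) = (\<integral>\<^sup>+u. ennreal (c * exp (- s\<^sup>2 * max u 0)) \<partial>\<mu>)" for s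
  proof -
    have "\<phi>'' s = (LINT u|\<mu>. c * exp (- s\<^sup>2 * max u 0))"
      using lap[of "s\<^sup>2"] by (simp add: ff c_def)
    also have "ennreal \<dots> = (\<integral>\<^sup>+u. ennreal (c * exp (- s\<^sup>2 * max u 0)) \<partial>\<mu>)"
      using c integrable_exp_minus_max[OF \<mu>, of "s\<^sup>2"]
      by (intro nn_integral_eq_integral[symmetric] integrable_mult_right) auto
    finally show ?thesis .
  qed
  have tonelli: "(\<integral>\<^sup>+u. (\<integral>\<^sup>+s. ennreal (c * (\<bar>t - s\<bar> * exp (- s\<^sup>2 * max u 0))) \<partial>lborel) \<partial>\<mu>) = ennreal (2 * \<phi> t)" for t
  proof -
    have "(\<integral>\<^sup>+u. (\<integral>\<^sup>+s. ennreal (c * (\<bar>t - s\<bar> * exp (- s\<^sup>2 * max u 0))) \<partial>lborel) \<partial>\<mu>) =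
      (\<integral>\<^sup>+s. (\<integral>\<^sup>+u. ennreal (c * (\<bar>t - s\<bar> * exp (- s\<^sup>2 * max u 0))) \<partial>\<mu>) \<partial>lborel)"
      by (rule L.Fubini') measurable
    also have "\<dots> = (\<integral>\<^sup>+s. ennreal (\<bar>t - s\<bar> * \<phi>'' s) \<partial>lborel)"
    proof (rule nn_integral_cong)
      fix s :: real
      have "(\<integral>\<^sup>+u. ennreal (c * (\<bar>t - s\<bar> * exp (- s\<^sup>2 * max u 0))) \<partial>\<mu>) =
        (\<integral>\<^sup>+u. ennreal \<bar>t - s\<bar> * ennreal (c * exp (- s\<^sup>2 * max u 0)) \<partial>\<mu>)"
        using c by (intro nn_integral_cong) (simp add: ennreal_mult'[symmetric] mult_ac)
      also have "\<dots> = ennreal \<bar>t - s\<bar> * ennreal (\<phi>'' s)"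
        unfolding repr by (rule nn_integral_cmult) measurable
      finally show "(\<integral>\<^sup>+u. ennreal (c * (\<bar>t - s\<bar> * exp (- s\<^sup>2 * max u 0))) \<partial>\<mu>) = ennreal (\<bar>t - s\<bar> * \<phi>'' s)"
        by (simp add: ennreal_mult')
    qed
    finally show ?thesis unfolding kernel .
  qed
  \<comment> \<open>The double integral at \<open>t = 0\<close> is finite, whereas each
    \<open>u \<le> 0\<close> makes the inner integral a positive multiple of the integral of
    |s|.\<close>
  have pos: "AE u in \<mu>. u > 0"
  proof -
    have "(\<integral>\<^sup>+u. (\<integral>\<^sup>+s. ennreal (c * (\<bar>0 - s\<bar> * exp (- s\<^sup>2 * max u 0))) \<partial>lborel) \<partial>\<mu>) \<noteq> \<infinity>"
      unfolding tonelli by simp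
    then have "AE u in \<mu>. (\<integral>\<^sup>+s. ennreal (c * (\<bar>0 - s\<bar> * exp (- s\<^sup>2 * max u 0))) \<partial>lborel) \<noteq> \<infinity>"
      by (intro nn_integral_PInf_AE) measurable
    then show ?thesis
    proof eventually_elim
      case (elim u)
      show "u > 0"
      proof (rule ccontr)
        assume "\<not> u > 0"
        then have "max u 0 = 0" by simp
        then have "(\<integral>\<^sup>+s. ennreal (c * (\<bar>0 - s\<bar> * exp (- s\<^sup>2 * max u 0))) \<partial>lborel) = ennreal c * (\<integral>\<^sup>+s. ennreal \<bar>s\<bar> \<partial>lborel)"
          using c by (subst nn_integral_cmult[symmetric]) (auto simp: ennreal_mult')
        then show False using elim c by (simp add: nn_integral_abs_infinite ennreal_mult_top)
      qed
    qed
  qed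
  \<comment> \<open>Read off from \<open>nn_integral_abs_diff_exp_square\<close>: the deviation is
    \<open>1 / sqrt (2 * u)\<close>, and the amplitude is half of \<open>c * sqrt (pi / u)\<close>
    because the kernel identity produces 2 \<phi>. The value 0 at \<open>u \<le> 0\<close> concerns
    a null set.\<close>
  define W where "W u = (if u > 0 then c / 2 * sqrt (pi / u) else 0)" for u
  define V where "V u = (if u > 0 then 1 / sqrt (2 * u) else 0)" for u :: real
  have WV: "W \<in> borel_measurable borel" "V \<in> borel_measurable borel" "\<And>u. W u \<ge> 0" "\<And>u. V u \<ge> 0"
    unfolding W_def V_def using c by auto
  note [measurable] = WV(1,2)
  have base: "(\<integral>\<^sup>+u. ennreal (W u * gauss_abs t (V u)) \<partial>\<mu>) = ennreal (\<phi> t)" for t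
  proof -
    have "2 * (\<integral>\<^sup>+u. ennreal (W u * gauss_abs t (V u)) \<partial>\<mu>) = (\<integral>\<^sup>+u. 2 * ennreal (W u * gauss_abs t (V u)) \<partial>\<mu>)"
      by (rule nn_integral_cmult[symmetric]) measurable
    also have "\<dots> = (\<integral>\<^sup>+u. (\<integral>\<^sup>+s. ennreal (c * (\<bar>t - s\<bar> * exp (- s\<^sup>2 * max u 0))) \<partial>lborel) \<partial>\<mu>)"
    proof (rule nn_integral_cong_AE, use pos in eventually_elim)
      case (elim u)
      have "(\<integral>\<^sup>+s. ennreal (c * (\<bar>t - s\<bar> * exp (- s\<^sup>2 * max u 0))) \<partial>lborel) = ennreal c * (\<integral>\<^sup>+s. ennreal (\<bar>t - s\<bar> * exp (- s\<^sup>2 * u)) \<partial>lborel)"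
        using c elim by (subst nn_integral_cmult[symmetric]) (auto simp: ennreal_mult')
      also have "\<dots> = ennreal (c * (sqrt (pi / u) * gauss_abs t (1 / sqrt (2 * u))))"
        unfolding nn_integral_abs_diff_exp_square[OF elim] using c by (simp add: ennreal_mult')
      also have "c * (sqrt (pi / u) * gauss_abs t (1 / sqrt (2 * u))) = 2 * (W u * gauss_abs t (V u))"
        using elim by (simp add: W_def V_def)
      also have "ennreal \<dots> = 2 * ennreal (W u * gauss_abs t (V u))" by (simp add: ennreal_mult')
      finally show ?case by simp
    qed
    also have "\<dots> = 2 * ennreal (\<phi> t)" unfolding tonelli by (simp add: ennreal_mult')
    finally show ?thesis by (simp add: ennreal_mult_cancel_left)
  qed
  have scaled: "(\<integral>\<^sup>+u. ennreal (W u * gauss_abs t (r * V u)) \<partial>\<mu>) = ennreal (nrm r t)" if r: "r > 0" for r t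
  proof -
    have "(\<integral>\<^sup>+u. ennreal (W u * gauss_abs t (r * V u)) \<partial>\<mu>) = (\<integral>\<^sup>+u. ennreal r * ennreal (W u * gauss_abs (t / r) (V u)) \<partial>\<mu>)"
    proof (rule nn_integral_cong)
      fix u
      have "gauss_abs t (r * V u) = r * gauss_abs (t / r) (V u)"
        using gauss_abs_scale[of r "t / r" "V u"] r by simp
      then show "ennreal (W u * gauss_abs t (r * V u)) = ennreal r * ennreal (W u * gauss_abs (t / r) (V u))"
        using r by (simp add: ennreal_mult'[symmetric] mult_ac)
    qed
    also have "\<dots> = ennreal r * ennreal (\<phi> (t / r))"
      unfolding base[symmetric] by (rule nn_integral_cmult) measurable
    also have "\<dots> = ennreal (nrm r t)"
      using hom[of r 1 "t / r"] r by (simp add: ennreal_mult'[symmetric] \<phi>_def)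
    finally show ?thesis .
  qed
  \<comment> \<open>Homogeneity cannot reach \<open>r = 0\<close>, where the claim amounts to
    \<open>W\<close> having total mass 1. As \<open>r\<close> decreases to 0, \<open>nrm r 1\<close>
    tends to 1, while \<open>gauss_abs 1 (r * V u)\<close> lies between 1 and
    \<open>1 + r * gauss_abs 0 (V u)\<close>, and \<open>W u * gauss_abs 0 (V u)\<close> has
    integral \<phi>(0) = 1.\<close>
  have W1: "(\<integral>\<^sup>+u. ennreal (W u) \<partial>\<mu>) = 1"
  proof -
    have up: "(\<integral>\<^sup>+u. ennreal (W u) \<partial>\<mu>) \<le> ennreal (1 + r)" if "r > 0" for r
    proof -
      have "(\<integral>\<^sup>+u. ennreal (W u) \<partial>\<mu>) \<le> (\<integral>\<^sup>+u. ennreal (W u * gauss_abs 1 (r * V u)) \<partial>\<mu>)"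
      proof (intro nn_integral_mono ennreal_leI)
        fix u show "W u \<le> W u * gauss_abs 1 (r * V u)"
          using gauss_abs_ge[of 1 "r * V u"] mult_left_mono[OF _ WV(3)[of u], of 1] by simp
      qed
      also have "\<dots> = ennreal (nrm r 1)" by (rule scaled[OF that])
      also have "\<dots> \<le> ennreal (1 + r)" using lip[of r 1 0] nrm01[of 1] that by (intro ennreal_leI) simp
      finally show ?thesis .
    qed
    have fin: "(\<integral>\<^sup>+u. ennreal (W u) \<partial>\<mu>) < \<infinity>" using up[of 1] by (rule le_less_trans) simp_all
    define w where "w = enn2real (\<integral>\<^sup>+u. ennreal (W u) \<partial>\<mu>)"
    have w: "(\<integral>\<^sup>+u. ennreal (W u) \<partial>\<mu>) = ennreal w" "w \<ge> 0" using fin by (simp_all add: w_def)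
    have "w \<le> 1 + r" if "r > 0" for r using up[OF that] that unfolding w by (subst (asm) ennreal_le_iff) auto
    then have "w \<le> 1" by (rule field_le_epsilon)
    moreover have "1 \<le> w + r" if "r > 0" for r
    proof -
      \<comment> \<open>Half of \<open>r\<close> is spent on the Lipschitz estimate of
        \<open>nrm\<close> and half on the upper bound for \<open>gauss_abs\<close>.\<close>
      have r2: "r / 2 > 0" using that by simp
      have "ennreal (1 - r/2) \<le> ennreal (nrm (r/2) 1)" using lip[of "r/2" 1 0] nrm01[of 1] that by (intro ennreal_leI) (simp add: abs_if split: if_splits)
      also have "\<dots> = (\<integral>\<^sup>+u. ennreal (W u * gauss_abs 1 (r/2 * V u)) \<partial>\<mu>)" by (rule scaled[OF r2, symmetric])
      also have "\<dots> \<le> (\<integral>\<^sup>+u. ennreal (W u) + ennreal (r/2) * ennreal (W u * gauss_abs 0 (V u)) \<partial>\<mu>)"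
      proof (intro nn_integral_mono)
        fix u
        have "gauss_abs 1 (r/2 * V u) \<le> 1 + r/2 * gauss_abs 0 (V u)"
          using gauss_abs_le[of 1 "r/2 * V u"] gauss_abs_scale[of "r/2" 0 "V u"] that by simp
        then have "W u * gauss_abs 1 (r/2 * V u) \<le> W u * (1 + r/2 * gauss_abs 0 (V u))"
          by (rule mult_left_mono) (rule WV)
        also have "\<dots> = W u + r/2 * (W u * gauss_abs 0 (V u))" by (simp add: algebra_simps)
        finally have "ennreal (W u * gauss_abs 1 (r/2 * V u)) \<le> ennreal (W u + r/2 * (W u * gauss_abs 0 (V u)))"
          by (rule ennreal_leI)
        also have "\<dots> = ennreal (W u) + ennreal (r/2) * ennreal (W u * gauss_abs 0 (V u))"
          using that WV(3)[of u] gauss_abs_nonneg[of 0 "V u"] by (subst ennreal_plus) (auto simp: ennreal_mult'[symmetric])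
        finally show "ennreal (W u * gauss_abs 1 (r/2 * V u)) \<le> ennreal (W u) + ennreal (r/2) * ennreal (W u * gauss_abs 0 (V u))" .
      qed
      also have "\<dots> = ennreal w + ennreal (r/2) * ennreal (\<phi> 0)"
        unfolding w(1)[symmetric] base[symmetric]
        by (subst nn_integral_add) (auto intro!: arg_cong2[where f="(+)"] nn_integral_cmult)
      also have "\<dots> = ennreal (w + r/2)"
        using w that nrm10 by (simp add: \<phi>_def)
      finally show ?thesis using w that by (subst (asm) ennreal_le_iff) auto
    qed
    then have "1 \<le> w" by (rule field_le_epsilon)
    ultimately show ?thesis using w by simp
  qed
  have final: "(\<integral>\<^sup>+u. ennreal (W u * gauss_abs t (r * V u)) \<partial>\<mu>) = ennreal (nrm r t)" if "r \<ge> 0" for r t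
  proof (cases "r = 0")
    case True
    have "gauss_abs t 0 = \<bar>t\<bar>"
      using prob_space.prob_space[OF prob_space_normal_density, of 1 0] by (simp add: gauss_abs_def)
    then have "(\<integral>\<^sup>+u. ennreal (W u * gauss_abs t (r * V u)) \<partial>\<mu>) = (\<integral>\<^sup>+u. ennreal (W u) * ennreal \<bar>t\<bar> \<partial>\<mu>)"
      using True WV by (simp add: ennreal_mult')
    also have "\<dots> = ennreal \<bar>t\<bar>" by (subst nn_integral_multc) (auto simp: W1)
    finally show ?thesis using True nrm01 by simp
  qed (use scaled that in simp)
  show ?thesis by (rule that[OF \<mu> WV final])
qed

subsection \<open>The characterisation\<close>

text \<open>\<open>X 0\<close> carries the common random factor, the \<open>X (Suc i)\<close> are
  the Gaussian variables. With \<open>X 0 = u\<close> fixed, independence leaves a Gaussian sum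
  whose deviation is \<open>V u\<close> times the Euclidean norm of the coefficients, and
  \<open>W u\<close> factors out of the modulus.\<close>

lemma (in prob_space) nn_integral_gaussian_mixture_functional:
  fixes X :: "nat \<Rightarrow> 'a \<Rightarrow> real" and W V :: "real \<Rightarrow> real"
  assumes ind: "indep_vars (\<lambda>_. borel) X UNIV"
    and law: "\<And>i. distr M borel (X (Suc i)) = std_normal_distribution"
    and [measurable]: "W \<in> borel_measurable borel" "V \<in> borel_measurable borel"
    and pos: "\<And>u. W u \<ge> 0" "\<And>u. V u \<ge> 0"
  shows "(\<integral>\<^sup>+x. ennreal \<bar>t * W (X 0 x) + (\<Sum>i<n. a i * (W (X 0 x) * V (X 0 x) * X (Suc i) x))\<bar> \<partial>M) =
    (\<integral>\<^sup>+u. ennreal (W u * gauss_abs t (sqrt (\<Sum>i<n. (a i)\<^sup>2) * V u)) \<partial>distr M borel (X 0))"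
proof -
  have X: "X i \<in> borel_measurable M" for i using ind unfolding indep_vars_def by blast
  note [measurable] = X
  define S where "S x = (\<Sum>i<n. a i * X (Suc i) x)" for x
  have Sm: "S \<in> borel_measurable M" unfolding S_def by measurable
  note [measurable] = Sm
  \<comment> \<open>The coefficients are absorbed into the variables because
    \<open>indep_vars_sum\<close> speaks of plain sums; index 0 keeps the factor 1 and index
    \<open>Suc i\<close> receives \<open>a i\<close>.\<close>
  define Y where "Y j = (\<lambda>x. (if j = 0 then 1 else a (j - 1)) * X j x)" for j
  have "indep_vars (\<lambda>_. borel) (\<lambda>j x. (if j = 0 then 1 else a (j - 1)) * X j x) UNIV"
    by (rule indep_vars_compose2[OF ind, where Y="\<lambda>j y. (if j = 0 then 1 else a (j - 1)) * y"]) measurable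
  then have Yind: "indep_vars (\<lambda>_. borel) Y (insert 0 (Suc ` {..<n}))"
    unfolding Y_def[abs_def] by (rule indep_vars_subset) simp
  have "indep_var borel (Y 0) borel (\<lambda>x. \<Sum>j\<in>Suc ` {..<n}. Y j x)"
    by (rule indep_vars_sum) (use Yind in auto)
  moreover have "Y 0 = X 0" by (simp add: Y_def)
  moreover have "(\<lambda>x. \<Sum>j\<in>Suc ` {..<n}. Y j x) = S"
    by (rule ext, subst sum.reindex) (auto simp: Y_def S_def)
  ultimately have iv: "indep_var borel (X 0) borel S" by simp
  interpret X0: prob_space "distr M borel (X 0)" by (rule prob_space_distr) measurable
  interpret SS: prob_space "distr M borel S" by (rule prob_space_distr) measurable
  interpret P: pair_sigma_finite "distr M borel (X 0)" "distr M borel S" ..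
  have joint: "distr M borel (X 0) \<Otimes>\<^sub>M distr M borel S = distr M (borel \<Otimes>\<^sub>M borel) (\<lambda>x. (X 0 x, S x))"
    using iv by (simp add: indep_var_distribution_eq)
  define h where "h = (\<lambda>p. ennreal (W (fst p) * \<bar>t + V (fst p) * snd p\<bar>))"
  have h: "h \<in> borel_measurable (borel \<Otimes>\<^sub>M borel)" unfolding h_def by measurable
  have "(\<integral>\<^sup>+x. ennreal \<bar>t * W (X 0 x) + (\<Sum>i<n. a i * (W (X 0 x) * V (X 0 x) * X (Suc i) x))\<bar> \<partial>M) =
    (\<integral>\<^sup>+x. h (X 0 x, S x) \<partial>M)"
  proof (rule nn_integral_cong)
    fix x
    have "t * W (X 0 x) + (\<Sum>i<n. a i * (W (X 0 x) * V (X 0 x) * X (Suc i) x)) = W (X 0 x) * (t + V (X 0 x) * S x)"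
      by (simp add: S_def sum_distrib_left distrib_left mult_ac)
    then show "ennreal \<bar>t * W (X 0 x) + (\<Sum>i<n. a i * (W (X 0 x) * V (X 0 x) * X (Suc i) x))\<bar> = h (X 0 x, S x)"
      using pos by (simp add: h_def abs_mult)
  qed
  also have "\<dots> = (\<integral>\<^sup>+p. h p \<partial>distr M (borel \<Otimes>\<^sub>M borel) (\<lambda>x. (X 0 x, S x)))"
    by (rule nn_integral_distr[symmetric]) (use h in measurable)
  also have "\<dots> = (\<integral>\<^sup>+p. h p \<partial>(distr M borel (X 0) \<Otimes>\<^sub>M distr M borel S))" unfolding joint ..
  also have "\<dots> = (\<integral>\<^sup>+u. \<integral>\<^sup>+s. h (u, s) \<partial>distr M borel S \<partial>distr M borel (X 0))"
  proof (rule SS.nn_integral_fst[symmetric])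
    show "h \<in> borel_measurable (distr M borel (X 0) \<Otimes>\<^sub>M distr M borel S)"
      using h by (subst measurable_cong_sets[OF sets_pair_measure_cong refl]) auto
  qed
  also have "\<dots> = (\<integral>\<^sup>+u. ennreal (W u * gauss_abs t (sqrt (\<Sum>i<n. (a i)\<^sup>2) * V u)) \<partial>distr M borel (X 0))"
  proof (rule nn_integral_cong)
    fix u
    have "(\<integral>\<^sup>+s. h (u, s) \<partial>distr M borel S) = (\<integral>\<^sup>+x. h (u, S x) \<partial>M)"
      by (rule nn_integral_distr) (auto simp: h_def)
    also have "\<dots> = (\<integral>\<^sup>+x. ennreal (W u) * ennreal \<bar>t + (\<Sum>i<n. (V u * a i) * X (Suc i) x)\<bar> \<partial>M)"
      using pos by (intro nn_integral_cong) (simp add: h_def ennreal_mult' S_def sum_distrib_left mult.assoc)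
    also have "\<dots> = ennreal (W u) * (\<integral>\<^sup>+x. ennreal \<bar>t + (\<Sum>i<n. (V u * a i) * X (Suc i) x)\<bar> \<partial>M)"
      by (rule nn_integral_cmult) measurable
    also have "(\<integral>\<^sup>+x. ennreal \<bar>t + (\<Sum>i<n. (V u * a i) * X (Suc i) x)\<bar> \<partial>M) =
        (\<integral>\<^sup>+x. ennreal \<bar>t + (\<Sum>j\<in>Suc ` {..<n}. (V u * a (j - 1)) * X j x)\<bar> \<partial>M)"
      by (subst sum.reindex) auto
    also have "\<dots> = ennreal (gauss_abs t (sqrt (\<Sum>j\<in>Suc ` {..<n}. (V u * a (j - 1))\<^sup>2)))"
      by (rule nn_integral_abs_sum_std_normal) (use indep_vars_subset[OF ind] law in auto)
    also have "(\<Sum>j\<in>Suc ` {..<n}. (V u * a (j - 1))\<^sup>2) = (\<Sum>i<n. (V u * a i)\<^sup>2)"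
      by (subst sum.reindex) auto
    also have "sqrt (\<Sum>i<n. (V u * a i)\<^sup>2) = sqrt (\<Sum>i<n. (a i)\<^sup>2) * V u"
      using pos by (simp add: power_mult_distrib sum_distrib_left[symmetric] real_sqrt_mult)
    finally show "(\<integral>\<^sup>+s. h (u, s) \<partial>distr M borel S) = ennreal (W u * gauss_abs t (sqrt (\<Sum>i<n. (a i)\<^sup>2) * V u))"
      using pos by (simp add: ennreal_mult')
  qed
  finally show ?thesis .
qed

lemma L1_functions_of_gaussian_mixture:
  fixes nrm :: "real \<Rightarrow> real \<Rightarrow> real" and W V :: "real \<Rightarrow> real"
  assumes \<mu>: "real_distribution \<mu>" and WV: "W \<in> borel_measurable borel" "V \<in> borel_measurable borel"
    and pos: "\<And>u. W u \<ge> 0" "\<And>u. V u \<ge> 0"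
    and mix: "\<And>r t. r \<ge> 0 \<Longrightarrow> (\<integral>\<^sup>+u. ennreal (W u * gauss_abs t (r * V u)) \<partial>\<mu>) = ennreal (nrm r t)"
    and nrm_nonneg: "\<And>r t. nrm r t \<ge> 0"
  obtains F0 F where "integrable unit_interval F0" "\<And>i::nat. integrable unit_interval (F i)"
    "\<And>n a t. (LINT x|unit_interval. \<bar>t * F0 x + (\<Sum>i<n. a i * F i x)\<bar>) = nrm (sqrt (\<Sum>i<n. (a i)\<^sup>2)) t"
proof -
  interpret prob_space unit_interval by (rule prob_space_unit_interval)
  have rd: "real_distribution (if j = 0 then \<mu> else std_normal_distribution)" for j :: nat
    using \<mu> real_dist_normal_dist by simp
  obtain X :: "nat \<Rightarrow> real \<Rightarrow> real" where ind: "indep_vars (\<lambda>_. borel) X UNIV"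
    and law: "\<And>j. distr unit_interval borel (X j) = (if j = 0 then \<mu> else std_normal_distribution)"
    and Xm: "\<And>j. X j \<in> borel_measurable unit_interval"
    by (rule ex_indep_vars_unit_interval[of "\<lambda>j. if j = 0 then \<mu> else std_normal_distribution", OF rd], rule that)
  note [measurable] = Xm WV
  define F0 where "F0 x = W (X 0 x)" for x
  define F where "F i x = W (X 0 x) * V (X 0 x) * X (Suc i) x" for i x
  have m: "F0 \<in> borel_measurable unit_interval" "F i \<in> borel_measurable unit_interval" for i
    unfolding F0_def F_def by measurable
  note [measurable] = m
  have nn: "(\<integral>\<^sup>+x. ennreal \<bar>t * F0 x + (\<Sum>i<n. a i * F i x)\<bar> \<partial>unit_interval) = ennreal (nrm (sqrt (\<Sum>i<n. (a i)\<^sup>2)) t)"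
    for n :: nat and a :: "nat \<Rightarrow> real" and t :: real
  proof -
    have "(\<integral>\<^sup>+x. ennreal \<bar>t * F0 x + (\<Sum>i<n. a i * F i x)\<bar> \<partial>unit_interval) =
      (\<integral>\<^sup>+u. ennreal (W u * gauss_abs t (sqrt (\<Sum>i<n. (a i)\<^sup>2) * V u)) \<partial>distr unit_interval borel (X 0))"
      unfolding F0_def F_def
      by (rule nn_integral_gaussian_mixture_functional[OF ind _ WV pos]) (simp add: law)
    also have "\<dots> = ennreal (nrm (sqrt (\<Sum>i<n. (a i)\<^sup>2)) t)"
      unfolding law[of 0, simplified] by (rule mix) (simp add: sum_nonneg)
    finally show ?thesis .
  qed
  show ?thesis
  proof (rule that)
    \<comment> \<open>Integrability is read off from the norm identity itself: \<open>F0\<close> is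
      the combination with \<open>t = 1\<close> and no further terms, \<open>F i\<close> the one
      with \<open>t = 0\<close> and a single unit coefficient.\<close>
    show "integrable unit_interval F0"
      by (rule integrableI_bounded) (use nn[of 1 "\<lambda>_. 0" 0] in simp_all)
    show "integrable unit_interval (F i)" for i
    proof (rule integrableI_bounded)
      have "0 * F0 x + (\<Sum>j<Suc i. of_bool (j = i) * F j x) = F i x" for x
        by (simp add: of_bool_def if_distrib[of "\<lambda>c. c * _"] cong: if_cong)
      then show "(\<integral>\<^sup>+x. ennreal (norm (F i x)) \<partial>unit_interval) < \<infinity>"
        using nn[of 0 "\<lambda>j. of_bool (j = i)" "Suc i"] by simp
    qed (rule m)
    fix n and a :: "nat \<Rightarrow> real" and t
    have "(LINT x|unit_interval. \<bar>t * F0 x + (\<Sum>i<n. a i * F i x)\<bar>) =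
      enn2real (\<integral>\<^sup>+x. ennreal \<bar>t * F0 x + (\<Sum>i<n. a i * F i x)\<bar> \<partial>unit_interval)"
      by (rule integral_eq_nn_integral) auto
    then show "(LINT x|unit_interval. \<bar>t * F0 x + (\<Sum>i<n. a i * F i x)\<bar>) = nrm (sqrt (\<Sum>i<n. (a i)\<^sup>2)) t"
      unfolding nn using nrm_nonneg by simp
  qed
qed

theorem theorem2p4:
  fixes N :: "real^2 \<Rightarrow> real" and \<phi> :: "real \<Rightarrow> real"
  assumes "is_norm N"
    and "sign_symmetric N (axis 1 1) (axis 2 1)"
    and "N (axis 1 1) = 1" and "N (axis 2 1) = 1"
    and "N differentiable (at (axis 2 1))"
    and "\<phi> = (\<lambda>t. N (axis 1 1 + t *\<^sub>R axis 2 1))"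
    and "C2_real \<phi>"
  shows "L1_subspace (H_norm N) \<longleftrightarrow>
    completely_monotone_closed (\<lambda>t. deriv (deriv \<phi>) (sqrt t))"
proof -
  define nrm where "nrm r t = N (r *\<^sub>R axis 1 1 + t *\<^sub>R axis 2 1)" for r t
  have Nsc: "N (c *\<^sub>R x) = \<bar>c\<bar> * N x" and Ntri: "N (x + y) \<le> N x + N y" and N0: "N 0 = 0" for c x y
    using assms(1) unfolding is_norm_def by auto
  have N_nonneg: "N x \<ge> 0" for x
    using Ntri[of x "- x"] Nsc[of "-1" x] N0 by simp
  have \<phi>: "\<phi> = nrm 1" by (auto simp: assms(6) nrm_def)
  have lip: "\<bar>nrm r t - nrm r' t\<bar> \<le> \<bar>r - r'\<bar>" for r r' t
    unfolding nrm_def by (rule is_norm_lipschitz[OF assms(1,3)])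
  have C2: "\<phi> differentiable_on UNIV" "deriv \<phi> differentiable_on UNIV" "continuous_on UNIV (deriv (deriv \<phi>))"
    using assms(7) unfolding C2_real_def by auto
  have d1: "(\<phi> has_real_derivative deriv \<phi> x) (at x)" and d2: "(deriv \<phi> has_real_derivative deriv (deriv \<phi>) x) (at x)" for x
    using C2(1,2) differentiable_on_eq_differentiable_at[OF open_UNIV, of \<phi>]
      differentiable_on_eq_differentiable_at[OF open_UNIV, of "deriv \<phi>"]
    by (auto simp: DERIV_deriv_iff_real_differentiable)
  \<comment> \<open>Right-continuity at 0 comes from continuity of the second derivative, so both
    directions reduce to the open half-line.\<close>
  have cont: "continuous (at_right 0) (\<lambda>t. deriv (deriv \<phi>) (sqrt t))"
  proof -
    have "continuous_on UNIV (\<lambda>t. deriv (deriv \<phi>) (sqrt t))"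
      by (rule continuous_on_compose2[OF C2(3)]) (auto intro!: continuous_intros)
    then have "continuous (at (0::real)) (\<lambda>t. deriv (deriv \<phi>) (sqrt t))"
      by (simp add: continuous_on_eq_continuous_at)
    then show ?thesis by (rule continuous_within_subset) simp
  qed
  show ?thesis
  proof
    assume L: "L1_subspace (H_norm N)"
    show "completely_monotone_closed (\<lambda>t. deriv (deriv \<phi>) (sqrt t))"
    proof (rule H_norm_isometry_imp_functions[OF L])
      fix F0 :: "real \<Rightarrow> real" and F :: "nat \<Rightarrow> real \<Rightarrow> real"
      assume F: "integrable unit_interval F0" "\<And>i. integrable unit_interval (F i)"
        and iso: "\<And>n a t. (LINT x|unit_interval. \<bar>t * F0 x + (\<Sum>i<n. a i * F i x)\<bar>) =
          N (sqrt (\<Sum>i<n. (a i)\<^sup>2) *\<^sub>R axis 1 1 + t *\<^sub>R axis 2 1)"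
      have "cm_curvature (nrm 1)"
        by (rule cm_curvature_of_L1_isometry[where nrm=nrm, OF F _ lip]) (unfold nrm_def, rule iso)
      then have "completely_monotone_open (\<lambda>t. deriv (deriv \<phi>) (sqrt t))"
        unfolding \<phi> by (rule cm_curvature_imp_deriv)
      then show ?thesis unfolding completely_monotone_closed_def using cont by blast
    qed
  next
    assume "completely_monotone_closed (\<lambda>t. deriv (deriv \<phi>) (sqrt t))"
    then have cm: "completely_monotone_open (\<lambda>t. deriv (deriv \<phi>) (sqrt t))"
      unfolding completely_monotone_closed_def by blast
    have even: "\<phi> (- t) = \<phi> t" for t
    proof -
      \<comment> \<open>Sign symmetry flips the first coordinate and homogeneity with factor -1
        flips both; together they flip the second.\<close>
      have "N (- (- 1) *\<^sub>R axis 1 1 + (- t) *\<^sub>R axis 2 1) = N ((- 1) *\<^sub>R axis 1 1 + (- t) *\<^sub>R axis 2 1)"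
        using assms(2) unfolding sign_symmetric_def by blast
      also have "(- 1) *\<^sub>R axis 1 1 + (- t) *\<^sub>R axis 2 1 = (- 1) *\<^sub>R (axis 1 1 + t *\<^sub>R axis 2 1 :: real^2)"
        by (simp add: algebra_simps)
      also have "N \<dots> = N (axis 1 1 + t *\<^sub>R axis 2 1)" by (simp only: Nsc)
      finally show ?thesis by (simp add: assms(6))
    qed
    have asym: "((\<lambda>t. \<phi> t - t) \<longlongrightarrow> 0) at_top"
      unfolding assms(6) by (rule smooth_norm_asymptotics[OF assms(1,2,4,5)])
    have hom: "nrm (c * r) (c * t) = c * nrm r t" if "c \<ge> 0" for c r t
    proof -
      have "(c * r) *\<^sub>R axis 1 1 + (c * t) *\<^sub>R axis 2 1 = c *\<^sub>R (r *\<^sub>R axis 1 1 + t *\<^sub>R axis 2 1 :: real^2)"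
        by (simp add: algebra_simps)
      then show ?thesis using that by (simp only: nrm_def Nsc abs_of_nonneg)
    qed
    have nrm10: "nrm 1 0 = 1" and nrm01: "nrm 0 t = \<bar>t\<bar>" and nrm_nonneg: "nrm r t \<ge> 0" for r t
      using assms(3,4) N_nonneg by (simp_all add: nrm_def Nsc)
    show "L1_subspace (H_norm N)"
    proof (rule cm_curvature_gaussian_mixture[OF d1[unfolded \<phi>] d2[unfolded \<phi>] C2(3)[unfolded \<phi>] even[unfolded \<phi>]
          asym[unfolded \<phi>] hom lip nrm10 nrm01 nrm_nonneg cm[unfolded \<phi>]])
      fix \<mu> W V
      assume \<mu>: "real_distribution \<mu>" and WV: "W \<in> borel_measurable borel" "V \<in> borel_measurable borel"
        and pos: "\<And>u. W u \<ge> 0" "\<And>u. V u \<ge> 0"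
        and mix: "\<And>r t. r \<ge> 0 \<Longrightarrow> (\<integral>\<^sup>+u. ennreal (W u * gauss_abs t (r * V u)) \<partial>\<mu>) = ennreal (nrm r t)"
      show ?thesis
      proof (rule L1_functions_of_gaussian_mixture[OF \<mu> WV pos mix nrm_nonneg])
        fix F0 :: "real \<Rightarrow> real" and F :: "nat \<Rightarrow> real \<Rightarrow> real"
        assume F: "integrable unit_interval F0" "\<And>i. integrable unit_interval (F i)"
          and iso: "\<And>n a t. (LINT x|unit_interval. \<bar>t * F0 x + (\<Sum>i<n. a i * F i x)\<bar>) = nrm (sqrt (\<Sum>i<n. (a i)\<^sup>2)) t"
        show ?thesis
        proof (rule H_norm_isometryI[OF assms(1,3,4)])
          fix n :: nat and a :: "nat \<Rightarrow> real" and t :: real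
          have "t *\<^sub>R abs_L1_01 F0 + (\<Sum>i<n. a i *\<^sub>R abs_L1_01 (F i)) = abs_L1_01 (\<lambda>x. t * F0 x + (\<Sum>i<n. a i * F i x))"
            using F by (simp add: abs_L1_01_scaleR abs_L1_01_sum abs_L1_01_add)
          then show "norm (t *\<^sub>R abs_L1_01 F0 + (\<Sum>i<n. a i *\<^sub>R abs_L1_01 (F i))) =
            N (sqrt (\<Sum>i<n. (a i)\<^sup>2) *\<^sub>R axis 1 1 + t *\<^sub>R axis 2 1)"
            using F iso by (simp add: norm_abs_L1_01 nrm_def)
        qed
      qed
    qed
  qed
qed

end
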